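(* For each fixed pair of real numbers $\alpha$ and $\beta$ with $\beta>0$, the random process $G_{q,\alpha,\beta}$ converges in distribution (as a random element of $\mathscr C[0,1]$) to $G_{\alpha,\beta}$ as $q\to\infty$ along the primes.
   Context: Notation: $e(x)=e^{2\pi i x}$; $\mathscr C[0,1]$ is the space of continuous complex-valued functions on $[0,1]$ with the supremum norm. For an odd prime $q$, $\chi_q$ is the quadratic character mod $q$ (Legendre symbol) and $\tau(\chi_q)=\sum_{a=1}^{q}\chi_q(a)e(a/q)$ is its Gauss sum. $G_{q,\alpha,\beta}$ is the $\mathscr C[0,1]$-valued random process obtained by choosing $k\in\{0,1,\dots,q-1\}$ uniformly at random and forming the function $$t\mapsto\frac1{\tau(\chi_q)}\sum_{\alpha q<n\le(\alpha+\beta)q}\chi_q(n)\,e(n(k+t)/q),\qquad t\in[0,1].$$ The limiting process is $$G_{\alpha,\beta}(t)=\frac{e(\alpha t)}{2\pi i}\sum_{l\in\mathbb Z}\frac{e(\alpha l)\,(e(\beta(l+t))-1)}{l+t}\,\mathbb Y(l),$$ where $\mathbb Y(l)$, $l\in\mathbb Z$, are independent random variables uniformly distributed on $\{-1,1\}$. The sum is the limit of symmetric partial sums, and $(e(\beta(l+t))-1)/(l+t)$ is read as $2\pi i\beta$ when $l+t=0$. This process is almost surely continuous. *)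

theory Defs
  imports "HOL-Probability.Probability" "HOL-Number_Theory.Number_Theory"
begin

text \<open>
  The unit interval as a metric space of its own, so that the library's bounded continuous
  functions \<open>unit_interval \<Rightarrow>\<^sub>C complex\<close>, whose distance is the supremum distance, are the space
  of continuous complex-valued functions on \<open>[0, 1]\<close>. Boundedness is automatic by compactness,
  see \<open>bcontfun_unit_interval\<close> below.
\<close>

typedef unit_interval = "{0..1 :: real}"
  morphisms coord Unit_interval
  by (rule exI[of _ 0]) simp

instantiation unit_interval :: metric_space
begin

definition dist_unit_interval :: "unit_interval \<Rightarrow> unit_interval \<Rightarrow> real"
  where "dist_unit_interval s t = dist (coord s) (coord t)"

definition uniformity_unit_interval :: "(unit_interval \<times> unit_interval) filter"
  where "uniformity_unit_interval = (INF e\<in>{0<..}. principal {(s, t). dist s t < e})"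

definition open_unit_interval :: "unit_interval set \<Rightarrow> bool"
  where "open_unit_interval U = (\<forall>s\<in>U. \<forall>\<^sub>F (s', t) in uniformity. s' = s \<longrightarrow> t \<in> U)"

instance
proof
  fix s t u :: unit_interval
  show "dist s t = 0 \<longleftrightarrow> s = t"
    by (simp add: dist_unit_interval_def coord_inject)
  show "dist s t \<le> dist s u + dist t u"
    unfolding dist_unit_interval_def by (rule dist_triangle2)
qed (rule uniformity_unit_interval_def open_unit_interval_def)+

end

type_synonym C01 = "unit_interval \<Rightarrow>\<^sub>C complex"

lemma continuous_on_coord: "continuous_on UNIV coord"
  unfolding continuous_on_iff by (auto simp: dist_unit_interval_def)

lemma bcontfun_unit_interval:
  fixes f :: "real \<Rightarrow> complex"
  assumes "continuous_on {0..1} f"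
  shows "(\<lambda>t. f (coord t)) \<in> bcontfun"
proof -
  have "continuous_on UNIV (f \<circ> coord)"
    by (rule continuous_on_compose[OF continuous_on_coord])
       (rule continuous_on_subset[OF assms], use coord in auto)
  moreover have "bounded (f ` {0..1})"
    by (intro compact_imp_bounded compact_continuous_image assms) simp
  then have "bounded (range (f \<circ> coord))"
    by (rule bounded_subset) (use coord in auto)
  ultimately show ?thesis
    by (simp add: bcontfun_def comp_def)
qed

definition e :: "real \<Rightarrow> complex"
  where "e x = exp (2 * of_real pi * \<i> * of_real x)"

definition gauss_sum :: "nat \<Rightarrow> complex"
  where "gauss_sum q = (\<Sum>a = 1..q. of_int (Legendre (int a) (int q)) * e (real a / real q))"

definition G_finite_path :: "nat \<Rightarrow> real \<Rightarrow> real \<Rightarrow> nat \<Rightarrow> real \<Rightarrow> complex"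
  where "G_finite_path q \<alpha> \<beta> k t = 1 / gauss_sum q *
     (\<Sum>n\<in>{n :: int. \<alpha> * real q < of_int n \<and> of_int n \<le> (\<alpha> + \<beta>) * real q}.
        of_int (Legendre n (int q)) * e (of_int n * (real k + t) / real q))"

definition G_finite :: "nat \<Rightarrow> real \<Rightarrow> real \<Rightarrow> nat \<Rightarrow> C01"
  where "G_finite q \<alpha> \<beta> k = Bcontfun (\<lambda>t. G_finite_path q \<alpha> \<beta> k (coord t))"

lemma apply_G_finite: "apply_bcontfun (G_finite q \<alpha> \<beta> k) t = G_finite_path q \<alpha> \<beta> k (coord t)"
proof -
  have "continuous_on {0..1} (G_finite_path q \<alpha> \<beta> k)"
    unfolding G_finite_path_def e_def divide_inverse by (intro continuous_intros)
  then show ?thesis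
    by (simp add: G_finite_def Bcontfun_inverse bcontfun_unit_interval)
qed

definition kernel :: "real \<Rightarrow> real \<Rightarrow> complex"
  where "kernel \<beta> x =
    (if x = 0 then 2 * of_real pi * \<i> * of_real \<beta> else (e (\<beta> * x) - 1) / of_real x)"

definition G_partial :: "real \<Rightarrow> real \<Rightarrow> (int \<Rightarrow> real) \<Rightarrow> nat \<Rightarrow> real \<Rightarrow> complex"
  where "G_partial \<alpha> \<beta> y N t = e (\<alpha> * t) / (2 * of_real pi * \<i>) *
    (\<Sum>l = - int N..int N. e (\<alpha> * of_int l) * kernel \<beta> (of_int l + t) * of_real (y l))"

text \<open>
  The limiting path for a given choice \<open>y\<close> of signs. The symmetric partial sums have a continuous
  pointwise limit on \<open>[0, 1]\<close> for almost every choice of independent uniform signs; the value \<open>0\<close>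
  on the exceptional null set is immaterial.
\<close>

definition G_limit :: "real \<Rightarrow> real \<Rightarrow> (int \<Rightarrow> real) \<Rightarrow> C01"
  where "G_limit \<alpha> \<beta> y =
    (if \<exists>g :: C01. \<forall>t. (\<lambda>N. G_partial \<alpha> \<beta> y N (coord t)) \<longlonglongrightarrow> apply_bcontfun g t
     then THE g :: C01. \<forall>t. (\<lambda>N. G_partial \<alpha> \<beta> y N (coord t)) \<longlonglongrightarrow> apply_bcontfun g t
     else 0)"

text \<open>
  Convergence in distribution of random elements of a metric space along a filter. The random
  elements may live on different probability spaces.
\<close>

definition converges_in_distribution ::
  "('i \<Rightarrow> 'a measure) \<Rightarrow> ('i \<Rightarrow> 'a \<Rightarrow> 'b :: metric_space) \<Rightarrow> 'c measure \<Rightarrow> ('c \<Rightarrow> 'b) \<Rightarrow> 'i filter \<Rightarrow> bool"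
  where "converges_in_distribution M X N Z F \<longleftrightarrow>
    (\<forall>\<^sub>F i in F. X i \<in> borel_measurable (M i)) \<and> Z \<in> borel_measurable N \<and>
    (\<forall>\<phi> :: 'b \<Rightarrow> real. continuous_on UNIV \<phi> \<and> bounded (range \<phi>) \<longrightarrow>
       ((\<lambda>i. \<integral>x. \<phi> (X i x) \<partial>M i) \<longlongrightarrow> (\<integral>z. \<phi> (Z z) \<partial>N)) F)"

end

theory Submission
  imports Defs "Berlekamp_Zassenhaus.Finite_Field"
begin

text \<open>
Write \<open>\<chi>\<close> for the quadratic character modulo \<open>q\<close>. Expanding \<open>\<chi>(n)\<close> through the Gauss sum turns the
random function into a sum over a complete residue system, \<open>\<Sum>\<close> over \<open>\<bar>l\<bar> \<le> (q - 1) / 2\<close> of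
\<open>\<chi>(k - l) c_q(l + t)\<close>, in which \<open>c_q(x)\<close> is \<open>1 / q\<close> times the sum of \<open>e(n x / q)\<close> over the
given range of \<open>n\<close>. This is a Riemann sum for the integral \<open>c(x)\<close> of \<open>e(u x)\<close> over
\<open>\<alpha> \<le> u \<le> \<alpha> + \<beta>\<close>, and the limit process is the sum of the \<open>c(l + t) Y(l)\<close>. So two things have to be
seen: finitely many of the signs \<open>\<chi>(k - l)\<close>, for random \<open>k\<close>, behave like independent signs, and the
terms with large \<open>\<bar>l\<bar>\<close> are small uniformly in \<open>q\<close> and \<open>t\<close>.

For the first, expand a function of finitely many signs into products of signs
(\<open>walsh_expansion\<close>). It then suffices that the average over \<open>k\<close> of a product of \<open>\<chi>(k - l)\<close> over a
nonempty finite set of \<open>l\<close> tends to \<open>0\<close>. The product is \<open>\<chi>(f(k))\<close> for a polynomial \<open>f\<close> with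
distinct roots. Stepanov's method bounds the number of \<open>k\<close> at which \<open>f(k)\<close> is a square: a nonzero
polynomial of degree about \<open>c p\<close> is constructed that vanishes to order \<open>2 c\<close> at all these \<open>k\<close>, which
leaves room for \<open>p / 2 + O(p / c)\<close> of them (\<open>stepanov_bound\<close>). The nonsquares obey the same bound,
so both kinds occur about equally often. A fixed, large \<open>c\<close> suffices, since only \<open>o(p)\<close> is wanted.

For the second, \<open>c_q\<close> is a geometric sum, hence \<open>c_q(x)\<close> is \<open>(e(v x) - e(u x)) \<kappa>(x)\<close> with
\<open>\<kappa>(x) = 1 / (q (e(x / q) - 1))\<close>, and \<open>\<kappa>(l + t)\<close> differs from \<open>\<kappa>(l)\<close> by \<open>O(1 / l\<^sup>2)\<close>. Up to this
absolutely summable error the tail is \<open>e(v t) V - e(u t) U\<close> with random \<open>U\<close>, \<open>V\<close> that do not depend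
on \<open>t\<close>, so its supremum over \<open>t\<close> is at most \<open>\<bar>U\<bar> + \<bar>V\<bar>\<close> (\<open>tame_tail_bound\<close>). Since the signs
\<open>\<chi>(k - l)\<close> are nearly orthogonal, the second moments of \<open>U\<close> and \<open>V\<close> are at most the sum of \<open>1 / l\<^sup>2\<close>
over the tail (\<open>expectation_norm_sum_le\<close>). These \<open>L\<^sup>1\<close> bounds on the supremum norm take the place of a
tightness argument.

The same decomposition with \<open>\<kappa>(x) = 1 / (2 \<pi> \<i> x)\<close> describes the limit process: its partial sums
converge at every \<open>t\<close> exactly when two numerical random series converge, and then they converge
uniformly (\<open>G_limit_cases\<close>). This yields both the measurability of the limit process and its almost sure
approximation by partial sums. Finally, bounded Lipschitz functionals suffice to test convergence in
distribution (\<open>converges_in_distribution_lipschitz\<close>), and for these the three approximations combine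
(\<open>lipschitz_functional_tendsto\<close>).
\<close>

hide_const (open) Module.smult Coset.order

section \<open>Stepanov's method\<close>

text \<open>
Bounding the indices of the nonzero coefficients, rather than the degree, gives a vector space of
dimension \<open>n\<close> also for \<open>n = 0\<close>, so over a finite field the number of elements is exactly a power.
\<close>

definition polys_below :: "nat \<Rightarrow> 'a::zero poly set"
  where "polys_below n = {u. \<forall>i\<ge>n. poly.coeff u i = 0}"

lemma polys_below_0 [simp]: "0 \<in> polys_below n"
  by (simp add: polys_below_def)

lemma polys_below_mono: "u \<in> polys_below n \<Longrightarrow> n \<le> n' \<Longrightarrow> u \<in> polys_below n'"
  by (auto simp: polys_below_def)

lemma polys_below_add: "u \<in> polys_below n \<Longrightarrow> v \<in> polys_below n \<Longrightarrow> u + v \<in> polys_below n"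
  by (simp add: polys_below_def)

lemma polys_below_diff:
  fixes u v :: "'a::ab_group_add poly"
  shows "u \<in> polys_below n \<Longrightarrow> v \<in> polys_below n \<Longrightarrow> u - v \<in> polys_below n"
  by (simp add: polys_below_def)

lemma polys_below_smult: "u \<in> polys_below n \<Longrightarrow> smult c u \<in> polys_below n"
  by (simp add: polys_below_def)

lemma polys_below_sum: "(\<And>i. i \<in> I \<Longrightarrow> u i \<in> polys_below n) \<Longrightarrow> (\<Sum>i\<in>I. u i) \<in> polys_below n"
  by (induction I rule: infinite_finite_induct) (auto intro: polys_below_add)

lemma polys_below_mult:
  fixes u v :: "'a::comm_semiring_0 poly"
  assumes "u \<in> polys_below n" "degree v \<le> m"
  shows "v * u \<in> polys_below (n + m)"
  unfolding polys_below_def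
proof (safe)
  fix i assume i: "n + m \<le> i"
  show "poly.coeff (v * u) i = 0"
    unfolding coeff_mult
  proof (rule sum.neutral, safe)
    fix j assume "j \<le> i"
    show "poly.coeff v j * poly.coeff u (i - j) = 0"
    proof (cases "j \<le> m")
      case True
      then have "i - j \<ge> n" using i by simp
      then show ?thesis using assms(1) by (simp add: polys_below_def)
    next
      case False
      then show ?thesis using assms(2) by (simp add: coeff_eq_0)
    qed
  qed
qed

lemma polys_below_degree: "u \<in> polys_below n \<Longrightarrow> degree u \<le> n"
  by (rule degree_le) (auto simp: polys_below_def)

lemma card_polys_below:
  "finite (polys_below n :: 'a::{zero,finite} poly set) \<and> card (polys_below n :: 'a poly set) = CARD('a) ^ n"
proof (induction n)
  case 0
  have "(polys_below 0 :: 'a poly set) = {0}"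
    by (auto simp: polys_below_def poly_eq_iff)
  then show ?case by simp
next
  case (Suc n)
  have eq: "(polys_below (Suc n) :: 'a poly set) = (\<lambda>(a, u). pCons a u) ` (UNIV \<times> polys_below n)"
  proof (safe)
    fix u :: "'a poly" assume u: "u \<in> polys_below (Suc n)"
    obtain a v where av: "u = pCons a v" by (cases u)
    have "v \<in> polys_below n"
      using u unfolding av polys_below_def by (auto simp: coeff_pCons)
    then show "u \<in> (\<lambda>(a, u). pCons a u) ` (UNIV \<times> polys_below n)"
      by (auto simp: av)
  next
    fix a and v :: "'a poly" assume "v \<in> polys_below n"
    then show "pCons a v \<in> polys_below (Suc n)"
      by (auto simp: polys_below_def coeff_pCons split: nat.splits)
  qed
  have inj: "inj_on (\<lambda>(a, u). pCons a u) (UNIV \<times> (polys_below n :: 'a poly set))"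
    by (auto simp: inj_on_def)
  show ?case
    unfolding eq card_image[OF inj] using Suc by (simp add: card_cartesian_product)
qed

text \<open>
The \<open>k\<close>-th derivative of \<open>u * f ^ n\<close> is a polynomial times \<open>f ^ n\<close>, divided by \<open>f ^ k\<close>. This is the
polynomial, with \<open>c\<close> the image of the exponent \<open>n\<close> in the field, see \<open>twisted_pderiv\<close> below. For
\<open>c = 0\<close> it is \<open>f ^ k\<close> times the ordinary derivative.
\<close>

primrec twisted_pderiv :: "'a::idom poly \<Rightarrow> 'a \<Rightarrow> nat \<Rightarrow> 'a poly \<Rightarrow> 'a poly" where
  "twisted_pderiv f c 0 u = u"
| "twisted_pderiv f c (Suc k) u =
     f * pderiv (twisted_pderiv f c k u) + smult (c - of_nat k) (pderiv f * twisted_pderiv f c k u)"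

lemma twisted_pderiv_diff:
  "twisted_pderiv f c k (u - v) = twisted_pderiv f c k u - twisted_pderiv f c k v"
proof (induction k)
  case (Suc k)
  show ?case
    unfolding twisted_pderiv.simps Suc pderiv_diff right_diff_distrib smult_diff_right by simp
qed simp

lemma polys_below_twisted_pderiv:
  assumes "degree f \<le> m" "u \<in> polys_below n"
  shows "twisted_pderiv f c k u \<in> polys_below (n + k * m)"
proof (induction k)
  case (Suc k)
  let ?v = "twisted_pderiv f c k u"
  have 1: "pderiv ?v \<in> polys_below (n + k * m)"
    using Suc by (auto simp: polys_below_def coeff_pderiv)
  have 2: "degree (pderiv f) \<le> m"
    using assms(1) by (intro degree_le) (auto simp: coeff_pderiv coeff_eq_0)
  have "f * pderiv ?v \<in> polys_below (n + k * m + m)"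
    by (rule polys_below_mult[OF 1 assms(1)])
  moreover have "smult (c - of_nat k) (pderiv f * ?v) \<in> polys_below (n + k * m + m)"
    by (rule polys_below_smult[OF polys_below_mult[OF Suc 2]])
  ultimately show ?case
    by (simp add: polys_below_add algebra_simps)
qed (use assms in simp)

lemma twisted_pderiv:
  fixes f :: "'a::idom poly"
  shows "f ^ k * (pderiv ^^ k) (u * f ^ n) = twisted_pderiv f (of_nat n) k u * f ^ n"
proof (induction k)
  case (Suc k)
  let ?D = "(pderiv ^^ k) (u * f ^ n)" and ?T = "twisted_pderiv f (of_nat n) k u"
  have pw: "f * pderiv (f ^ j) = smult (of_nat j) (f ^ j * pderiv f)" for j
    by (cases j) (simp_all only: pderiv_power_Suc, simp_all add: mult_ac del: of_nat_Suc)
  have "f ^ Suc k * pderiv ?D = f * pderiv (f ^ k * ?D) - f * pderiv (f ^ k) * ?D"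
    by (simp add: pderiv_mult algebra_simps)
  also have "f * pderiv (f ^ k * ?D) = f * pderiv ?T * f ^ n + ?T * (f * pderiv (f ^ n))"
    unfolding Suc by (simp add: pderiv_mult algebra_simps)
  also have "f * pderiv (f ^ n) = smult (of_nat n) (f ^ n * pderiv f)"
    by (rule pw)
  also have "f * pderiv (f ^ k) * ?D = smult (of_nat k) (pderiv f * (f ^ k * ?D))"
    by (simp add: pw mult_ac)
  also have "\<dots> = smult (of_nat k) (pderiv f * (?T * f ^ n))"
    unfolding Suc ..
  finally show ?case
    by (simp add: algebra_simps smult_diff_left)
qed simp

lemma higher_pderiv_root_power:
  fixes X h :: "'a::idom poly"
  assumes "pderiv X = 1" "poly X a = 0"
  shows "poly ((pderiv ^^ n) (X ^ n * h)) a = of_nat (fact n) * poly h a"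
proof (induction n arbitrary: h)
  case (Suc n)
  have "pderiv (X ^ Suc n * h) = X ^ n * (smult (of_nat (Suc n)) h + X * pderiv h)"
    by (simp only: pderiv_mult pderiv_power_Suc assms(1))
      (simp add: distrib_left mult_ac del: of_nat_Suc)
  then have "(pderiv ^^ Suc n) (X ^ Suc n * h) =
      (pderiv ^^ n) (X ^ n * (smult (of_nat (Suc n)) h + X * pderiv h))"
    by (simp only: funpow_Suc_right comp_apply)
  then show ?case
    by (simp only: Suc) (simp add: assms(2) algebra_simps)
qed simp

text \<open>
In positive characteristic vanishing derivatives detect a multiplicity only below the
characteristic, where the factorials in the Taylor expansion are units.
\<close>

lemma order_ge_of_higher_pderiv_eq_0:
  fixes u :: "'a::field poly"
  assumes "prime CHAR('a)" "u \<noteq> 0" "l \<le> CHAR('a)"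
    and "\<And>k. k < l \<Longrightarrow> poly ((pderiv ^^ k) u) a = 0"
  shows "l \<le> order a u"
proof (rule ccontr)
  define n where "n = order a u"
  assume "\<not> l \<le> order a u"
  then have n: "n < l" by (simp add: n_def)
  obtain h where h: "u = [:-a, 1:] ^ n * h" "\<not> [:-a, 1:] dvd h"
    using order_decomp[OF assms(2), of a] unfolding n_def by blast
  have "poly h a \<noteq> 0" using h(2) by (simp add: poly_eq_0_iff_dvd)
  moreover have "of_nat (fact n) * poly h a = 0"
    using assms(4)[OF n] higher_pderiv_root_power[of "[:-a, 1:]" a n h]
    by (simp add: h(1)[symmetric] pderiv_pCons)
  moreover have "of_nat (fact n) \<noteq> (0 :: 'a)"
  proof
    assume "of_nat (fact n) = (0 :: 'a)"
    then have "CHAR('a) dvd fact n" by (simp only: of_nat_eq_0_iff_char_dvd)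
    then show False
      using prime_dvd_fact_iff[OF assms(1)] n assms(3) by simp
  qed
  ultimately show False by simp
qed

lemma card_mult_order_le_degree:
  fixes u :: "'a::idom poly"
  assumes "finite S" "u \<noteq> 0" "\<And>a. a \<in> S \<Longrightarrow> l \<le> order a u"
  shows "l * card S \<le> degree u"
  using assms
proof (induction S arbitrary: u rule: finite_induct)
  case (insert a S)
  obtain h where h: "u = [:-a, 1:] ^ order a u * h" "\<not> [:-a, 1:] dvd h"
    using order_decomp[OF insert.prems(1), of a] by blast
  have h0: "h \<noteq> 0" using h(2) by auto
  have "l \<le> order b h" if "b \<in> S" for b
  proof -
    have "b \<noteq> a" using that insert.hyps by auto
    then have "order b ([:-a, 1:] ^ order a u) = 0"
      by (intro order_0I) simp
    moreover have "order b u = order b ([:-a, 1:] ^ order a u) + order b h"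
      by (subst h(1), rule order_mult) (use h insert.prems(1) in simp)
    ultimately show ?thesis using insert.prems(2)[of b] that by simp
  qed
  then have "l * card S \<le> degree h"
    using insert.IH h0 by blast
  moreover have "degree u = order a u + degree h"
    by (subst h(1)) (simp add: degree_mult_eq h0 degree_power_eq)
  moreover have "l \<le> order a u" using insert.prems(2) by simp
  ultimately show ?case using insert.hyps by simp
qed simp

text \<open>
The power \<open>f ^ ((p - 1) div 2)\<close> is a square root of \<open>f ^ p / f\<close>, and modulo \<open>x ^ p\<close> the power
\<open>f ^ p\<close> is the constant \<open>f(0) ^ p\<close>. Multiplying the relation by its conjugate therefore leaves
\<open>r\<^sup>2 f = const * s\<^sup>2\<close> modulo \<open>x ^ p\<close>, which for reasons of degree is an identity of polynomials. But
\<open>f\<close> has a simple root \<open>a\<close>, at which the left hand side has odd order and the right hand side even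
order.
\<close>

lemma dvd_twisted_square:
  fixes f r s :: "'a::field_prime_char poly" and p :: nat
  assumes p: "p = CHAR('a)" "odd p"
    and f: "degree f \<le> m" "poly f 0 \<noteq> 0" "poly f a = 0" "order a f = 1"
    and rs: "r \<in> polys_below d" "s \<in> polys_below d" "2 * d + m \<le> p + 1"
    and dvd: "Polynomial.monom 1 p dvd r + s * f ^ ((p - 1) div 2)"
  shows "r = 0 \<and> s = 0"
proof -
  define g where "g = f ^ ((p - 1) div 2)"
  define C where "C = poly f 0 ^ p"
  have f0: "f \<noteq> 0" using f(2) by auto
  have prime: "prime CHAR('a)" using pos_char_exists CHAR_pos_iff prime_CHAR_semidom by blast
  have C: "C \<noteq> 0" using f(2) by (simp add: C_def)
  have "Suc (2 * ((p - 1) div 2)) = p" using p(2) by (auto elim: oddE)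
  then have gf: "g ^ 2 * f = f ^ p"
    unfolding g_def by (metis mult.commute power_Suc power_mult)
  obtain h where h: "f = [:poly f 0:] + Polynomial.monom 1 1 * h"
    by (cases f) (auto simp: monom_altdef)
  \<comment> \<open>The Frobenius endomorphism removes all middle terms, so only the constant term of \<open>f\<close> survives
    below degree \<open>p\<close>.\<close>
  have "f ^ p = [:poly f 0:] ^ p + (Polynomial.monom 1 1 * h) ^ p"
    by (subst h, rule freshmans_dream) (use prime p in auto)
  also have "[:poly f 0:] ^ p = [:C:]"
    by (simp add: C_def poly_const_pow)
  also have "(Polynomial.monom 1 1 * h) ^ p = Polynomial.monom 1 p * h ^ p"
    by (simp add: power_mult_distrib monom_power)
  finally have fp: "f ^ p = [:C:] + Polynomial.monom 1 p * h ^ p" .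
  have "Polynomial.monom 1 p dvd (r + s * g) * (r - s * g) * f"
    using dvd unfolding g_def by (intro dvd_mult2)
  also have "(r + s * g) * (r - s * g) * f = r ^ 2 * f - s ^ 2 * (g ^ 2 * f)"
    by (simp add: power2_eq_square algebra_simps)
  also have "\<dots> = (r ^ 2 * f - smult C (s ^ 2)) - Polynomial.monom 1 p * (s ^ 2 * h ^ p)"
    unfolding gf fp by (simp add: algebra_simps)
  finally have "Polynomial.monom 1 p dvd r ^ 2 * f - smult C (s ^ 2)"
    by (metis dvd_diff_right_iff dvd_triv_left dvd_diffD diff_add_cancel dvd_add)
  moreover have "r ^ 2 * f - smult C (s ^ 2) = 0 \<or> degree (r ^ 2 * f - smult C (s ^ 2)) < p"
  proof (cases "d = 0")
    case True
    then have "r = 0" "s = 0" using rs(1,2) by (auto simp: polys_below_def poly_eq_iff)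
    then show ?thesis by simp
  next
    case False
    have "degree r \<le> d - 1" "degree s \<le> d - 1"
      using rs(1,2) False by (auto intro!: degree_le simp: polys_below_def)
    then have "degree (r ^ 2) \<le> 2 * (d - 1)" "degree (s ^ 2) \<le> 2 * (d - 1)"
      using degree_power_le[of r 2] degree_power_le[of s 2] by simp_all
    then have "degree (r ^ 2 * f) \<le> 2 * (d - 1) + m" "degree (smult C (s ^ 2)) \<le> 2 * (d - 1) + m"
      using f(1) degree_mult_le[of "r ^ 2" f] C by simp_all
    then have "degree (r ^ 2 * f - smult C (s ^ 2)) \<le> 2 * (d - 1) + m"
      by (rule degree_diff_le)
    then show ?thesis using rs(3) False by arith
  qed
  ultimately have eq: "r ^ 2 * f = smult C (s ^ 2)"
    by (metis degree_monom_eq divides_degree eq_iff_diff_eq_0 linorder_not_le one_neq_zero)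
  show ?thesis
  proof (cases "r = 0 \<or> s = 0")
    case True
    then show ?thesis using eq f0 C by auto
  next
    case False
    have "order a (r ^ 2 * f) = 2 * order a r + 1"
      using False f0 f(4) by (simp add: power2_eq_square order_mult)
    moreover have "order a (smult C (s ^ 2)) = 2 * order a s"
      using False C by (simp add: power2_eq_square order_mult order_smult)
    ultimately have "2 * order a r + 1 = 2 * order a s" using eq by simp
    then show ?thesis by presburger
  qed
qed

text \<open>
Stepanov's auxiliary polynomial. The powers \<open>x ^ (p * j)\<close> have derivative zero, so they behave as
constants under differentiation, and they agree with \<open>x ^ j\<close> at the points of the prime field: the
polynomial has high degree but takes values of low degree.
\<close>

definition stepanov_poly :: "'a::field poly \<Rightarrow> nat \<Rightarrow> nat \<Rightarrow> (nat \<Rightarrow> 'a poly) \<Rightarrow> (nat \<Rightarrow> 'a poly) \<Rightarrow> 'a poly"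
  where "stepanov_poly f p J r s =
    (\<Sum>j<J. (r j + s j * f ^ ((p - 1) div 2)) * Polynomial.monom 1 (p * j))"

text \<open>
If the sum vanishes, its lowest block is divisible by \<open>x ^ p\<close>, hence zero by
\<open>dvd_twisted_square\<close>; divide by \<open>x ^ p\<close> and repeat.
\<close>

lemma stepanov_poly_eq_0:
  fixes f :: "'a::field_prime_char poly" and p :: nat
  assumes p: "p = CHAR('a)" "odd p"
    and f: "degree f \<le> m" "poly f 0 \<noteq> 0" "poly f a = 0" "order a f = 1"
    and d: "2 * d + m \<le> p + 1"
    and "\<And>j. j < J \<Longrightarrow> r j \<in> polys_below d" "\<And>j. j < J \<Longrightarrow> s j \<in> polys_below d"
    and "stepanov_poly f p J r s = 0"
  shows "\<forall>j<J. r j = 0 \<and> s j = 0"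
  using assms(8-)
proof (induction J arbitrary: r s)
  case (Suc J)
  let ?x = "Polynomial.monom (1::'a) p"
  let ?g = "f ^ ((p - 1) div 2)"
  have monom: "Polynomial.monom (1::'a) (p * Suc j) = ?x * Polynomial.monom 1 (p * j)" for j
    by (simp add: mult_monom)
  have split: "stepanov_poly f p (Suc J) r s =
      (r 0 + s 0 * ?g) + ?x * stepanov_poly f p J (\<lambda>j. r (Suc j)) (\<lambda>j. s (Suc j))"
    unfolding stepanov_poly_def sum.lessThan_Suc_shift monom
    by (simp add: sum_distrib_left mult_ac one_pCons[symmetric] monom_0)
  have "r 0 + s 0 * ?g = ?x * (- stepanov_poly f p J (\<lambda>j. r (Suc j)) (\<lambda>j. s (Suc j)))"
    using Suc.prems(3) unfolding split by (simp add: eq_neg_iff_add_eq_0)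
  then have "?x dvd r 0 + s 0 * ?g" by simp
  then have 0: "r 0 = 0 \<and> s 0 = 0"
    using dvd_twisted_square[OF p f _ _ d, of "r 0" "s 0"] Suc.prems(1,2) by simp
  have "?x * stepanov_poly f p J (\<lambda>j. r (Suc j)) (\<lambda>j. s (Suc j)) = 0"
    using Suc.prems(3) unfolding split by (simp add: 0)
  then have "stepanov_poly f p J (\<lambda>j. r (Suc j)) (\<lambda>j. s (Suc j)) = 0"
    by (simp add: monom_eq_0_iff)
  then have "\<forall>j<J. r (Suc j) = 0 \<and> s (Suc j) = 0"
    by (intro Suc.IH) (use Suc.prems in auto)
  then show ?case using 0 by (auto simp: less_Suc_eq_0_disj)
qed simp

lemma pderiv_monom_CHAR [simp]:
  "pderiv (Polynomial.monom (1::'a::idom) (CHAR('a) * j)) = 0"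
  by (simp add: pderiv_monom)

lemma higher_pderiv_mult_monom_CHAR:
  fixes u :: "'a::idom poly"
  shows "(pderiv ^^ k) (u * Polynomial.monom 1 (CHAR('a) * j)) =
    (pderiv ^^ k) u * Polynomial.monom 1 (CHAR('a) * j)"
  by (induction k) (simp_all add: pderiv_mult)

text \<open>
At a point with \<open>f(x) ^ ((p - 1) div 2) = \<epsilon>\<close> the \<open>k\<close>-th derivative of the auxiliary polynomial has,
up to the factor \<open>f(x) ^ k\<close>, the same value as a polynomial of small degree. Requiring that
polynomial to be zero is a system of few linear conditions on the coefficients of \<open>r\<close> and \<open>s\<close>.
\<close>

lemma higher_pderiv_stepanov_poly_eq_0:
  fixes f :: "'a::finite_field poly" and p :: nat
  assumes p: "p = CHAR('a)" "CARD('a) = CHAR('a)"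
    and x: "poly f x \<noteq> 0" "poly f x ^ ((p - 1) div 2) = \<epsilon>"
    and eq: "(\<Sum>j<J. (twisted_pderiv f 0 k (r j) +
        smult \<epsilon> (twisted_pderiv f (of_nat ((p - 1) div 2)) k (s j))) * Polynomial.monom 1 j) = 0"
  shows "poly ((pderiv ^^ k) (stepanov_poly f p J r s)) x = 0"
proof -
  define n where "n = (p - 1) div 2"
  have frob: "x ^ (p * j) = x ^ j" for j
    using finite_field_power_card_eq_same[of x] by (simp add: p power_mult)
  have r: "f ^ k * (pderiv ^^ k) u = twisted_pderiv f 0 k u" for u
    using twisted_pderiv[of f k u 0] by simp
  have "poly f x ^ k * poly ((pderiv ^^ k) (stepanov_poly f p J r s)) x =
      poly (f ^ k * (pderiv ^^ k) (stepanov_poly f p J r s)) x"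
    by simp
  also have "f ^ k * (pderiv ^^ k) (stepanov_poly f p J r s) =
      (\<Sum>j<J. (f ^ k * (pderiv ^^ k) (r j) + f ^ k * (pderiv ^^ k) (s j * f ^ n)) *
         Polynomial.monom 1 (p * j))"
    unfolding stepanov_poly_def p(1) higher_pderiv_sum higher_pderiv_mult_monom_CHAR higher_pderiv_add
    by (simp add: sum_distrib_left distrib_left distrib_right mult.assoc n_def p)
  also have "\<dots> = (\<Sum>j<J. (twisted_pderiv f 0 k (r j) + twisted_pderiv f (of_nat n) k (s j) * f ^ n) *
         Polynomial.monom 1 (p * j))"
    unfolding r twisted_pderiv ..
  also have "poly \<dots> x = poly (\<Sum>j<J. (twisted_pderiv f 0 k (r j) +
        smult \<epsilon> (twisted_pderiv f (of_nat n) k (s j))) * Polynomial.monom 1 j) x"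
    using x(2) unfolding poly_sum n_def[symmetric]
    by (intro sum.cong refl) (simp add: poly_monom frob ac_simps frob[unfolded mult.commute[of p]])
  also have "\<dots> = 0" using eq by (simp add: n_def)
  finally show ?thesis using x(1) by simp
qed

text \<open>
There are \<open>2 d (c + 1)\<close> unknown coefficients and at most \<open>2 c (d + 2 c m + c + 1)\<close> linear
conditions; the hypothesis says that the former is larger. Over a finite field the pigeonhole
principle gives two families with the same image, and their difference is the solution.
\<close>

lemma exists_stepanov_coeffs:
  fixes f :: "'a::finite_field poly" and \<epsilon> :: 'a
  assumes f: "degree f \<le> m" and c: "c * (2 * c * m + c + 1) < d"
  obtains r s where "\<And>j. j < Suc c \<Longrightarrow> r j \<in> polys_below d" "\<And>j. j < Suc c \<Longrightarrow> s j \<in> polys_below d"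
    and "\<exists>j<Suc c. r j \<noteq> 0 \<or> s j \<noteq> 0"
    and "\<And>k. k < 2 * c \<Longrightarrow> (\<Sum>j<Suc c. (twisted_pderiv f 0 k (r j) +
        smult \<epsilon> (twisted_pderiv f b k (s j))) * Polynomial.monom 1 j) = 0"
proof -
  define D where "D = {..<Suc c} \<rightarrow>\<^sub>E ((polys_below d :: 'a poly set) \<times> (polys_below d :: 'a poly set))"
  define R where "R = {..<2 * c} \<rightarrow>\<^sub>E (polys_below (d + 2 * c * m + c + 1) :: 'a poly set)"
  define L where "L w k = (\<Sum>j<Suc c. (twisted_pderiv f 0 k (fst (w j)) +
      smult \<epsilon> (twisted_pderiv f b k (snd (w j)))) * Polynomial.monom 1 j)" for w k
  define \<Phi> where "\<Phi> w = (\<lambda>k\<in>{..<2 * c}. L w k)" for w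
  have q: "CARD('a) > 1"
    using card_mono[of UNIV "{0, 1::'a}"] by simp
  have fin: "finite D" "finite R"
    unfolding D_def R_def using card_polys_below by (auto intro!: finite_PiE)
  have cardD: "card D = CARD('a) ^ (2 * d * Suc c)"
    unfolding D_def by (simp add: card_PiE card_cartesian_product card_polys_below
      del: power_Suc prod.lessThan_Suc mult_Suc_right)
      (simp only: power_add[symmetric] power_mult[symmetric] mult_2)
  have cardR: "card R = CARD('a) ^ ((d + 2 * c * m + c + 1) * (2 * c))"
    unfolding R_def by (simp add: card_PiE card_polys_below del: add_Suc_right)
      (simp only: power_mult[symmetric])
  have maps: "\<Phi> ` D \<subseteq> R"
  proof (safe)
    fix w assume w: "w \<in> D"
    have "L w k \<in> polys_below (d + 2 * c * m + c + 1)" if k: "k < 2 * c" for k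
      unfolding L_def
    proof (rule polys_below_sum)
      fix j assume j: "j \<in> {..<Suc c}"
      have "w j \<in> polys_below d \<times> polys_below d" using w j unfolding D_def by (rule PiE_mem)
      then have 1: "fst (w j) \<in> polys_below d" "snd (w j) \<in> polys_below d" by auto
      have "twisted_pderiv f 0 k (fst (w j)) + smult \<epsilon> (twisted_pderiv f b k (snd (w j)))
          \<in> polys_below (d + k * m)"
        by (intro polys_below_add polys_below_smult polys_below_twisted_pderiv f 1)
      then have "Polynomial.monom 1 j * (twisted_pderiv f 0 k (fst (w j)) +
          smult \<epsilon> (twisted_pderiv f b k (snd (w j)))) \<in> polys_below (d + k * m + j)"
        by (rule polys_below_mult) (simp add: degree_monom_le)
      then show "(twisted_pderiv f 0 k (fst (w j)) + smult \<epsilon> (twisted_pderiv f b k (snd (w j)))) *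
          Polynomial.monom 1 j \<in> polys_below (d + 2 * c * m + c + 1)"
        unfolding mult.commute[of _ "Polynomial.monom 1 j"]
      proof (rule polys_below_mono)
        have "k * m \<le> 2 * c * m" using k by (intro mult_right_mono) auto
        then show "d + k * m + j \<le> d + 2 * c * m + c + 1"
          using j add_mono[of "k * m" "2 * c * m" j c] by (simp del: mult_le_cancel2)
      qed
    qed
    then show "\<Phi> w \<in> R" unfolding \<Phi>_def R_def by auto
  qed
  have "(d + 2 * c * m + c + 1) * (2 * c) = 2 * d * c + 2 * (c * (2 * c * m + c + 1))"
    by (simp add: algebra_simps)
  also have "\<dots> < 2 * d * c + 2 * d" using c by simp
  finally have "card R < card D"
    unfolding cardD cardR using q by (intro power_strict_increasing) (simp_all add: algebra_simps)
  then have "\<not> inj_on \<Phi> D"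
    using card_inj_on_le[OF _ maps fin(2)] by auto
  then obtain w w' where w: "w \<in> D" "w' \<in> D" "w \<noteq> w'" "\<Phi> w = \<Phi> w'"
    by (auto simp: inj_on_def)
  have mem: "w j \<in> polys_below d \<times> polys_below d" "w' j \<in> polys_below d \<times> polys_below d" if "j < Suc c" for j
    using w(1,2) that unfolding D_def by (auto dest!: PiE_mem)
  show thesis
  proof (rule that[of "\<lambda>j. fst (w j) - fst (w' j)" "\<lambda>j. snd (w j) - snd (w' j)"])
    show "fst (w j) - fst (w' j) \<in> polys_below d" if "j < Suc c" for j
      using mem[OF that] by (auto intro: polys_below_diff)
    show "snd (w j) - snd (w' j) \<in> polys_below d" if "j < Suc c" for j
      using mem[OF that] by (auto intro: polys_below_diff)
    obtain j where "j < Suc c" "w j \<noteq> w' j"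
      using w(1-3) unfolding D_def by (metis PiE_ext lessThan_iff)
    then show "\<exists>j<Suc c. fst (w j) - fst (w' j) \<noteq> 0 \<or> snd (w j) - snd (w' j) \<noteq> 0"
      by (auto simp: prod_eq_iff)
    fix k assume "k < 2 * c"
    then have "L w k - L w' k = 0" using fun_cong[OF w(4), of k] by (simp add: \<Phi>_def)
    moreover have "L w k - L w' k = (\<Sum>j<Suc c. (twisted_pderiv f 0 k (fst (w j) - fst (w' j)) +
        smult \<epsilon> (twisted_pderiv f b k (snd (w j) - snd (w' j)))) * Polynomial.monom 1 j)"
      unfolding L_def twisted_pderiv_diff sum_subtractf[symmetric] smult_diff_right
      by (intro sum.cong refl) (simp only: left_diff_distrib[symmetric] add_diff_add)
    ultimately show "(\<Sum>j<Suc c. (twisted_pderiv f 0 k (fst (w j) - fst (w' j)) +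
        smult \<epsilon> (twisted_pderiv f b k (snd (w j) - snd (w' j)))) * Polynomial.monom 1 j) = 0"
      by simp
  qed
qed

text \<open>
The auxiliary polynomial vanishes to order \<open>2 c\<close> at each of the counted points, and its degree is
at most \<open>d + m (p - 1) / 2 + c p\<close>. The count is thus at most
\<open>p / 2 + (m + 1) p / (4 c)\<close>.
\<close>

lemma stepanov_bound:
  fixes f :: "'a::finite_field poly" and p :: nat and \<epsilon> :: 'a
  assumes p: "p = CHAR('a)" "CARD('a) = CHAR('a)" "odd p"
    and f: "degree f \<le> m" "poly f 0 \<noteq> 0" "poly f a = 0" "order a f = 1"
    and c: "m + 2 * c * (2 * c * m + c + 1) + 1 \<le> p"
  shows "4 * c * card {x. poly f x \<noteq> 0 \<and> poly f x ^ ((p - 1) div 2) = \<epsilon>} \<le> (2 * c + m + 1) * p"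
proof -
  define S where "S = {x. poly f x \<noteq> 0 \<and> poly f x ^ ((p - 1) div 2) = \<epsilon>}"
  \<comment> \<open>The least \<open>d\<close> for which the unknowns outnumber the conditions.\<close>
  define d where "d = c * (2 * c * m + c + 1) + 1"
  have d: "2 * d + m \<le> p + 1" using c by (simp add: d_def mult.assoc)
  have m: "m \<ge> 1"
  proof (rule ccontr)
    assume "\<not> m \<ge> 1"
    then obtain b where "f = [:b:]" using f(1) by (metis degree_eq_zeroE le_zero_eq not_less_eq_eq One_nat_def)
    then show False using f(2,3) by simp
  qed
  obtain r s where rs: "\<And>j. j < Suc c \<Longrightarrow> r j \<in> polys_below d" "\<And>j. j < Suc c \<Longrightarrow> s j \<in> polys_below d"
      "\<exists>j<Suc c. r j \<noteq> 0 \<or> s j \<noteq> 0"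
    and eq: "\<And>k. k < 2 * c \<Longrightarrow> (\<Sum>j<Suc c. (twisted_pderiv f 0 k (r j) +
        smult \<epsilon> (twisted_pderiv f (of_nat ((p - 1) div 2)) k (s j))) * Polynomial.monom 1 j) = 0"
    by (rule exists_stepanov_coeffs[OF f(1), of c d \<epsilon> "of_nat ((p - 1) div 2)"])
      (simp add: d_def, blast)
  define F where "F = stepanov_poly f p (Suc c) r s"
  have F0: "F \<noteq> 0"
  proof
    assume "F = 0"
    then have "stepanov_poly f p (Suc c) r s = 0" by (simp add: F_def)
    then have "\<forall>j<Suc c. r j = 0 \<and> s j = 0"
      by (intro stepanov_poly_eq_0[OF p(1,3) f d rs(1,2)])
    then show False using rs(3) by auto
  qed
  have prime: "prime CHAR('a)" using pos_char_exists CHAR_pos_iff prime_CHAR_semidom by blast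
  have "2 * c * 1 \<le> 2 * c * (2 * c * m + c + 1)" by (intro mult_left_mono) auto
  then have "2 * c \<le> CHAR('a)" using c p(1) by simp
  have "2 * c * card S \<le> degree F"
  proof (rule card_mult_order_le_degree[OF _ F0])
    fix x assume x: "x \<in> S"
    show "2 * c \<le> order x F"
    proof (rule order_ge_of_higher_pderiv_eq_0[OF prime F0 \<open>2 * c \<le> CHAR('a)\<close>])
      fix k assume "k < 2 * c"
      then show "poly ((pderiv ^^ k) F) x = 0"
        unfolding F_def using x
        by (intro higher_pderiv_stepanov_poly_eq_0[OF p(1,2) _ _ eq]) (auto simp: S_def)
    qed
  qed simp
  also have "degree F \<le> d + m * ((p - 1) div 2) + c * p"
    unfolding F_def stepanov_poly_def
  proof (rule degree_sum_le)
    fix j assume j: "j \<in> {..<Suc c}"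
    have "degree (f ^ ((p - 1) div 2)) \<le> m * ((p - 1) div 2)"
      using degree_power_le[of f "(p - 1) div 2"] f(1) by (meson le_trans mult_right_mono zero_le)
    then have "degree (r j + s j * f ^ ((p - 1) div 2)) \<le> d + m * ((p - 1) div 2)"
      using polys_below_degree[OF rs(1)[of j]] polys_below_degree[OF rs(2)[of j]] j
        degree_mult_le[of "s j" "f ^ ((p - 1) div 2)"]
      by (intro degree_add_le) auto
    moreover have "degree (Polynomial.monom (1::'a) (p * j)) \<le> c * p"
      using j by (simp add: degree_monom_eq mult.commute)
    ultimately show "degree ((r j + s j * f ^ ((p - 1) div 2)) * Polynomial.monom 1 (p * j))
        \<le> d + m * ((p - 1) div 2) + c * p"
      using degree_mult_le[of "r j + s j * f ^ ((p - 1) div 2)" "Polynomial.monom 1 (p * j)"] by linarith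
  qed simp
  finally have "4 * c * card S \<le> 2 * d + m * (2 * ((p - 1) div 2)) + 2 * c * p"
    by simp
  also have "2 * ((p - 1) div 2) = p - 1" using p(3) by (auto elim: oddE)
  also have "m * (p - 1) = m * p - m" by (simp add: diff_mult_distrib2)
  also have "2 * d + (m * p - m) + 2 * c * p \<le> (2 * c + m + 1) * p"
    using d m p(3) by (auto simp: algebra_simps elim!: oddE)
  finally show ?thesis unfolding S_def .
qed

text \<open>
The points at which \<open>\<eta>(f(x))\<close> is \<open>1\<close> and those at which it is \<open>-1\<close> both number at most
\<open>p / 2 + (m + 1) p / (4 c)\<close>. Together they are all points except for the at most \<open>m\<close> roots, so
neither kind can fall much below \<open>p / 2\<close> and the two almost balance.
\<close>

lemma stepanov_sum_bound:
  fixes f :: "'a::finite_field poly" and p :: nat and \<eta> :: "'a \<Rightarrow> int"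
  assumes p: "p = CHAR('a)" "CARD('a) = CHAR('a)" "odd p"
    and f: "degree f \<le> m" "poly f 0 \<noteq> 0" "poly f a = 0" "order a f = 1"
    and c: "m + 2 * c * (2 * c * m + c + 1) + 1 \<le> p"
    and \<eta>: "\<And>x. of_int (\<eta> x) = x ^ ((p - 1) div 2)" "\<And>x. \<eta> x \<in> {-1, 0, 1}"
  shows "2 * int c * \<bar>\<Sum>x\<in>UNIV. \<eta> (poly f x)\<bar> \<le> (int m + 1) * int p + 2 * int c * int m"
proof -
  define P where "P = {x. \<eta> (poly f x) = 1}"
  define N where "N = {x. \<eta> (poly f x) = -1}"
  define Z where "Z = {x. \<eta> (poly f x) = 0}"
  have p2: "p > 1"
    using p card_mono[of UNIV "{0, 1::'a}"] by simp
  have p3: "p \<ge> 3" using p2 p(3) by (cases "p = 2") auto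
  then have e0: "(p - 1) div 2 > 0" by simp
  have f0: "f \<noteq> 0" using f(2) by auto
  have card: "4 * c * card S \<le> (2 * c + m + 1) * p"
    if "S \<subseteq> {x. poly f x \<noteq> 0 \<and> poly f x ^ ((p - 1) div 2) = \<epsilon>}" for S \<epsilon>
  proof -
    have "card S \<le> card {x. poly f x \<noteq> 0 \<and> poly f x ^ ((p - 1) div 2) = \<epsilon>}"
      using that by (intro card_mono) auto
    then have "4 * c * card S \<le> 4 * c * card {x. poly f x \<noteq> 0 \<and> poly f x ^ ((p - 1) div 2) = \<epsilon>}"
      by (rule mult_left_mono) simp
    with stepanov_bound[OF p f c, of \<epsilon>] show ?thesis by linarith
  qed
  have "\<eta> 0 = 0"
    using \<eta>(1)[of 0] \<eta>(2)[of 0] e0 by (auto simp: zero_power)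
  then have nz: "poly f x \<noteq> 0" if "\<eta> (poly f x) \<noteq> 0" for x
    using that by auto
  have P: "4 * c * card P \<le> (2 * c + m + 1) * p"
  proof (rule card[of _ 1], safe)
    fix x assume "x \<in> P"
    then have x: "\<eta> (poly f x) = 1" by (simp add: P_def)
    show "poly f x ^ ((p - 1) div 2) = 1" using \<eta>(1)[of "poly f x"] x by simp
    show "poly f x = 0 \<Longrightarrow> False" using nz[of x] x by simp
  qed
  have N: "4 * c * card N \<le> (2 * c + m + 1) * p"
  proof (rule card[of _ "-1"], safe)
    fix x assume "x \<in> N"
    then have x: "\<eta> (poly f x) = -1" by (simp add: N_def)
    show "poly f x ^ ((p - 1) div 2) = -1" using \<eta>(1)[of "poly f x"] x by simp
    show "poly f x = 0 \<Longrightarrow> False" using nz[of x] x by simp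
  qed
  have "poly f x = 0" if "x \<in> Z" for x
  proof -
    have "poly f x ^ ((p - 1) div 2) = 0" using that \<eta>(1)[of "poly f x"] by (simp add: Z_def)
    then show ?thesis by simp
  qed
  then have "card Z \<le> card {x. poly f x = 0}" by (intro card_mono) auto
  then have Z: "card Z \<le> m" using card_poly_roots_bound[OF f0] f(1) by linarith
  have U: "UNIV = P \<union> N \<union> Z" using \<eta>(2) by (auto simp: P_def N_def Z_def)
  have disj: "P \<inter> N = {}" "(P \<union> N) \<inter> Z = {}" by (auto simp: P_def N_def Z_def)
  have "p = card P + card N + card Z"
    using arg_cong[OF U, of card] disj p by (simp add: card_Un_disjoint)
  then have cp: "int p = int (card P) + int (card N) + int (card Z)" by simp
  have "(\<Sum>x\<in>UNIV. \<eta> (poly f x)) = (\<Sum>x\<in>P. \<eta> (poly f x)) + (\<Sum>x\<in>N. \<eta> (poly f x)) + (\<Sum>x\<in>Z. \<eta> (poly f x))"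
    unfolding U using disj by (simp add: sum.union_disjoint)
  also have "(\<Sum>x\<in>P. \<eta> (poly f x)) = int (card P)" by (simp add: P_def)
  also have "(\<Sum>x\<in>N. \<eta> (poly f x)) = - int (card N)" by (simp add: N_def)
  also have "(\<Sum>x\<in>Z. \<eta> (poly f x)) = 0" by (simp add: Z_def)
  finally have sum: "(\<Sum>x\<in>UNIV. \<eta> (poly f x)) = int (card P) - int (card N)" by simp
  have P': "2 * (2 * int c * int (card P)) \<le> 2 * int c * int p + (int m + 1) * int p"
    and N': "2 * (2 * int c * int (card N)) \<le> 2 * int c * int p + (int m + 1) * int p"
    using of_nat_mono[OF P, where ?'a = int] of_nat_mono[OF N, where ?'a = int]
    by (simp_all add: algebra_simps)
  have Z': "2 * int c * int (card Z) \<le> 2 * int c * int m"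
    using Z by (intro mult_left_mono) auto
  have eq: "2 * int c * int p = 2 * int c * int (card P) + 2 * int c * int (card N) + 2 * int c * int (card Z)"
    unfolding cp by (simp add: algebra_simps)
  have "\<bar>2 * int c * int (card P) - 2 * int c * int (card N)\<bar> \<le> (int m + 1) * int p + 2 * int c * int m"
    using P' N' Z' eq by linarith
  also have "\<bar>2 * int c * int (card P) - 2 * int c * int (card N)\<bar> = 2 * int c * \<bar>int (card P) - int (card N)\<bar>"
    by (simp add: abs_mult flip: right_diff_distrib)
  finally show ?thesis unfolding sum .
qed

section \<open>Correlations of the Legendre symbol\<close>

text \<open>
The bound above for the polynomial with root set \<open>A\<close>, as a property of the modulus. The residues in
\<open>A\<close> have to be distinct for the roots to be simple, and nonzero for the polynomial not to vanish at
\<open>0\<close>.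
\<close>

definition legendre_correlation_bound :: "nat \<Rightarrow> bool"
  where "legendre_correlation_bound p \<longleftrightarrow>
    (\<forall>A c. finite A \<and> A \<noteq> {} \<and> inj_on (\<lambda>a. a mod int p) A \<and> (\<forall>a\<in>A. \<not> int p dvd a) \<and>
       card A + 2 * c * (2 * c * card A + c + 1) + 1 \<le> p \<longrightarrow>
       2 * int c * \<bar>\<Sum>k<p. \<Prod>a\<in>A. Legendre (int k - a) (int p)\<bar>
         \<le> (int (card A) + 1) * int p + 2 * int c * int (card A))"

text \<open>
By Euler's criterion both sides are congruent modulo \<open>p\<close>, and they differ by at most \<open>2 < p\<close>.
\<close>

lemma legendre_mult:
  assumes "prime p" "2 < p"
  shows "Legendre (a * b) (int p) = Legendre a (int p) * Legendre b (int p)"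
proof -
  have "[Legendre (a * b) (int p) = (a * b) ^ ((p - 1) div 2)] (mod int p)"
    using euler_criterion[OF assms, of "a * b"] by simp
  also have "(a * b) ^ ((p - 1) div 2) = a ^ ((p - 1) div 2) * b ^ ((p - 1) div 2)"
    by (rule power_mult_distrib)
  also have "[\<dots> = Legendre a (int p) * Legendre b (int p)] (mod int p)"
    by (intro cong_mult cong_sym[OF euler_criterion[OF assms]])
  finally have "int p dvd Legendre (a * b) (int p) - Legendre a (int p) * Legendre b (int p)"
    by (simp add: cong_iff_dvd_diff)
  moreover have "\<bar>Legendre (a * b) (int p) - Legendre a (int p) * Legendre b (int p)\<bar> \<le> 2"
    by (auto simp: Legendre_def)
  ultimately show ?thesis
    using assms(2) dvd_imp_le_int[of "Legendre (a * b) (int p) - Legendre a (int p) * Legendre b (int p)" "int p"]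
    by fastforce
qed

lemma legendre_prod:
  assumes "prime p" "2 < p"
  shows "Legendre (\<Prod>a\<in>A. f a) (int p) = (\<Prod>a\<in>A. Legendre (f a) (int p))"
proof -
  have "[(1::int) \<noteq> 0] (mod int p)" if "2 < p" using that by (simp add: cong_def)
  moreover have "QuadRes (int p) 1" unfolding QuadRes_def by (rule exI[of _ 1]) simp
  ultimately have "Legendre 1 (int p) = 1" using assms(2) by (simp add: Legendre_def)
  then show ?thesis
    by (induction A rule: infinite_finite_induct) (simp_all add: legendre_mult[OF assms])
qed

lemma legendre_cong: "[a = b] (mod p) \<Longrightarrow> Legendre a p = Legendre b p"
  by (simp add: Legendre_def QuadRes_def cong_def)

lemma legendre_correlation_bound_finite_field:
  assumes "CARD('a) = CHAR('a::finite_field)"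
  shows "legendre_correlation_bound CHAR('a)"
  unfolding legendre_correlation_bound_def
proof (intro allI impI, elim conjE)
  fix A :: "int set" and c :: nat
  define p where "p = CHAR('a)"
  define m where "m = card A"
  assume A: "finite A" "A \<noteq> {}" "inj_on (\<lambda>a. a mod int CHAR('a)) A" "\<forall>a\<in>A. \<not> int CHAR('a) dvd a"
    and c: "card A + 2 * c * (2 * c * card A + c + 1) + 1 \<le> CHAR('a)"
  have prime: "prime p" unfolding p_def using pos_char_exists CHAR_pos_iff prime_CHAR_semidom by blast
  have eq_iff: "(of_int a :: 'a) = of_int b \<longleftrightarrow> [a = b] (mod int p)" for a b
    unfolding p_def by (rule of_int_eq_iff_cong_CHAR)
  have range: "bij_betw (\<lambda>k. of_nat k :: 'a) {..<p} UNIV"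
  proof -
    have inj: "inj_on (\<lambda>k. of_nat k :: 'a) {..<p}"
      unfolding inj_on_def of_nat_eq_iff_cong_CHAR p_def by (auto simp: cong_def)
    then have "(\<lambda>k. of_nat k :: 'a) ` {..<p} = UNIV"
      using assms by (intro card_subset_eq) (auto simp: card_image p_def)
    with inj show ?thesis by (simp add: bij_betw_def)
  qed
  show "2 * int c * \<bar>\<Sum>k<CHAR('a). \<Prod>a\<in>A. Legendre (int k - a) (int CHAR('a))\<bar>
         \<le> (int (card A) + 1) * int CHAR('a) + 2 * int c * int (card A)"
  proof (cases "p = 2")
    case True
    have "c = 0"
    proof (rule ccontr)
      assume "c \<noteq> 0"
      then have "c * 1 \<ge> 1" "c * (2 * c * m + c + 1) \<ge> c * 1" by (auto intro!: mult_left_mono)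
      then have "2 * c * (2 * c * m + c + 1) \<ge> 2" by linarith
      then show False using c True by (simp add: p_def m_def)
    qed
    then show ?thesis by simp
  next
    case False
    then have odd: "odd p" and p2: "2 < p"
      using prime prime_odd_nat prime_ge_2_nat[OF prime] by force+
    define f where "f = (\<Prod>a\<in>A. [:- of_int a, 1 :: 'a:])"
    define ind where "ind x = (the_inv_into {..<p} (\<lambda>k. of_nat k :: 'a) x)" for x
    define \<eta> where "\<eta> x = Legendre (int (ind x)) (int p)" for x
    have ind: "of_nat (ind x) = x" for x
      unfolding ind_def using f_the_inv_into_f_bij_betw[OF range] by simp
    have \<eta>_of_int: "\<eta> (of_int a) = Legendre a (int p)" for a
    proof -
      have "of_int (int (ind (of_int a))) = (of_int a :: 'a)" by (simp add: ind)
      then show ?thesis unfolding \<eta>_def eq_iff by (rule legendre_cong)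
    qed
    have polyf: "poly f (of_int k) = of_int (\<Prod>a\<in>A. k - a)" for k
      by (simp add: f_def poly_prod)
    obtain a where a: "a \<in> A" using A(2) by blast
    have f_split: "f = [:- of_int a, 1:] * (\<Prod>b\<in>A - {a}. [:- of_int b, 1 :: 'a:])"
      unfolding f_def using A(1) a by (rule prod.remove)
    have "2 * int c * \<bar>\<Sum>x\<in>UNIV. \<eta> (poly f x)\<bar> \<le> (int m + 1) * int p + 2 * int c * int m"
    proof (rule stepanov_sum_bound[OF p_def _ odd])
      show "CARD('a) = CHAR('a)" by fact
      show "degree f \<le> m"
        unfolding f_def m_def using A(1) by (subst degree_prod_eq_sum_degree) auto
      show "poly f 0 \<noteq> 0"
      proof
        assume "poly f 0 = 0"
        then have "of_int (\<Prod>a\<in>A. 0 - a) = (0 :: 'a)" using polyf[of 0] by simp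
        then have "\<exists>a\<in>A. of_int a = (0 :: 'a)" using A(1) by (auto simp: prod_zero_iff)
        then show False using A(4) eq_iff[of _ 0] by (auto simp: cong_0_iff p_def)
      qed
      show "poly f (of_int a) = 0" unfolding f_split by simp
      show "order (of_int a) f = 1"
      proof -
        have "of_int a \<noteq> (of_int b :: 'a)" if "b \<in> A - {a}" for b
          using that a A(3) unfolding eq_iff cong_def inj_on_def p_def by auto
        then have "poly (\<Prod>b\<in>A - {a}. [:- of_int b, 1 :: 'a:]) (of_int a) \<noteq> 0"
          using A(1) by (auto simp: poly_prod prod_zero_iff)
        then have 0: "order (of_int a) (\<Prod>b\<in>A - {a}. [:- of_int b, 1 :: 'a:]) = 0"
          and nz: "(\<Prod>b\<in>A - {a}. [:- of_int b, 1 :: 'a:]) \<noteq> 0"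
          by (auto intro: order_0I)
        have "order (of_int a) f = order (of_int a) [:- of_int a, 1 :: 'a:] +
            order (of_int a) (\<Prod>b\<in>A - {a}. [:- of_int b, 1 :: 'a:])"
          unfolding f_split by (rule order_mult) (use nz in \<open>simp del: mult_pCons_left\<close>)
        also have "order (of_int a) [:- of_int a, 1 :: 'a:] = 1"
          using order_power_n_n[of "of_int a :: 'a" 1] by simp
        finally show ?thesis using 0 by simp
      qed
      show "m + 2 * c * (2 * c * m + c + 1) + 1 \<le> p" using c by (simp add: p_def m_def)
      show "of_int (\<eta> x) = x ^ ((p - 1) div 2)" for x
      proof -
        have "of_int (\<eta> x) = (of_int (int (ind x) ^ ((p - 1) div 2)) :: 'a)"
          unfolding eq_iff \<eta>_def by (rule euler_criterion[OF prime p2])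
        then show ?thesis by (simp add: ind)
      qed
      show "\<eta> x \<in> {-1, 0, 1}" for x by (auto simp: \<eta>_def Legendre_def)
    qed
    also have "(\<Sum>x\<in>UNIV. \<eta> (poly f x)) = (\<Sum>k<p. \<eta> (poly f (of_nat k)))"
      by (rule sum.reindex_bij_betw[OF range, symmetric])
    also have "\<dots> = (\<Sum>k<p. \<Prod>a\<in>A. Legendre (int k - a) (int p))"
    proof (rule sum.cong[OF refl])
      fix k
      have "poly f (of_nat k) = of_int (\<Prod>a\<in>A. int k - a)"
        using polyf[of "int k"] by (simp only: of_int_of_nat_eq)
      then show "\<eta> (poly f (of_nat k)) = (\<Prod>a\<in>A. Legendre (int k - a) (int p))"
        by (simp only: \<eta>_of_int legendre_prod[OF prime p2])
    qed
    finally show ?thesis by (simp add: p_def m_def)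
  qed
qed

text \<open>
The polynomial argument takes place in a type that is a field with \<open>p\<close> elements, whereas the bound is
wanted for every prime number \<open>p\<close>. A type cannot depend on a variable, but it may depend on a
constant: choose a counterexample to the bound if there is any, form the field with that many
elements, and conclude that the chosen number is not a counterexample.
\<close>

definition exceptional_prime :: nat
  where "exceptional_prime =
    (if \<exists>p. prime p \<and> \<not> legendre_correlation_bound p
     then SOME p. prime p \<and> \<not> legendre_correlation_bound p else 2)"

lemma prime_exceptional_prime: "prime exceptional_prime"
  unfolding exceptional_prime_def using someI_ex[of "\<lambda>p. prime p \<and> \<not> legendre_correlation_bound p"]
  by auto

typedef exceptional_index = "{..<exceptional_prime}"
  using prime_gt_0_nat[OF prime_exceptional_prime] by blast

lemma card_exceptional_index: "CARD(exceptional_index) = exceptional_prime"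
  using type_definition.card[OF type_definition_exceptional_index] by simp

instance exceptional_index :: finite
proof
  have "(UNIV :: exceptional_index set) = Abs_exceptional_index ` {..<exceptional_prime}"
    by (rule type_definition.univ[OF type_definition_exceptional_index])
  then show "finite (UNIV :: exceptional_index set)"
    by (metis finite_imageI finite_lessThan)
qed

instance exceptional_index :: prime_card
  by standard (simp add: card_exceptional_index prime_exceptional_prime)

lemma legendre_correlation_bound:
  assumes "prime p"
  shows "legendre_correlation_bound p"
proof (rule ccontr)
  assume "\<not> legendre_correlation_bound p"
  with assms have ex: "\<exists>p. prime p \<and> \<not> legendre_correlation_bound p" by blast
  have "legendre_correlation_bound exceptional_prime"
    using legendre_correlation_bound_finite_field[where ?'a = "exceptional_index mod_ring"]
    by (simp add: card_exceptional_index)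
  with someI_ex[OF ex] show False
    unfolding exceptional_prime_def using ex by auto
qed

section \<open>Additive characters and Gauss sums\<close>

lemma e_add: "e (x + y) = e x * e y"
  by (simp add: e_def distrib_left exp_add)

lemma e_diff: "e (x - y) = e x / e y"
  by (simp add: e_def right_diff_distrib exp_diff)

lemma e_0 [simp]: "e 0 = 1"
  by (simp add: e_def)

lemma e_eq_cis: "e x = cis (2 * pi * x)"
  by (simp add: e_def cis_conv_exp mult_ac)

lemma norm_e [simp]: "norm (e x) = 1"
  by (simp add: e_eq_cis)

lemma e_neq_0 [simp]: "e x \<noteq> 0"
  by (simp add: e_def)

lemma e_eq_1_iff: "e x = 1 \<longleftrightarrow> x \<in> \<int>"
proof -
  have "e x = 1 \<longleftrightarrow> (\<exists>n::int. 2 * pi * x = of_int (2 * n) * pi)"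
    unfolding e_def exp_eq_1 by simp
  also have "\<dots> \<longleftrightarrow> (\<exists>n::int. x = of_int n)"
    by (intro ex_cong1) auto
  finally show ?thesis by (auto elim: Ints_cases)
qed

lemma e_of_int [simp]: "e (of_int n) = 1"
  by (simp add: e_eq_1_iff)

lemma e_power: "e x ^ n = e (of_nat n * x)"
  by (induction n) (simp_all add: e_add[symmetric] algebra_simps)

lemma e_cong:
  assumes "[a = b] (mod int q)" "q > 0"
  shows "e (of_int a / real q) = e (of_int b / real q)"
proof -
  obtain c where c: "a = b + c * int q"
    using assms(1) by (metis cong_iff_lin mult.commute cong_sym)
  have "of_int a / real q = of_int b / real q + of_int c"
    using assms(2) by (simp add: c field_simps)
  then show ?thesis by (simp add: e_add)
qed

text \<open>
Orthogonality of the additive characters: a geometric sum whose ratio is a \<open>q\<close>-th root of unity.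
\<close>

lemma sum_e_complete:
  assumes "q > 0"
  shows "(\<Sum>n\<in>{0..<int q}. e (of_int n * of_int m / real q)) = (if int q dvd m then of_nat q else 0)"
proof -
  define z where "z = e (of_int m / real q)"
  have z: "e (of_int (int n) * of_int m / real q) = z ^ n" for n
    by (simp add: z_def e_power)
  have "(\<Sum>n\<in>{0..<int q}. e (of_int n * of_int m / real q)) =
      (\<Sum>n<q. e (of_int (int n) * of_int m / real q))"
    by (rule sum.reindex_bij_witness[of _ int nat]) auto
  also have "\<dots> = (\<Sum>n<q. z ^ n)"
    by (simp only: z)
  also have "\<dots> = (if int q dvd m then of_nat q else 0)"
  proof (cases "int q dvd m")
    case True
    then obtain c where "m = int q * c" by blast
    then have "z = 1" using assms by (simp add: z_def)
    then show ?thesis using True by simp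
  next
    case False
    have "z \<noteq> 1"
    proof
      assume "z = 1"
      then obtain c :: int where "of_int m / real q = of_int c"
        unfolding z_def e_eq_1_iff by (auto elim: Ints_cases)
      then have "real_of_int m = real_of_int (c * int q)"
        using assms by (simp add: field_simps)
      then have "m = c * int q" by linarith
      then show False using False by simp
    qed
    moreover have "z ^ q = 1"
      unfolding z_def e_power using assms by simp
    ultimately show ?thesis using False by (simp add: geometric_sum)
  qed
  finally show ?thesis .
qed

lemma sum_complete_residues:
  fixes f :: "int \<Rightarrow> 'b::comm_monoid_add"
  assumes "\<And>n. f (n mod int q) = f n" "bij_betw (\<lambda>x. g x mod int q) R {0..<int q}"
  shows "(\<Sum>x\<in>R. f (g x)) = (\<Sum>n\<in>{0..<int q}. f n)"
  using sum.reindex_bij_betw[OF assms(2), of f] by (simp add: assms(1))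

lemma bij_betw_mod_if_inj:
  assumes "q > 0" "inj_on (\<lambda>x. g x mod int q) R" "card R = q" "finite R"
  shows "bij_betw (\<lambda>x. g x mod int q) R {0..<int q}"
  unfolding bij_betw_def
proof
  show "(\<lambda>x. g x mod int q) ` R = {0..<int q}"
    using assms by (intro card_subset_eq) (auto simp: card_image)
qed fact

lemma inj_on_mod_interval: "inj_on (\<lambda>x. x mod int q) {a..<a + int q}"
proof (rule inj_onI)
  fix x y assume xy: "x \<in> {a..<a + int q}" "y \<in> {a..<a + int q}" "x mod int q = y mod int q"
  then have "int q dvd x - y" by (simp add: mod_eq_dvd_iff)
  moreover have "\<bar>x - y\<bar> < int q" using xy by auto
  ultimately show "x = y" using dvd_imp_le_int[of "x - y" "int q"] by fastforce
qed

lemma bij_betw_mod_diff: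
  assumes "q > 0"
  shows "bij_betw (\<lambda>x. (c - x) mod int q) {a..<a + int q} {0..<int q}"
proof (rule bij_betw_mod_if_inj[OF assms])
  show "inj_on (\<lambda>x. (c - x) mod int q) {a..<a + int q}"
  proof (rule inj_onI)
    fix x y assume "x \<in> {a..<a + int q}" "y \<in> {a..<a + int q}" "(c - x) mod int q = (c - y) mod int q"
    moreover from this(3) have "x mod int q = y mod int q"
      using mod_diff_cong[of c "int q" c "c - x" "c - y"] by simp
    ultimately show "x = y" using inj_on_mod_interval[of q a] by (auto dest: inj_onD)
  qed
qed auto

locale odd_prime =
  fixes q :: nat
  assumes prime: "prime q" and gt2: "2 < q"
begin

abbreviation leg :: "int \<Rightarrow> int" where "leg n \<equiv> Legendre n (int q)"

lemma q_pos: "q > 0" using gt2 by simp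

lemma odd: "odd q" using prime gt2 prime_odd_nat by simp

lemma leg_mod [simp]: "leg (n mod int q) = leg n"
  by (rule legendre_cong) simp

lemma leg_dvd: "int q dvd n \<Longrightarrow> leg n = 0"
  by (simp add: Legendre_def cong_0_iff)

lemma leg_square: "leg n * leg n = (if int q dvd n then 0 else 1)"
  by (simp add: Legendre_def cong_0_iff)

lemma leg_mult: "leg (a * b) = leg a * leg b"
  by (rule legendre_mult[OF prime gt2])

lemma leg_1 [simp]: "leg 1 = 1"
  using legendre_prod[OF prime gt2, of "\<lambda>_. 1" "{}"] by simp

lemma abs_leg_le_1: "\<bar>leg n\<bar> \<le> 1"
  by (simp add: Legendre_def)

lemma bij_betw_mult_mod:
  assumes "\<not> int q dvd u"
  shows "bij_betw (\<lambda>x. (u * x) mod int q) {0..<int q} {0..<int q}"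
proof (rule bij_betw_mod_if_inj[OF q_pos])
  show "inj_on (\<lambda>x. (u * x) mod int q) {0..<int q}"
  proof (rule inj_onI)
    fix x y assume xy: "x \<in> {0..<int q}" "y \<in> {0..<int q}" "(u * x) mod int q = (u * y) mod int q"
    then have "int q dvd u * (x - y)" by (simp add: mod_eq_dvd_iff right_diff_distrib)
    then have "int q dvd x - y"
      using assms prime by (simp add: prime_dvd_mult_iff)
    then have "x mod int q = y mod int q" by (simp add: mod_eq_dvd_iff)
    then show "x = y" using xy inj_on_mod_interval[of q 0] by (auto dest: inj_onD)
  qed
qed auto

lemma sum_mult_complete:
  fixes f :: "int \<Rightarrow> 'b::comm_monoid_add"
  assumes "\<And>n. f (n mod int q) = f n" "\<not> int q dvd u"
  shows "(\<Sum>x\<in>{0..<int q}. f (u * x)) = (\<Sum>n\<in>{0..<int q}. f n)"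
  using sum_complete_residues[of f q "\<lambda>x. u * x" "{0..<int q}"] assms bij_betw_mult_mod by simp

text \<open>
A primitive root is one: its power with exponent \<open>(q - 1) / 2\<close> is not \<open>1\<close>.
\<close>

lemma exists_nonresidue: "\<exists>u. leg u = -1"
proof -
  obtain g where g: "residue_primroot q g" using prime_primitive_root_exists[of q] prime gt2 by auto
  have "ord q g = q - 1"
    using g prime by (simp add: residue_primroot_def totient_prime)
  moreover have "\<not> (q - 1) dvd (q - 1) div 2"
    using gt2 by (auto dest!: dvd_imp_le)
  ultimately have "\<not> [g ^ ((q - 1) div 2) = 1] (mod q)" by (metis ord_divides)
  then have "\<not> [int g ^ ((q - 1) div 2) = 1] (mod int q)"
    by (metis cong_int_iff of_nat_1 of_nat_power)
  then have "leg (int g) \<noteq> 1"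
    using euler_criterion[OF prime gt2, of "int g"] by (metis cong_sym)
  moreover have "leg (int g) \<noteq> 0"
  proof
    assume "leg (int g) = 0"
    then have "int q dvd int g" by (auto simp: Legendre_def cong_0_iff split: if_splits)
    then have "q dvd g" by simp
    moreover have "coprime q g" using g by (simp add: residue_primroot_def)
    ultimately have "q = 1" by (metis coprime_absorb_left nat_dvd_1_iff_1)
    then show False using gt2 by simp
  qed
  ultimately have "leg (int g) = -1" by (auto simp: Legendre_def split: if_splits)
  then show ?thesis by blast
qed

lemma sum_leg: "(\<Sum>b\<in>{0..<int q}. leg b) = 0"
proof -
  obtain u where u: "leg u = -1" using exists_nonresidue by blast
  then have "\<not> int q dvd u" using leg_dvd by force
  then have "(\<Sum>b\<in>{0..<int q}. leg (u * b)) = (\<Sum>b\<in>{0..<int q}. leg b)"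
    by (intro sum_mult_complete) auto
  then show ?thesis by (simp add: leg_mult u sum_negf)
qed

definition gauss :: "int \<Rightarrow> complex"
  where "gauss n = (\<Sum>b\<in>{0..<int q}. of_int (leg b) * e (of_int (b * n) / real q))"

lemma e_mod_mult: "e (of_int ((a mod int q) * n) / real q) = e (of_int (a * n) / real q)"
  by (rule e_cong[OF _ q_pos]) (simp add: cong_def mod_mult_left_eq)

text \<open>
For \<open>n\<close> prime to \<open>q\<close> substitute \<open>n b\<close> for \<open>b\<close> in the sum. For \<open>n\<close> divisible by \<open>q\<close> the exponentials
are all \<open>1\<close>, and the Legendre symbols add up to zero.
\<close>

lemma gauss_eq_leg_mult: "gauss n = of_int (leg n) * gauss 1"
proof (cases "int q dvd n")
  case True
  then obtain c where c: "n = int q * c" by blast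
  have "of_int (b * n) / real q = of_int (b * c)" for b
    using q_pos by (simp add: c)
  then have "gauss n = (\<Sum>b\<in>{0..<int q}. of_int (leg b))"
    unfolding gauss_def by (simp only: e_of_int mult_1_right)
  also have "\<dots> = of_int (\<Sum>b\<in>{0..<int q}. leg b)" by simp
  also have "\<dots> = 0" unfolding sum_leg by simp
  finally show ?thesis using leg_dvd[OF True] by simp
next
  case False
  have "gauss 1 = (\<Sum>b\<in>{0..<int q}. of_int (leg (n * b)) * e (of_int (n * b * 1) / real q))"
    unfolding gauss_def
    by (rule sum_mult_complete[OF _ False, symmetric])
      (use e_mod_mult[of _ 1] in simp)
  also have "\<dots> = of_int (leg n) * gauss n"
    unfolding gauss_def by (simp add: leg_mult sum_distrib_left mult_ac)
  finally have "of_int (leg n) * gauss 1 = of_int (leg n * leg n) * gauss n" by simp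
  then show ?thesis using False by (simp add: leg_square del: of_int_mult)
qed

text \<open>
Absorb \<open>gauss 1\<close> into the summands of \<open>gauss (-1)\<close> by \<open>gauss_eq_leg_mult\<close>. The resulting double sum
is the discrete Fourier transform of the Legendre symbol followed by its inverse, evaluated at \<open>1\<close>.
\<close>

lemma gauss_mult_gauss_uminus: "gauss 1 * gauss (-1) = of_nat q"
proof -
  have "gauss 1 * gauss (-1) = (\<Sum>b\<in>{0..<int q}. e (of_int (b * (-1)) / real q) * gauss b)"
  proof -
    have "(\<Sum>b\<in>{0..<int q}. e (of_int (b * (-1)) / real q) * gauss b) =
        (\<Sum>b\<in>{0..<int q}. e (of_int (b * (-1)) / real q) * (of_int (leg b) * gauss 1))"
      by (intro sum.cong refl arg_cong2[of _ _ _ _ "(*)"] gauss_eq_leg_mult)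
    then show ?thesis unfolding gauss_def[of "-1"] by (simp add: sum_distrib_left mult_ac)
  qed
  also have "\<dots> = (\<Sum>b\<in>{0..<int q}. \<Sum>a\<in>{0..<int q}.
      of_int (leg a) * e (of_int b * of_int (a - 1) / real q))"
    unfolding gauss_def sum_distrib_left
    by (intro sum.cong refl) (simp add: e_add[symmetric] field_simps)
  also have "\<dots> = (\<Sum>a\<in>{0..<int q}. of_int (leg a) * (\<Sum>b\<in>{0..<int q}. e (of_int b * of_int (a - 1) / real q)))"
    by (subst sum.swap) (simp add: sum_distrib_left)
  also have "\<dots> = (\<Sum>a\<in>{0..<int q}. if a = 1 then of_nat q else 0)"
  proof (rule sum.cong[OF refl])
    fix a assume a: "a \<in> {0..<int q}"
    have "int q dvd a - 1 \<longleftrightarrow> a = 1"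
      using a gt2 dvd_imp_le_int[of "a - 1" "int q"] by fastforce
    then show "of_int (leg a) * (\<Sum>b\<in>{0..<int q}. e (of_int b * of_int (a - 1) / real q)) =
        (if a = 1 then of_nat q else 0)"
      unfolding sum_e_complete[OF q_pos] by simp
  qed
  also have "\<dots> = of_nat q" using gt2 by simp
  finally show ?thesis .
qed

lemma gauss_nonzero: "gauss 1 \<noteq> 0"
  using gauss_mult_gauss_uminus q_pos by auto

lemma gauss_sum_eq: "gauss_sum q = gauss 1"
proof -
  have "gauss_sum q = (\<Sum>b\<in>{1..<1 + int q}. of_int (leg b) * e (of_int (b * 1) / real q))"
    unfolding gauss_sum_def by (rule sum.reindex_bij_witness[of _ nat int]) auto
  also have "\<dots> = gauss 1"
    unfolding gauss_def
  proof (rule sum_complete_residues[where g = "\<lambda>x. x"])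
    show "bij_betw (\<lambda>x. x mod int q) {1..<1 + int q} {0..<int q}"
      by (rule bij_betw_mod_if_inj[OF q_pos inj_on_mod_interval]) auto
  qed (use e_mod_mult[of _ 1] in simp)
  finally show ?thesis .
qed

lemma leg_div_gauss_sum:
  "of_int (leg n) / gauss_sum q =
     (\<Sum>b\<in>{0..<int q}. of_int (leg b) * e (- of_int (b * n) / real q)) / of_nat q"
proof -
  have "(\<Sum>b\<in>{0..<int q}. of_int (leg b) * e (- of_int (b * n) / real q)) = gauss (n * (-1))"
    unfolding gauss_def by simp
  also have "\<dots> = of_int (leg n) * gauss (-1)"
    using gauss_eq_leg_mult[of "n * (-1)"] gauss_eq_leg_mult[of "-1"] unfolding leg_mult by simp
  finally show ?thesis
    using gauss_mult_gauss_uminus gauss_nonzero q_pos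
    by (simp add: gauss_sum_eq field_simps)
qed

text \<open>
After multiplication by \<open>q\<close> the Legendre symbols can be replaced by Gauss sums. The sum over \<open>k\<close>
then forces the two summation variables to agree, and what remains is the sum of
\<open>e(x (b - a) / q)\<close> over the nonzero residues \<open>x\<close>.
\<close>

lemma leg_correlation:
  "(\<Sum>k\<in>{0..<int q}. leg (k - a) * leg (k - b)) = (if int q dvd a - b then int q else 0) - 1"
proof -
  let ?E = "\<lambda>x n. e (of_int (x * n) / real q)"
  have pull: "e (of_int (x * (k - a)) / real q) * e (of_int (y * (b - k)) / real q) =
      e (of_int (y * b - x * a) / real q) * e (of_int k * of_int (x - y) / real q)" for x y k
    unfolding e_add[symmetric] by (rule arg_cong[of _ _ e])
      (simp add: add_divide_distrib[symmetric] algebra_simps)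
  have orth: "int q dvd x - y \<longleftrightarrow> x = y" if "x \<in> {0..<int q}" "y \<in> {0..<int q}" for x y
    using that mod_eq_dvd_iff[of x "int q" y] by auto
  have "(\<Sum>k\<in>{0..<int q}. gauss (k - a) * gauss (b - k)) =
      (\<Sum>k\<in>{0..<int q}. \<Sum>x\<in>{0..<int q}. \<Sum>y\<in>{0..<int q}.
         of_int (leg x * leg y) * (e (of_int (x * (k - a)) / real q) * e (of_int (y * (b - k)) / real q)))"
    unfolding gauss_def sum_product by (intro sum.cong refl) (simp add: mult_ac)
  also have "\<dots> = (\<Sum>x\<in>{0..<int q}. \<Sum>y\<in>{0..<int q}. \<Sum>k\<in>{0..<int q}.
         of_int (leg x * leg y) * (e (of_int (x * (k - a)) / real q) * e (of_int (y * (b - k)) / real q)))"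
    by (rule trans[OF sum.swap], rule sum.cong[OF refl], rule sum.swap)
  also have "\<dots> = (\<Sum>x\<in>{0..<int q}. \<Sum>y\<in>{0..<int q}.
         of_int (leg x * leg y) * e (of_int (y * b - x * a) / real q) *
         (\<Sum>k\<in>{0..<int q}. e (of_int k * of_int (x - y) / real q)))"
    unfolding pull by (simp add: sum_distrib_left mult_ac)
  also have "\<dots> = (\<Sum>x\<in>{0..<int q}. \<Sum>y\<in>{0..<int q}.
         if x = y then of_nat q * (of_int (leg x * leg x) * e (of_int x * of_int (b - a) / real q)) else 0)"
    unfolding sum_e_complete[OF q_pos]
    by (intro sum.cong refl) (auto simp: orth algebra_simps)
  also have "\<dots> = of_nat q * (\<Sum>x\<in>{0..<int q}. of_int (leg x * leg x) * e (of_int x * of_int (b - a) / real q))"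
    by (simp add: sum_distrib_left)
  also have "(\<Sum>x\<in>{0..<int q}. of_int (leg x * leg x) * e (of_int x * of_int (b - a) / real q)) =
      (\<Sum>x\<in>{0..<int q}. e (of_int x * of_int (b - a) / real q) - (if x = 0 then 1 else 0))"
  proof (rule sum.cong[OF refl])
    fix x assume "x \<in> {0..<int q}"
    then have "int q dvd x \<longleftrightarrow> x = 0" using orth[of x 0] q_pos by simp
    then show "of_int (leg x * leg x) * e (of_int x * of_int (b - a) / real q) =
        e (of_int x * of_int (b - a) / real q) - (if x = 0 then 1 else 0)"
      unfolding leg_square by simp
  qed
  also have "\<dots> = (if int q dvd b - a then of_nat q else 0) - 1"
    unfolding sum_subtractf sum_e_complete[OF q_pos] using q_pos by simp
  finally have 1: "(\<Sum>k\<in>{0..<int q}. gauss (k - a) * gauss (b - k)) =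
      of_nat q * ((if int q dvd b - a then of_nat q else 0) - 1)" .
  have "gauss (k - a) * gauss (b - k) = of_nat q * of_int (leg (k - a) * leg (k - b))" for k
  proof -
    have "gauss (k - a) = of_int (leg (k - a)) * gauss 1" by (rule gauss_eq_leg_mult)
    moreover have "gauss (b - k) = of_int (leg (k - b)) * gauss (-1)"
      using gauss_eq_leg_mult[of "(k - b) * (-1)"] gauss_eq_leg_mult[of "-1"]
      unfolding leg_mult by simp
    ultimately have "gauss (k - a) * gauss (b - k) =
        (gauss 1 * gauss (-1)) * of_int (leg (k - a) * leg (k - b))" by simp
    then show ?thesis unfolding gauss_mult_gauss_uminus .
  qed
  then have "of_nat q * ((if int q dvd b - a then of_nat q else 0) - 1) =
      (of_nat q * (of_int (\<Sum>k\<in>{0..<int q}. leg (k - a) * leg (k - b))) :: complex)"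
    using 1 by (simp add: sum_distrib_left)
  then have "complex_of_int (\<Sum>k\<in>{0..<int q}. leg (k - a) * leg (k - b)) =
      of_int ((if int q dvd b - a then int q else 0) - 1)"
    using q_pos by (auto split: if_splits)
  then have "(\<Sum>k\<in>{0..<int q}. leg (k - a) * leg (k - b)) = (if int q dvd b - a then int q else 0) - 1"
    by (simp only: of_int_eq_iff)
  also have "int q dvd b - a \<longleftrightarrow> int q dvd a - b" by (rule dvd_diff_commute)
  finally show ?thesis .
qed

definition finite_coeff :: "real \<Rightarrow> real \<Rightarrow> real \<Rightarrow> complex"
  where "finite_coeff \<alpha> \<beta> x = (\<Sum>n\<in>{n :: int. \<alpha> * real q < of_int n \<and> of_int n \<le> (\<alpha> + \<beta>) * real q}.
      e (of_int n * x / real q)) / of_nat q"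

definition half :: int where "half = (int q - 1) div 2"

lemma q_eq_half: "int q = 2 * half + 1"
  using odd by (auto simp: half_def elim!: oddE)

text \<open>
Expand \<open>leg n / gauss_sum q\<close> into additive characters and put \<open>b = k - l\<close>. The frequency \<open>k\<close> then
cancels from the exponentials and survives only in the Legendre symbols.
\<close>

lemma G_finite_path_eq:
  "G_finite_path q \<alpha> \<beta> k t =
    (\<Sum>l\<in>{-half..half}. of_int (leg (int k - l)) * finite_coeff \<alpha> \<beta> (of_int l + t))"
proof -
  define R where "R = {n :: int. \<alpha> * real q < of_int n \<and> of_int n \<le> (\<alpha> + \<beta>) * real q}"
  have *: "of_int (leg n) / gauss_sum q =
      (\<Sum>l\<in>{-half..half}. of_int (leg (int k - l)) * e (- of_int ((int k - l) * n) / real q)) / of_nat q" for n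
  proof -
    have "{-half..half} = {-half..<-half + int q}" using q_eq_half by auto
    then have "(\<Sum>l\<in>{-half..half}. of_int (leg (int k - l)) * e (- of_int ((int k - l) * n) / real q)) =
       (\<Sum>b\<in>{0..<int q}. of_int (leg b) * e (- of_int (b * n) / real q))"
      using sum_complete_residues[where g = "\<lambda>l. int k - l" and q = q and R = "{-half..half}"
          and f = "\<lambda>b. of_int (leg b) * e (- of_int (b * n) / real q)"]
        bij_betw_mod_diff[OF q_pos, of "int k" "-half"] e_mod_mult[of _ "-n"] by simp
    then show ?thesis unfolding leg_div_gauss_sum by simp
  qed
  have "G_finite_path q \<alpha> \<beta> k t =
      (\<Sum>n\<in>R. of_int (leg n) / gauss_sum q * e (of_int n * (real k + t) / real q))"
    unfolding G_finite_path_def R_def by (simp add: sum_distrib_left)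
  also have "\<dots> = (\<Sum>n\<in>R. \<Sum>l\<in>{-half..half}. of_int (leg (int k - l)) *
      (e (of_int n * (of_int l + t) / real q) / of_nat q))"
    unfolding * sum_divide_distrib sum_distrib_right
  proof (intro sum.cong refl)
    fix n l
    have "e (of_int n * (of_int l + t) / real q) =
        e (- of_int ((int k - l) * n) / real q) * e (of_int n * (real k + t) / real q)"
      unfolding e_add[symmetric] by (rule arg_cong[of _ _ e])
        (simp add: add_divide_distrib[symmetric] algebra_simps)
    then show "of_int (leg (int k - l)) * e (- of_int ((int k - l) * n) / real q) / of_nat q *
        e (of_int n * (real k + t) / real q) =
        of_int (leg (int k - l)) * (e (of_int n * (of_int l + t) / real q) / of_nat q)"
      by simp
  qed
  also have "\<dots> = (\<Sum>l\<in>{-half..half}. of_int (leg (int k - l)) * finite_coeff \<alpha> \<beta> (of_int l + t))"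
    unfolding finite_coeff_def R_def by (subst sum.swap) (simp add: sum_distrib_left sum_divide_distrib)
  finally show ?thesis .
qed

end

section \<open>Lipschitz test functions\<close>

text \<open>
The largest function below \<open>\<phi>\<close> with Lipschitz constant \<open>n\<close>. For bounded continuous \<open>\<phi>\<close> these
minorants increase to \<open>\<phi>\<close> with \<open>n\<close>.
\<close>

definition lipschitz_minorant :: "('b::metric_space \<Rightarrow> real) \<Rightarrow> nat \<Rightarrow> 'b \<Rightarrow> real"
  where "lipschitz_minorant \<phi> n x = (INF y. \<phi> y + real n * dist x y)"

context
  fixes \<phi> :: "'b::metric_space \<Rightarrow> real" and B :: real
  assumes bdd: "\<And>x. \<bar>\<phi> x\<bar> \<le> B"
begin

lemma minorant_ge: "- B \<le> \<phi> y + real n * dist x y"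
proof -
  have "- B \<le> \<phi> y" using bdd[of y] by linarith
  moreover have "0 \<le> real n * dist x y" by simp
  ultimately show ?thesis by linarith
qed

lemma minorant_bdd_below: "bdd_below (range (\<lambda>y. \<phi> y + real n * dist x y))"
  by (rule bdd_belowI[of _ "- B"]) (auto intro: minorant_ge)

lemma lipschitz_minorant_lower: "lipschitz_minorant \<phi> n x \<le> \<phi> y + real n * dist x y"
  unfolding lipschitz_minorant_def by (rule cINF_lower[OF minorant_bdd_below]) simp

lemma lipschitz_minorant_le: "lipschitz_minorant \<phi> n x \<le> \<phi> x"
  using lipschitz_minorant_lower[of n x x] by simp

lemma lipschitz_minorant_ge: "- B \<le> lipschitz_minorant \<phi> n x"
  unfolding lipschitz_minorant_def by (rule cINF_greatest) (simp_all add: minorant_ge)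

lemma lipschitz_minorant_bdd: "\<bar>lipschitz_minorant \<phi> n x\<bar> \<le> B"
  using lipschitz_minorant_ge[of n x] lipschitz_minorant_le[of n x] bdd[of x] by linarith

lemma lipschitz_minorant_lipschitz:
  "\<bar>lipschitz_minorant \<phi> n x - lipschitz_minorant \<phi> n x'\<bar> \<le> real n * dist x x'"
proof -
  have "lipschitz_minorant \<phi> n x - real n * dist x x' \<le> lipschitz_minorant \<phi> n x'" for x x'
    unfolding lipschitz_minorant_def[of _ _ x']
  proof (rule cINF_greatest)
    fix y
    have "real n * dist x y \<le> real n * (dist x x' + dist x' y)"
      by (intro mult_left_mono dist_triangle) simp
    then show "lipschitz_minorant \<phi> n x - real n * dist x x' \<le> \<phi> y + real n * dist x' y"
      using lipschitz_minorant_lower[of n x y] by (simp add: distrib_left)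
  qed simp
  from this[of x x'] this[of x' x] show ?thesis by (simp add: dist_commute abs_le_iff)
qed

lemma lipschitz_minorant_tendsto:
  assumes cont: "continuous_on UNIV \<phi>"
  shows "(\<lambda>n. lipschitz_minorant \<phi> n x) \<longlonglongrightarrow> \<phi> x"
proof (rule LIMSEQ_I)
  fix r :: real assume r: "r > 0"
  obtain d where d: "d > 0" "\<And>y. dist y x < d \<Longrightarrow> dist (\<phi> y) (\<phi> x) < r / 2"
    using cont r unfolding continuous_on_iff by (meson UNIV_I half_gt_zero)
  obtain N where N: "real N \<ge> 2 * B / d" using real_arch_simple by blast
  have "norm (lipschitz_minorant \<phi> n x - \<phi> x) < r" if n: "n \<ge> N" for n
  proof -
    have "\<phi> x - r / 2 \<le> lipschitz_minorant \<phi> n x"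
      unfolding lipschitz_minorant_def
    proof (rule cINF_greatest)
      fix y
      show "\<phi> x - r / 2 \<le> \<phi> y + real n * dist x y"
      proof (cases "dist y x < d")
        case True
        have "\<phi> x - r / 2 \<le> \<phi> y" using d(2)[OF True] by (simp add: dist_real_def abs_if split: if_splits)
        moreover have "0 \<le> real n * dist x y" by simp
        ultimately show ?thesis by linarith
      next
        case False
        have "2 * B / d \<le> real n" using N n by linarith
        then have "2 * B \<le> real n * d" using d(1) by (simp add: field_simps)
        also have "\<dots> \<le> real n * dist x y" using False by (intro mult_left_mono) (simp_all add: dist_commute)
        finally show ?thesis using bdd[of x] bdd[of y] r by linarith
      qed
    qed simp
    then show ?thesis using lipschitz_minorant_le[of n x] r by (simp add: abs_if)
  qed
  then show "\<exists>N. \<forall>n\<ge>N. norm (lipschitz_minorant \<phi> n x - \<phi> x) < r" by blast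
qed

end

lemma continuous_on_if_lipschitz:
  fixes \<phi> :: "'b::metric_space \<Rightarrow> real"
  assumes "\<And>x y. \<bar>\<phi> x - \<phi> y\<bar> \<le> C * dist x y"
  shows "continuous_on UNIV \<phi>"
proof (rule continuous_onI)
  fix x :: 'b and r :: real assume r: "r > 0"
  show "\<exists>d>0. \<forall>x'\<in>UNIV. dist x' x < d \<longrightarrow> dist (\<phi> x') (\<phi> x) \<le> r"
  proof (intro exI conjI ballI impI)
    show "r / (\<bar>C\<bar> + 1) > 0" using r by simp
    fix x' assume x': "dist x' x < r / (\<bar>C\<bar> + 1)"
    have "\<bar>\<phi> x' - \<phi> x\<bar> \<le> C * dist x' x" by (rule assms)
    also have "\<dots> \<le> (\<bar>C\<bar> + 1) * dist x' x" by (intro mult_right_mono) auto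
    also have "\<dots> \<le> r" using x' r by (simp add: field_simps)
    finally show "dist (\<phi> x') (\<phi> x) \<le> r" by (simp add: dist_real_def)
  qed
qed

lemma measurable_continuous_compose:
  fixes \<phi> :: "'b::topological_space \<Rightarrow> real"
  assumes "continuous_on UNIV \<phi>" "X \<in> borel_measurable M"
  shows "(\<lambda>x. \<phi> (X x)) \<in> borel_measurable M"
  by (rule measurable_compose[OF assms(2) borel_measurable_continuous_onI[OF assms(1)]])

lemma integrable_continuous_compose:
  fixes \<phi> :: "'b::topological_space \<Rightarrow> real"
  assumes "continuous_on UNIV \<phi>" "\<And>x. \<bar>\<phi> x\<bar> \<le> B" "X \<in> borel_measurable M" "prob_space M"
  shows "integrable M (\<lambda>x. \<phi> (X x))"
proof -
  interpret prob_space M by fact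
  show ?thesis
    by (rule integrable_const_bound[of _ B]) (use assms measurable_continuous_compose in auto)
qed

text \<open>
The Lipschitz minorants of \<open>\<phi>\<close> give the lower bound \<open>\<integral> \<phi>(Z) - r\<close> for the integrals of \<open>\<phi>(X i)\<close>
in the limit, by dominated convergence on the side of \<open>Z\<close>. The upper bound is the same statement for
\<open>- \<phi>\<close>.
\<close>

lemma converges_in_distribution_lipschitz:
  fixes X :: "'i \<Rightarrow> 'a \<Rightarrow> 'b::metric_space"
  assumes ev: "\<forall>\<^sub>F i in F. prob_space (M i) \<and> X i \<in> borel_measurable (M i)"
    and N: "prob_space N" and Z: "Z \<in> borel_measurable N"
    and lip: "\<And>\<phi> B C. (\<And>x. \<bar>\<phi> x\<bar> \<le> B) \<Longrightarrow> (\<And>x y. \<bar>\<phi> x - \<phi> y\<bar> \<le> C * dist x y) \<Longrightarrow> 0 \<le> C \<Longrightarrow>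
      ((\<lambda>i. \<integral>x. \<phi> (X i x) \<partial>M i) \<longlongrightarrow> (\<integral>z. \<phi> (Z z) \<partial>N)) F"
  shows "converges_in_distribution M X N Z F"
proof -
  interpret N: prob_space N by (rule N)
  have below: "\<forall>\<^sub>F i in F. (\<integral>z. \<phi> (Z z) \<partial>N) - r < (\<integral>x. \<phi> (X i x) \<partial>M i)"
    if \<phi>: "continuous_on UNIV \<phi>" "\<And>x. \<bar>\<phi> x\<bar> \<le> B" and r: "r > 0" for \<phi> :: "'b \<Rightarrow> real" and B r :: real
  proof -
    let ?\<phi> = "lipschitz_minorant \<phi>"
    note lips = lipschitz_minorant_lipschitz[of \<phi> B, OF \<phi>(2)]
    have cont: "continuous_on UNIV (?\<phi> n)" for n
      by (rule continuous_on_if_lipschitz[OF lips])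
    have "(\<lambda>n. \<integral>z. ?\<phi> n (Z z) \<partial>N) \<longlonglongrightarrow> (\<integral>z. \<phi> (Z z) \<partial>N)"
    proof (rule integral_dominated_convergence[where w = "\<lambda>_. B"])
      show "(\<lambda>z. \<phi> (Z z)) \<in> borel_measurable N"
        by (rule measurable_continuous_compose[OF \<phi>(1) Z])
      show "(\<lambda>z. ?\<phi> n (Z z)) \<in> borel_measurable N" for n
        by (rule measurable_continuous_compose[OF cont Z])
      show "AE z in N. (\<lambda>n. ?\<phi> n (Z z)) \<longlonglongrightarrow> \<phi> (Z z)"
        using lipschitz_minorant_tendsto[of \<phi> B] \<phi> by simp
      show "AE z in N. norm (?\<phi> n (Z z)) \<le> B" for n
        using lipschitz_minorant_bdd[of \<phi> B] \<phi> by simp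
    qed simp
    from order_tendstoD(1)[OF this, of "(\<integral>z. \<phi> (Z z) \<partial>N) - r / 2"]
    obtain n where n: "(\<integral>z. \<phi> (Z z) \<partial>N) - r / 2 < (\<integral>z. ?\<phi> n (Z z) \<partial>N)"
      using r by (auto simp: eventually_sequentially)
    have "((\<lambda>i. \<integral>x. ?\<phi> n (X i x) \<partial>M i) \<longlongrightarrow> (\<integral>z. ?\<phi> n (Z z) \<partial>N)) F"
      by (rule lip[of _ B "real n"]) (use lipschitz_minorant_bdd[of \<phi> B] \<phi> lips in auto)
    then have "\<forall>\<^sub>F i in F. (\<integral>z. ?\<phi> n (Z z) \<partial>N) - r / 2 < (\<integral>x. ?\<phi> n (X i x) \<partial>M i)"
      using r by (intro order_tendstoD(1)) auto
    with ev show ?thesis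
    proof eventually_elim
      case (elim i)
      have "(\<integral>x. ?\<phi> n (X i x) \<partial>M i) \<le> (\<integral>x. \<phi> (X i x) \<partial>M i)"
        using elim \<phi> cont lipschitz_minorant_bdd[of \<phi> B] lipschitz_minorant_le[of \<phi> B]
        by (intro integral_mono integrable_continuous_compose[of _ B]) auto
      then show ?case using elim n by (simp add: field_simps)
    qed
  qed
  show ?thesis
    unfolding converges_in_distribution_def
  proof (intro conjI allI impI Z)
    show "\<forall>\<^sub>F i in F. X i \<in> borel_measurable (M i)"
      using ev by eventually_elim simp
    fix \<phi> :: "'b \<Rightarrow> real" assume \<phi>: "continuous_on UNIV \<phi> \<and> bounded (range \<phi>)"
    then obtain B where B: "\<And>x. \<bar>\<phi> x\<bar> \<le> B" by (auto simp: bounded_iff)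
    have \<phi>': "continuous_on UNIV (\<lambda>x. - \<phi> x)" using \<phi> by (intro continuous_intros) simp
    show "((\<lambda>i. \<integral>x. \<phi> (X i x) \<partial>M i) \<longlongrightarrow> (\<integral>z. \<phi> (Z z) \<partial>N)) F"
    proof (rule tendstoI)
      fix r :: real assume r: "r > 0"
      have "\<forall>\<^sub>F i in F. (\<integral>z. \<phi> (Z z) \<partial>N) - r < (\<integral>x. \<phi> (X i x) \<partial>M i)"
        using below[of \<phi> B r] \<phi> B r by simp
      moreover have "\<forall>\<^sub>F i in F. (\<integral>z. - \<phi> (Z z) \<partial>N) - r < (\<integral>x. - \<phi> (X i x) \<partial>M i)"
        by (rule below[OF \<phi>' _ r]) (use B in simp)
      ultimately show "\<forall>\<^sub>F i in F. dist (\<integral>x. \<phi> (X i x) \<partial>M i) (\<integral>z. \<phi> (Z z) \<partial>N) < r"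
        by eventually_elim (simp add: dist_real_def abs_if)
    qed
  qed
qed

section \<open>Second moments and Walsh expansion\<close>

text \<open>
The correlation matrix is the identity minus \<open>\<eta>\<close> times the all-ones matrix, hence at most the
identity as a quadratic form. Independent signs have \<open>\<eta> = 0\<close>, and Legendre symbols of shifts of a
random residue modulo \<open>q\<close> have \<open>\<eta> = 1 / q\<close>.
\<close>

lemma (in prob_space) expectation_norm_sum_le:
  fixes X :: "'i \<Rightarrow> 'a \<Rightarrow> real" and w :: "'i \<Rightarrow> complex"
  assumes fin: "finite A" and meas: "\<And>l. l \<in> A \<Longrightarrow> X l \<in> borel_measurable M"
    and bdd: "\<And>l \<omega>. l \<in> A \<Longrightarrow> \<omega> \<in> space M \<Longrightarrow> \<bar>X l \<omega>\<bar> \<le> 1"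
    and corr: "\<And>l l'. l \<in> A \<Longrightarrow> l' \<in> A \<Longrightarrow>
      expectation (\<lambda>\<omega>. X l \<omega> * X l' \<omega>) = (if l = l' then 1 else 0) - \<eta>"
    and \<eta>: "0 \<le> \<eta>"
  shows "integrable M (\<lambda>\<omega>. norm (\<Sum>l\<in>A. of_real (X l \<omega>) * w l)) \<and>
    expectation (\<lambda>\<omega>. norm (\<Sum>l\<in>A. of_real (X l \<omega>) * w l)) \<le> sqrt (\<Sum>l\<in>A. (norm (w l))\<^sup>2)"
proof -
  define Z where "Z \<omega> = norm (\<Sum>l\<in>A. of_real (X l \<omega>) * w l)" for \<omega>
  have int2: "integrable M (\<lambda>\<omega>. X l \<omega> * X l' \<omega>)" if "l \<in> A" "l' \<in> A" for l l'
    using bdd that meas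
    by (intro integrable_const_bound[of _ 1]) (auto simp: abs_mult intro!: mult_le_one)
  have real: "integrable M (\<lambda>\<omega>. (\<Sum>l\<in>A. X l \<omega> * a l)\<^sup>2) \<and>
      expectation (\<lambda>\<omega>. (\<Sum>l\<in>A. X l \<omega> * a l)\<^sup>2) \<le> (\<Sum>l\<in>A. (a l)\<^sup>2)" for a :: "'i \<Rightarrow> real"
  proof
    have eq: "(\<lambda>\<omega>. (\<Sum>l\<in>A. X l \<omega> * a l)\<^sup>2) =
        (\<lambda>\<omega>. \<Sum>l\<in>A. \<Sum>l'\<in>A. (X l \<omega> * X l' \<omega>) * (a l * a l'))"
      unfolding power2_eq_square sum_product by (simp add: mult_ac)
    show "integrable M (\<lambda>\<omega>. (\<Sum>l\<in>A. X l \<omega> * a l)\<^sup>2)"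
      unfolding eq using int2 by (intro Bochner_Integration.integrable_sum integrable_mult_left) auto
    have "expectation (\<lambda>\<omega>. (\<Sum>l\<in>A. X l \<omega> * a l)\<^sup>2) =
        (\<Sum>l\<in>A. \<Sum>l'\<in>A. expectation (\<lambda>\<omega>. X l \<omega> * X l' \<omega>) * (a l * a l'))"
      unfolding eq using int2
      by (subst Bochner_Integration.integral_sum; (intro sum.cong refl Bochner_Integration.integrable_sum integrable_mult_left)?)
        (auto simp: Bochner_Integration.integral_sum)
    also have "\<dots> = (\<Sum>l\<in>A. \<Sum>l'\<in>A. (if l = l' then (a l)\<^sup>2 else 0) - \<eta> * (a l * a l'))"
      by (intro sum.cong refl) (auto simp: corr power2_eq_square algebra_simps)
    also have "\<dots> = (\<Sum>l\<in>A. (a l)\<^sup>2) - \<eta> * (\<Sum>l\<in>A. a l)\<^sup>2"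
    proof -
      have "\<eta> * (\<Sum>l\<in>A. a l)\<^sup>2 = (\<Sum>l\<in>A. \<Sum>l'\<in>A. \<eta> * (a l * a l'))"
        unfolding power2_eq_square sum_product by (simp only: sum_distrib_left)
      then show ?thesis using fin by (simp add: sum_subtractf)
    qed
    also have "\<dots> \<le> (\<Sum>l\<in>A. (a l)\<^sup>2)" using \<eta> by simp
    finally show "expectation (\<lambda>\<omega>. (\<Sum>l\<in>A. X l \<omega> * a l)\<^sup>2) \<le> (\<Sum>l\<in>A. (a l)\<^sup>2)" .
  qed
  have Z2: "(Z \<omega>)\<^sup>2 = (\<Sum>l\<in>A. X l \<omega> * Re (w l))\<^sup>2 + (\<Sum>l\<in>A. X l \<omega> * Im (w l))\<^sup>2" for \<omega>
    unfolding Z_def cmod_power2 by simp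
  have intZ2: "integrable M (\<lambda>\<omega>. (Z \<omega>)\<^sup>2)"
    unfolding Z2 using real by (intro Bochner_Integration.integrable_add) auto
  have Zmeas: "Z \<in> borel_measurable M"
    unfolding Z_def using meas by measurable
  have intZ: "integrable M Z"
  proof (rule Bochner_Integration.integrable_bound)
    \<comment> \<open>Square integrability dominates integrability through \<open>2 Z \<le> 1 + Z\<^sup>2\<close>.\<close>
    show "integrable M (\<lambda>\<omega>. 1 + (Z \<omega>)\<^sup>2)" using intZ2 by simp
    have "norm (Z \<omega>) \<le> norm (1 + (Z \<omega>)\<^sup>2)" for \<omega>
    proof -
      have "0 \<le> (Z \<omega> - 1)\<^sup>2" by simp
      then have "2 * Z \<omega> \<le> 1 + (Z \<omega>)\<^sup>2" by (simp add: power2_eq_square algebra_simps)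
      moreover have "0 \<le> Z \<omega>" by (simp add: Z_def)
      ultimately show ?thesis by simp
    qed
    then show "AE \<omega> in M. norm (Z \<omega>) \<le> norm (1 + (Z \<omega>)\<^sup>2)" by simp
  qed fact
  have "(expectation Z)\<^sup>2 \<le> expectation (\<lambda>\<omega>. (Z \<omega>)\<^sup>2)"
    using variance_eq[OF intZ intZ2] variance_positive[of Z] by simp
  also have "\<dots> \<le> (\<Sum>l\<in>A. (Re (w l))\<^sup>2) + (\<Sum>l\<in>A. (Im (w l))\<^sup>2)"
    unfolding Z2 using real[of "\<lambda>l. Re (w l)"] real[of "\<lambda>l. Im (w l)"]
    by (subst Bochner_Integration.integral_add) auto
  also have "\<dots> = (\<Sum>l\<in>A. (norm (w l))\<^sup>2)"
    by (simp add: cmod_power2 sum.distrib)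
  finally have "expectation Z \<le> sqrt (\<Sum>l\<in>A. (norm (w l))\<^sup>2)" by (rule real_le_rsqrt)
  with intZ show ?thesis unfolding Z_def by blast
qed

text \<open>
Induction on \<open>A\<close>: on the values \<open>1\<close> and \<open>-1\<close> of one coordinate every function is the sum of its even
part and the coordinate times its odd part.
\<close>

lemma walsh_expansion:
  fixes h :: "('i \<Rightarrow> real) \<Rightarrow> real"
  assumes "finite A" "\<And>x y. (\<And>l. l \<in> A \<Longrightarrow> x l = y l) \<Longrightarrow> h x = h y"
  shows "\<exists>c. \<forall>x. (\<forall>l\<in>A. x l \<in> {-1, 1}) \<longrightarrow> h x = (\<Sum>S\<in>Pow A. c S * (\<Prod>l\<in>S. x l))"
  using assms
proof (induction A arbitrary: h rule: finite_induct)
  case empty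
  have "h x = h (\<lambda>_. 0)" for x by (rule empty) simp
  then show ?case by (intro exI[of _ "\<lambda>_. h (\<lambda>_. 0)"]) simp
next
  case (insert a A)
  have "\<exists>c. \<forall>x. (\<forall>l\<in>A. x l \<in> {-1, 1}) \<longrightarrow> h (x(a := s)) = (\<Sum>S\<in>Pow A. c S * (\<Prod>l\<in>S. x l))" for s
    by (rule insert.IH) (auto intro!: insert.prems)
  then obtain c where c: "\<And>s x. (\<forall>l\<in>A. x l \<in> {-1, 1}) \<Longrightarrow>
      h (x(a := s)) = (\<Sum>S\<in>Pow A. c s S * (\<Prod>l\<in>S. x l))" by metis
  define d where "d S = (if a \<in> S then (c 1 (S - {a}) - c (-1) (S - {a})) / 2
      else (c 1 S + c (-1) S) / 2)" for S
  show ?case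
  proof (intro exI allI impI)
    fix x assume x: "\<forall>l\<in>insert a A. x l \<in> {-1, 1::real}"
    then have xA: "\<forall>l\<in>A. x l \<in> {-1, 1}" and xa: "x a = 1 \<or> x a = -1" by auto
    have inj: "inj_on (insert a) (Pow A)"
      using insert.hyps by (auto simp: inj_on_def)
    have "(\<Sum>S\<in>Pow (insert a A). d S * (\<Prod>l\<in>S. x l)) =
        (\<Sum>S\<in>Pow A. d S * (\<Prod>l\<in>S. x l)) + (\<Sum>S\<in>insert a ` Pow A. d S * (\<Prod>l\<in>S. x l))"
      unfolding Pow_insert using insert.hyps by (intro sum.union_disjoint) auto
    also have "(\<Sum>S\<in>insert a ` Pow A. d S * (\<Prod>l\<in>S. x l)) =
        (\<Sum>S\<in>Pow A. d (insert a S) * (\<Prod>l\<in>insert a S. x l))"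
      by (rule sum.reindex[OF inj, unfolded comp_def])
    also have "\<dots> = (\<Sum>S\<in>Pow A. x a * ((c 1 S - c (-1) S) / 2 * (\<Prod>l\<in>S. x l)))"
    proof (rule sum.cong[OF refl])
      fix S assume "S \<in> Pow A"
      then have "a \<notin> S" "finite S" using insert.hyps finite_subset by auto
      then show "d (insert a S) * (\<Prod>l\<in>insert a S. x l) = x a * ((c 1 S - c (-1) S) / 2 * (\<Prod>l\<in>S. x l))"
        by (simp add: d_def)
    qed
    also have "(\<Sum>S\<in>Pow A. d S * (\<Prod>l\<in>S. x l)) = (\<Sum>S\<in>Pow A. (c 1 S + c (-1) S) / 2 * (\<Prod>l\<in>S. x l))"
      by (rule sum.cong[OF refl]) (use insert.hyps in \<open>auto simp: d_def\<close>)
    finally have "(\<Sum>S\<in>Pow (insert a A). d S * (\<Prod>l\<in>S. x l)) =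
        (\<Sum>S\<in>Pow A. c (x a) S * (\<Prod>l\<in>S. x l))"
      using xa by (auto simp: sum.distrib[symmetric] sum_negf[symmetric] field_simps intro!: sum.cong)
    also have "\<dots> = h (x(a := x a))" by (rule c[OF xA, symmetric])
    finally show "h x = (\<Sum>S\<in>Pow (insert a A). d S * (\<Prod>l\<in>S. x l))" by simp
  qed
qed

section \<open>Independent signs\<close>

locale rademacher = prob_space M for M :: "'a measure" +
  fixes Y :: "int \<Rightarrow> 'a \<Rightarrow> real"
  assumes indep: "indep_vars (\<lambda>_. count_space {-1, 1}) Y UNIV"
    and distr: "\<And>l. distr M (count_space {-1, 1}) (Y l) = uniform_count_measure {-1, 1}"
begin

lemma measurable_Y: "Y l \<in> measurable M (count_space {-1, 1})"
  using indep unfolding indep_vars_def by simp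

lemma measurable_Y_borel [measurable]: "Y l \<in> borel_measurable M"
  using measurable_Y by (rule measurable_compose) simp

lemma Y_values: "\<omega> \<in> space M \<Longrightarrow> Y l \<omega> \<in> {-1, 1}"
  using measurable_space[OF measurable_Y] by simp

lemma expectation_Y: "expectation (Y l) = 0"
proof -
  have "expectation (Y l) = (\<integral>x. x \<partial>distr M (count_space {-1, 1}) (Y l))"
    by (rule integral_distr[OF measurable_Y, symmetric]) simp
  also have "\<dots> = 0" unfolding distr by (simp add: integral_uniform_count_measure)
  finally show ?thesis .
qed

lemma expectation_prod_Y:
  assumes "finite S" "S \<noteq> {}"
  shows "expectation (\<lambda>\<omega>. \<Prod>l\<in>S. Y l \<omega>) = 0"
proof -
  have "indep_vars (\<lambda>_. borel) (\<lambda>l \<omega>. Y l \<omega>) UNIV"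
    by (rule indep_vars_compose2[OF indep]) simp
  then have "indep_vars (\<lambda>_. borel) (\<lambda>l \<omega>. Y l \<omega>) S"
    by (rule indep_vars_subset) simp
  moreover have "integrable M (Y l)" for l
  proof (rule integrable_const_bound[of _ 1])
    have "norm (Y l \<omega>) \<le> 1" if "\<omega> \<in> space M" for \<omega>
      using Y_values[OF that, of l] by auto
    then show "AE \<omega> in M. norm (Y l \<omega>) \<le> 1" by simp
  qed simp
  ultimately have "expectation (\<lambda>\<omega>. \<Prod>l\<in>S. Y l \<omega>) = (\<Prod>l\<in>S. expectation (Y l))"
    using assms by (intro indep_vars_lebesgue_integral) auto
  also have "\<dots> = 0" using assms by (auto simp: expectation_Y)
  finally show ?thesis .
qed

lemma expectation_Y_Y: "expectation (\<lambda>\<omega>. Y l \<omega> * Y l' \<omega>) = (if l = l' then 1 else 0) - 0"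
proof (cases "l = l'")
  case True
  have "expectation (\<lambda>\<omega>. Y l \<omega> * Y l \<omega>) = expectation (\<lambda>\<omega>. 1)"
  proof (rule Bochner_Integration.integral_cong[OF refl])
    fix \<omega> assume "\<omega> \<in> space M"
    then show "Y l \<omega> * Y l \<omega> = 1" using Y_values[of \<omega> l] by auto
  qed
  then show ?thesis using True by (simp add: prob_space)
next
  case False
  then show ?thesis using expectation_prod_Y[of "{l, l'}"] by simp
qed

lemma expectation_norm_sum_Y_le:
  fixes w :: "int \<Rightarrow> complex"
  assumes "finite A"
  shows "integrable M (\<lambda>\<omega>. norm (\<Sum>l\<in>A. of_real (Y l \<omega>) * w l))"
    and "expectation (\<lambda>\<omega>. norm (\<Sum>l\<in>A. of_real (Y l \<omega>) * w l)) \<le> sqrt (\<Sum>l\<in>A. (norm (w l))\<^sup>2)"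
proof -
  have "\<bar>Y l \<omega>\<bar> \<le> 1" if "\<omega> \<in> space M" for l \<omega>
    using Y_values[OF that, of l] by auto
  from expectation_norm_sum_le[OF assms measurable_Y_borel this expectation_Y_Y order_refl, of w]
  show "integrable M (\<lambda>\<omega>. norm (\<Sum>l\<in>A. of_real (Y l \<omega>) * w l))"
    and "expectation (\<lambda>\<omega>. norm (\<Sum>l\<in>A. of_real (Y l \<omega>) * w l)) \<le> sqrt (\<Sum>l\<in>A. (norm (w l))\<^sup>2)"
    by blast+
qed

text \<open>
Sums of measurable functions into a space without a countable base need not be measurable. Here this is
avoided because only finitely many sign patterns occur.
\<close>

lemma measurable_finitely_determined:
  assumes "finite A" "\<And>x y. (\<And>l. l \<in> A \<Longrightarrow> x l = y l) \<Longrightarrow> h x = h y"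
  shows "(\<lambda>\<omega>. h (\<lambda>l. Y l \<omega>)) \<in> measurable M (borel :: 'b::topological_space measure)"
proof -
  let ?P = "A \<rightarrow>\<^sub>E {-1, 1 :: real}"
  have fin: "finite ?P" using assms(1) by (intro finite_PiE) auto
  have "(\<lambda>\<omega>. restrict (\<lambda>l. Y l \<omega>) A) \<in> measurable M (count_space ?P)"
    unfolding measurable_count_space_eq2[OF fin]
  proof (intro conjI ballI)
    show "(\<lambda>\<omega>. restrict (\<lambda>l. Y l \<omega>) A) \<in> space M \<rightarrow> ?P"
      using Y_values by auto
    fix \<sigma> assume \<sigma>: "\<sigma> \<in> ?P"
    have "(\<lambda>\<omega>. restrict (\<lambda>l. Y l \<omega>) A) -` {\<sigma>} \<inter> space M = {\<omega>\<in>space M. \<forall>l\<in>A. Y l \<omega> = \<sigma> l}"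
      using \<sigma> by (auto simp: fun_eq_iff restrict_def PiE_def extensional_def)
    also have "\<dots> \<in> sets M"
      using assms(1) by measurable
    finally show "(\<lambda>\<omega>. restrict (\<lambda>l. Y l \<omega>) A) -` {\<sigma>} \<inter> space M \<in> sets M" .
  qed
  moreover have "h \<in> measurable (count_space ?P) borel" by simp
  ultimately have "(\<lambda>\<omega>. h (restrict (\<lambda>l. Y l \<omega>) A)) \<in> measurable M borel"
    by (rule measurable_compose)
  also have "(\<lambda>\<omega>. h (restrict (\<lambda>l. Y l \<omega>) A)) = (\<lambda>\<omega>. h (\<lambda>l. Y l \<omega>))"
    by (intro ext assms(2)) simp
  finally show ?thesis .
qed

end

section \<open>Equidistribution of sign patterns\<close>

abbreviation primes_at_top :: "nat filter"
  where "primes_at_top \<equiv> inf at_top (principal {q. prime q})"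

lemma eventually_odd_prime: "\<forall>\<^sub>F q in primes_at_top. odd_prime q \<and> q \<ge> n"
proof -
  have "\<forall>\<^sub>F q in at_top. prime q \<longrightarrow> odd_prime q \<and> q \<ge> n"
    using eventually_ge_at_top[of "max 3 n"] by eventually_elim (auto simp: odd_prime_def)
  then show ?thesis by (simp add: eventually_inf_principal)
qed

lemma tendsto_divide_primes: "((\<lambda>q. c / real q) \<longlongrightarrow> 0) primes_at_top"
proof (rule tendsto_mono)
  show "primes_at_top \<le> sequentially" by simp
  show "(\<lambda>q. c / real q) \<longlonglongrightarrow> 0" by (rule lim_const_over_n)
qed

context odd_prime
begin

lemma sum_leg_shift:
  assumes "\<And>n. f (n mod int q) = f n"
  shows "(\<Sum>k<q. f (int k)) = (\<Sum>k\<in>{0..<int q}. (f (k - b) :: 'b::comm_monoid_add))"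
proof -
  have "(\<Sum>k<q. f (int k)) = (\<Sum>k\<in>{0..<int q}. f k)"
    by (rule sum.reindex_bij_witness[of _ nat int]) auto
  also have "\<dots> = (\<Sum>k\<in>{0..<int q}. f (k - b))"
  proof (rule sum_complete_residues[symmetric, where g = "\<lambda>k. k - b"])
    show "bij_betw (\<lambda>x. (x - b) mod int q) {0..<int q} {0..<int q}"
    proof (rule bij_betw_mod_if_inj[OF q_pos])
      show "inj_on (\<lambda>x. (x - b) mod int q) {0..<int q}"
      proof (rule inj_onI)
        fix x y assume xy: "x \<in> {0..<int q}" "y \<in> {0..<int q}" "(x - b) mod int q = (y - b) mod int q"
        then have "x mod int q = y mod int q" using mod_eq_dvd_iff[of x "int q" y]
          by (simp add: mod_eq_dvd_iff[of "x - b"])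
        then show "x = y" using xy by simp
      qed
    qed auto
  qed (rule assms)
  finally show ?thesis .
qed

lemma leg_mod_diff: "leg (n mod int q - a) = leg (n - a)"
  by (rule legendre_cong) (simp add: cong_def mod_diff_left_eq)

end

text \<open>
Shift \<open>A\<close> by \<open>b\<close> to make its elements positive, so that for large \<open>q\<close> they are distinct nonzero
residues. The correlation bound then gives \<open>(m + 1) / (2 c) + m / q\<close>, in which first \<open>c\<close> and then \<open>q\<close>
is taken large.
\<close>

lemma legendre_correlation_tendsto_0:
  fixes A :: "int set"
  assumes "finite A" "A \<noteq> {}"
  shows "((\<lambda>q. (\<Sum>k<q. \<Prod>a\<in>A. real_of_int (Legendre (int k - a) (int q))) / real q) \<longlongrightarrow> 0) primes_at_top"
proof (rule tendstoI)
  fix r :: real assume r: "r > 0"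
  define m where "m = card A"
  obtain c :: nat where c: "real c > (m + 1) / r" using reals_Archimedean2 by blast
  have c0: "c > 0" using c r by (cases c) (auto simp: field_simps)
  \<comment> \<open>The shift that moves the least element of \<open>A\<close> to \<open>1\<close>.\<close>
  define b where "b = 1 - Min A"
  define A' where "A' = (\<lambda>a. a + b) ` A"
  have A': "finite A'" "A' \<noteq> {}" "card A' = m" using assms by (auto simp: A'_def m_def card_image)
  have pos: "a \<ge> 1" if "a \<in> A'" for a using that assms by (auto simp: A'_def b_def)
  define K where "K = nat (Max A') + 1"
  have K: "a < int K" if "a \<in> A'" for a
    using Max_ge[OF A'(1) that] pos[OF that] by (simp add: K_def)
  have "((\<lambda>q. real m / real q) \<longlongrightarrow> 0) primes_at_top" by (rule tendsto_divide_primes)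
  then have "\<forall>\<^sub>F q in primes_at_top. real m / real q < r / 2"
    using r by (intro order_tendstoD(2)) auto
  moreover have "\<forall>\<^sub>F q in primes_at_top. odd_prime q \<and> q \<ge> max K (m + 2 * c * (2 * c * m + c + 1) + 1)"
    by (rule eventually_odd_prime)
  ultimately show "\<forall>\<^sub>F q in primes_at_top.
      dist ((\<Sum>k<q. \<Prod>a\<in>A. real_of_int (Legendre (int k - a) (int q))) / real q) 0 < r"
  proof eventually_elim
    case (elim q)
    then interpret odd_prime q by simp
    have "inj_on (\<lambda>a. a mod int q) A'" "\<forall>a\<in>A'. \<not> int q dvd a"
    proof -
      have 1: "a mod int q = a" if "a \<in> A'" for a
        using pos[OF that] K[OF that] elim by simp
      then show "inj_on (\<lambda>a. a mod int q) A'" by (auto simp: inj_on_def)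
      show "\<forall>a\<in>A'. \<not> int q dvd a" using 1 pos by (force simp: dvd_eq_mod_eq_0)
    qed
    then have bound: "2 * int c * \<bar>\<Sum>k<q. \<Prod>a\<in>A'. leg (int k - a)\<bar> \<le> (int m + 1) * int q + 2 * int c * int m"
      using legendre_correlation_bound[OF prime] A' elim
      unfolding legendre_correlation_bound_def by auto
    have prod: "(\<Prod>a\<in>A'. leg (k - a)) = (\<Prod>a\<in>A. leg (k - b - a))" for k
      unfolding A'_def by (subst prod.reindex) (auto simp: inj_on_def algebra_simps)
    have "(\<Sum>k<q. \<Prod>a\<in>A'. leg (int k - a)) = (\<Sum>k\<in>{0..<int q}. \<Prod>a\<in>A'. leg (k - 0 - a))"
      by (subst sum_leg_shift[of _ 0, symmetric]) (simp_all add: leg_mod_diff)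
    also have "\<dots> = (\<Sum>k\<in>{0..<int q}. \<Prod>a\<in>A. leg (k - b - a))"
      by (simp add: prod)
    also have "\<dots> = (\<Sum>k<q. \<Prod>a\<in>A. leg (int k - a))"
      by (subst sum_leg_shift[of "\<lambda>k. \<Prod>a\<in>A. leg (k - a)" b]) (simp_all add: leg_mod_diff)
    finally have eq: "(\<Sum>k<q. \<Prod>a\<in>A'. leg (int k - a)) = (\<Sum>k<q. \<Prod>a\<in>A. leg (int k - a))" .
    define T where "T = (\<Sum>k<q. \<Prod>a\<in>A. real_of_int (leg (int k - a)))"
    have "real_of_int (2 * int c * \<bar>\<Sum>k<q. \<Prod>a\<in>A. leg (int k - a)\<bar>) \<le>
        real_of_int ((int m + 1) * int q + 2 * int c * int m)"
      using bound unfolding eq of_int_le_iff .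
    then have "2 * real c * \<bar>T\<bar> \<le> (real m + 1) * real q + 2 * real c * real m"
      by (simp add: T_def)
    then have "\<bar>T\<bar> / real q \<le> (real m + 1) / (2 * real c) + real m / real q"
      using q_pos c0 by (simp add: field_simps)
    also have "(real m + 1) / (2 * real c) < r / 2"
      using c c0 r by (simp add: field_simps)
    also have "real m / real q < r / 2" using elim by simp
    finally show ?case unfolding T_def using q_pos by simp
  qed
qed

context rademacher
begin

text \<open>
On sign patterns \<open>h\<close> equals its Walsh expansion, whose average tends to the constant coefficient
because all correlations tend to zero. For the same reason that coefficient is the expectation of
\<open>h\<close> of independent signs. A Legendre symbol is zero for at most \<open>card A\<close> of the \<open>q\<close> values of \<open>k\<close>, and
these contribute \<open>O(1 / q)\<close>.
\<close>

lemma pattern_equidistribution: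
  fixes h :: "(int \<Rightarrow> real) \<Rightarrow> real"
  assumes fin: "finite A"
    and dep: "\<And>x y. (\<And>l. l \<in> A \<Longrightarrow> x l = y l) \<Longrightarrow> h x = h y"
    and bdd: "\<And>x. \<bar>h x\<bar> \<le> B"
  shows "((\<lambda>q. (\<Sum>k<q. h (\<lambda>l. of_int (Legendre (int k - l) (int q)))) / real q) \<longlongrightarrow>
    expectation (\<lambda>\<omega>. h (\<lambda>l. Y l \<omega>))) primes_at_top"
proof -
  obtain c where c: "\<And>x. (\<forall>l\<in>A. x l \<in> {-1, 1}) \<Longrightarrow> h x = (\<Sum>S\<in>Pow A. c S * (\<Prod>l\<in>S. x l))"
    using walsh_expansion[of A h, OF fin dep] by blast
  define W where "W x = (\<Sum>S\<in>Pow A. c S * (\<Prod>l\<in>S. x l))" for x :: "int \<Rightarrow> real"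
  define D where "D = B + (\<Sum>S\<in>Pow A. \<bar>c S\<bar>)"
  have intS: "integrable M (\<lambda>\<omega>. \<Prod>l\<in>S. Y l \<omega>)" for S
  proof (rule integrable_const_bound[of _ 1])
    have "\<bar>\<Prod>l\<in>S. Y l \<omega>\<bar> \<le> 1" if "\<omega> \<in> space M" for \<omega>
    proof -
      have "\<bar>Y l \<omega>\<bar> \<le> 1" for l using Y_values[OF that, of l] by auto
      then show ?thesis unfolding abs_prod by (intro prod_le_1) auto
    qed
    then show "AE \<omega> in M. norm (\<Prod>l\<in>S. Y l \<omega>) \<le> 1" by simp
  qed simp
  have "expectation (\<lambda>\<omega>. h (\<lambda>l. Y l \<omega>)) = expectation (\<lambda>\<omega>. W (\<lambda>l. Y l \<omega>))"
    unfolding W_def using Y_values by (intro Bochner_Integration.integral_cong refl c) auto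
  also have "\<dots> = (\<Sum>S\<in>Pow A. c S * expectation (\<lambda>\<omega>. \<Prod>l\<in>S. Y l \<omega>))"
    unfolding W_def using intS by (subst Bochner_Integration.integral_sum) auto
  also have "\<dots> = (\<Sum>S\<in>Pow A. if S = {} then c {} else 0)"
  proof (rule sum.cong[OF refl])
    fix S assume "S \<in> Pow A"
    then have "finite S" using fin finite_subset by auto
    then show "c S * expectation (\<lambda>\<omega>. \<Prod>l\<in>S. Y l \<omega>) = (if S = {} then c {} else 0)"
      using expectation_prod_Y[of S] by (auto simp: prob_space)
  qed
  also have "\<dots> = c {}" using fin by simp
  finally have lim: "expectation (\<lambda>\<omega>. h (\<lambda>l. Y l \<omega>)) = c {}" .
  define X where "X q k l = real_of_int (Legendre (int k - l) (int q))" for q k l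
  have "((\<lambda>q. (\<Sum>k<q. \<Prod>l\<in>S. X q k l) / real q) \<longlongrightarrow> (if S = {} then 1 else 0)) primes_at_top"
    if "S \<in> Pow A" for S
  proof (cases "S = {}")
    case True
    have "\<forall>\<^sub>F q in primes_at_top. (\<Sum>k<q. \<Prod>l\<in>S. X q k l) / real q = 1"
      using eventually_odd_prime[of 1] by eventually_elim (simp add: True)
    then show ?thesis using True by (simp add: tendsto_eventually)
  next
    case False
    have "finite S" using that fin finite_subset by auto
    then show ?thesis
      using legendre_correlation_tendsto_0[OF _ False] False by (simp add: X_def)
  qed
  then have "((\<lambda>q. \<Sum>S\<in>Pow A. c S * ((\<Sum>k<q. \<Prod>l\<in>S. X q k l) / real q)) \<longlongrightarrow>
      (\<Sum>S\<in>Pow A. c S * (if S = {} then 1 else 0))) primes_at_top"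
    by (intro tendsto_sum tendsto_mult_left) auto
  also have "(\<Sum>S\<in>Pow A. c S * (if S = {} then 1 else 0)) = c {}"
    using fin by (simp add: if_distrib cong: if_cong)
  also have "(\<lambda>q. \<Sum>S\<in>Pow A. c S * ((\<Sum>k<q. \<Prod>l\<in>S. X q k l) / real q)) =
      (\<lambda>q. (\<Sum>k<q. W (X q k)) / real q)"
    unfolding W_def by (subst sum.swap) (simp add: sum_divide_distrib sum_distrib_left)
  finally have W: "((\<lambda>q. (\<Sum>k<q. W (X q k)) / real q) \<longlongrightarrow> c {}) primes_at_top" .
  have "((\<lambda>q. (\<Sum>k<q. h (X q k)) / real q - (\<Sum>k<q. W (X q k)) / real q) \<longlongrightarrow> 0) primes_at_top"
  proof (rule Lim_null_comparison)
    show "((\<lambda>q. real (card A) * D / real q) \<longlongrightarrow> 0) primes_at_top"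
      by (rule tendsto_divide_primes)
    show "\<forall>\<^sub>F q in primes_at_top. norm ((\<Sum>k<q. h (X q k)) / real q - (\<Sum>k<q. W (X q k)) / real q)
        \<le> real (card A) * D / real q"
      using eventually_odd_prime[of 1]
    proof eventually_elim
      case (elim q)
      then interpret odd_prime q by simp
      \<comment> \<open>The values of \<open>k\<close> at which one of the Legendre symbols is zero.\<close>
      define E where "E = (\<lambda>l. nat (l mod int q)) ` A"
      have "card E \<le> card A" unfolding E_def by (rule card_image_le[OF fin])
      have D: "\<bar>h (X q k) - W (X q k)\<bar> \<le> D" for k
      proof -
        have "\<bar>W (X q k)\<bar> \<le> (\<Sum>S\<in>Pow A. \<bar>c S * (\<Prod>l\<in>S. X q k l)\<bar>)"
          unfolding W_def by (rule sum_abs)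
        also have "\<dots> \<le> (\<Sum>S\<in>Pow A. \<bar>c S\<bar>)"
        proof (rule sum_mono)
          fix S
          have "\<bar>X q k l\<bar> \<le> 1" for l using abs_leg_le_1[of "int k - l"] unfolding X_def by linarith
          then have "\<bar>\<Prod>l\<in>S. X q k l\<bar> \<le> 1" unfolding abs_prod by (intro prod_le_1) auto
          then show "\<bar>c S * (\<Prod>l\<in>S. X q k l)\<bar> \<le> \<bar>c S\<bar>"
            unfolding abs_mult by (rule mult_left_le) simp
        qed
        finally show ?thesis using bdd[of "X q k"] unfolding D_def by linarith
      qed
      have zero: "h (X q k) - W (X q k) = 0" if "k \<in> {..<q} - E" for k
      proof -
        have "X q k l \<in> {-1, 1}" if l: "l \<in> A" for l
        proof -
          have "\<not> int q dvd int k - l"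
          proof
            assume "int q dvd int k - l"
            then have "int k mod int q = l mod int q" by (simp add: mod_eq_dvd_iff)
            then have "k = nat (l mod int q)" using \<open>k \<in> {..<q} - E\<close> by simp
            then show False using \<open>k \<in> {..<q} - E\<close> l by (auto simp: E_def)
          qed
          then show ?thesis unfolding X_def by (auto simp: Legendre_def cong_0_iff)
        qed
        then show ?thesis unfolding W_def by (simp add: c)
      qed
      have "E \<subseteq> {..<q}" using q_pos by (auto simp: E_def nat_less_iff)
      have "norm ((\<Sum>k<q. h (X q k)) / real q - (\<Sum>k<q. W (X q k)) / real q) =
          \<bar>\<Sum>k<q. h (X q k) - W (X q k)\<bar> / real q"
        by (simp add: sum_subtractf flip: diff_divide_distrib)
      also have "(\<Sum>k<q. h (X q k) - W (X q k)) = (\<Sum>k\<in>E. h (X q k) - W (X q k))"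
        by (rule sum.mono_neutral_right) (use \<open>E \<subseteq> {..<q}\<close> zero in auto)
      also have "\<bar>\<Sum>k\<in>E. h (X q k) - W (X q k)\<bar> \<le> (\<Sum>k\<in>E. D)"
        by (rule order_trans[OF sum_abs sum_mono]) (rule D)
      also have "(\<Sum>k\<in>E. D) = real (card E) * D" by simp
      also have "\<dots> \<le> real (card A) * D"
        using D[of 0] \<open>card E \<le> card A\<close> by (intro mult_right_mono) auto
      finally show ?case by (simp add: divide_right_mono)
    qed
  qed
  from tendsto_add[OF this W] show ?thesis unfolding lim by (simp add: X_def[abs_def])
qed

end

section \<open>Kernel estimates\<close>

lemma e_eq_iexp: "e y = exp (\<i> * of_real (2 * pi * y))"
  by (simp add: e_def mult_ac)

lemma norm_e_minus_1_le: "norm (e y - 1) \<le> 2 * pi * \<bar>y\<bar>"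
  using iexp_approx1[of "2 * pi * y" 0] by (simp add: e_eq_iexp abs_mult)

lemma norm_e_minus_linear_le: "norm (e y - 1 - 2 * of_real pi * \<i> * of_real y) \<le> 2 * pi\<^sup>2 * y\<^sup>2"
proof -
  have "norm (e y - (1 + \<i> * of_real (2 * pi * y))) \<le> \<bar>2 * pi * y\<bar>\<^sup>2 / 2"
    using iexp_approx1[of "2 * pi * y" 1] by (simp add: e_eq_iexp numeral_2_eq_2)
  also have "\<bar>2 * pi * y\<bar>\<^sup>2 / 2 = 2 * pi\<^sup>2 * y\<^sup>2" by (simp add: power_mult_distrib)
  finally show ?thesis by (simp add: algebra_simps)
qed

lemma norm_e_diff_le: "norm (e x - e y) \<le> 2 * pi * \<bar>x - y\<bar>"
proof -
  have "e x - e y = e y * (e (x - y) - 1)" by (simp add: e_diff field_simps)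
  then show ?thesis using norm_e_minus_1_le[of "x - y"] by (simp add: norm_mult)
qed

text \<open>
The bound is applied to \<open>y = (l + t) / q\<close> with \<open>\<bar>l\<bar> \<le> (q - 1) / 2\<close> and \<open>0 \<le> t \<le> 1\<close>, which may exceed
\<open>1 / 2\<close> but for \<open>q \<ge> 3\<close> is at most \<open>2 / 3\<close>.
\<close>

lemma norm_e_minus_1_ge:
  assumes "\<bar>y\<bar> \<le> 2 / 3"
  shows "\<bar>y\<bar> \<le> norm (e y - 1)"
proof -
  have pos: "y \<le> norm (e y - 1)" if y: "0 < y" "y \<le> 2 / 3" for y
  proof -
    \<comment> \<open>Halving the angle brings it into the range where the cosine is at least \<open>1 / 2\<close>.\<close>
    define u where "u = pi * y / 2"
    have u: "0 < u" "u \<le> pi / 3" using y by (simp_all add: u_def field_simps)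
    obtain z where z: "0 < z" "z < u" "sin u - sin 0 = (u - 0) * cos z"
      using MVT2[of 0 u sin cos] u by (auto intro: DERIV_sin)
    have half: "1 / 2 \<le> cos z" if "0 \<le> z" "z \<le> u" for z
      using cos_monotone_0_pi_le[of z "pi / 3"] that u by (simp add: cos_60)
    have "sin u = u * cos z" using z by simp
    moreover have "u * (1 / 2) \<le> u * cos z" using half[of z] z u by (intro mult_left_mono) auto
    ultimately have 1: "u / 2 \<le> sin u" by simp
    have "sin (pi * y) = 2 * sin u * cos u" using sin_double[of u] by (simp add: u_def)
    also have "\<dots> \<ge> 2 * sin u * (1 / 2)"
      using half[of u] u 1 by (intro mult_left_mono) auto
    finally have 2: "u / 2 \<le> sin (pi * y)" using 1 by simp
    have "norm (e y - 1) = 2 * \<bar>sin (pi * y)\<bar>"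
    proof -
      have "(norm (e y - 1))\<^sup>2 = (cos (2 * (pi * y)) - 1)\<^sup>2 + (sin (2 * (pi * y)))\<^sup>2"
        by (simp add: cmod_power2 e_eq_cis mult.assoc)
      also have "\<dots> = 2 - 2 * cos (2 * (pi * y))"
        using sin_cos_squared_add[of "2 * (pi * y)"] by (simp add: power2_eq_square algebra_simps)
      also have "\<dots> = (2 * \<bar>sin (pi * y)\<bar>)\<^sup>2"
        unfolding cos_double_sin by (simp add: power2_eq_square)
      finally show ?thesis by (rule power2_eq_imp_eq) simp_all
    qed
    also have "\<dots> \<ge> u" using 2 by simp
    finally have "u \<le> norm (e y - 1)" .
    moreover have "y \<le> u" using y pi_gt3 by (simp add: u_def field_simps)
    ultimately show ?thesis by simp
  qed
  consider "y = 0" | "y > 0" | "y < 0" by linarith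
  then show ?thesis
  proof cases
    case 3
    have "norm (e y - 1) = norm (e y * (1 - e (- y)))"
      by (simp add: right_diff_distrib e_add[symmetric])
    also have "\<dots> = norm (e (- y) - 1)" by (simp add: norm_mult norm_minus_commute)
    finally show ?thesis using pos[of "- y"] 3 assms by simp
  qed (use pos assms in auto)
qed

text \<open>
What the kernel \<open>1 / (2 \<pi> \<i> x)\<close> of the limit process and the kernel \<open>1 / (q (e(x / q) - 1))\<close> of
the finite process have in common: they decay like \<open>1 / x\<close> and vary by \<open>O(1 / x\<^sup>2)\<close> over a unit
interval.
\<close>

definition tame_kernel :: "(real \<Rightarrow> complex) \<Rightarrow> int set \<Rightarrow> bool"
  where "tame_kernel \<kappa> A \<longleftrightarrow> (\<forall>l\<in>A. norm (\<kappa> (of_int l)) \<le> 1 / \<bar>of_int l\<bar> \<and>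
    (\<forall>t\<in>{0..1}. norm (\<kappa> (of_int l + t) - \<kappa> (of_int l)) \<le> 4 * pi / (of_int l)\<^sup>2))"

lemma tame_kernelD:
  assumes "tame_kernel \<kappa> A" "l \<in> A"
  shows "norm (\<kappa> (of_int l)) \<le> 1 / \<bar>of_int l\<bar>"
    and "t \<in> {0..1} \<Longrightarrow> norm (\<kappa> (of_int l + t) - \<kappa> (of_int l)) \<le> 4 * pi / (of_int l)\<^sup>2"
  using assms by (auto simp: tame_kernel_def)

lemma sum_inverse_squares_le:
  assumes "finite A" "\<And>l. l \<in> A \<Longrightarrow> int L < \<bar>l\<bar>" "L \<ge> 1"
  shows "(\<Sum>l\<in>A. 1 / (real_of_int l)\<^sup>2) \<le> 2 / real L"
proof -
  have pos: "(\<Sum>l\<in>A. 1 / (real_of_int l)\<^sup>2) \<le> 1 / real L"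
    if A: "finite A" "\<And>l. l \<in> A \<Longrightarrow> int L < l" for A
  proof -
    have bound: "(\<Sum>i<n. 1 / (real (L + 1 + i))\<^sup>2) \<le> 1 / real L - 1 / real (L + n)" for n
    proof (induction n)
      case (Suc n)
      have "1 / (D + 1)\<^sup>2 \<le> 1 / D - 1 / (D + 1)" if "D > 0" for D :: real
      proof -
        have "1 / (D + 1)\<^sup>2 \<le> 1 / (D * (D + 1))"
          unfolding power2_eq_square using that by (intro frac_le mult_right_mono) auto
        also have "\<dots> = 1 / D - 1 / (D + 1)" using that by (simp add: field_simps)
        finally show ?thesis .
      qed
      from this[of "real (L + n)"]
      have "1 / (real (L + 1 + n))\<^sup>2 \<le> 1 / real (L + n) - 1 / real (L + Suc n)"
        using assms(3) by (simp add: add_ac)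
      then show ?case using Suc by simp
    qed simp
    obtain n where n: "\<And>l. l \<in> A \<Longrightarrow> l < int n"
    proof
      fix l assume "l \<in> A"
      then have "l \<le> Max (insert 0 A)" using A(1) by (intro Max_ge) auto
      then show "l < int (nat (Max (insert 0 A)) + 1)" by simp
    qed
    have "(\<Sum>l\<in>A. 1 / (real_of_int l)\<^sup>2) \<le> (\<Sum>l\<in>(\<lambda>i. int (L + 1 + i)) ` {..<n}. 1 / (real_of_int l)\<^sup>2)"
    proof (rule sum_mono2)
      show "A \<subseteq> (\<lambda>i. int (L + 1 + i)) ` {..<n}"
      proof
        fix l assume "l \<in> A"
        with A(2) n have "int L < l" "l < int n" by auto
        then show "l \<in> (\<lambda>i. int (L + 1 + i)) ` {..<n}"
          by (intro image_eqI[of _ _ "nat (l - int L - 1)"]) auto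
      qed
    qed auto
    also have "\<dots> = (\<Sum>i<n. 1 / (real (L + 1 + i))\<^sup>2)"
      by (subst sum.reindex) (auto simp: inj_on_def)
    also have "\<dots> \<le> 1 / real L"
      using bound[of n] by (smt (verit) of_nat_0_le_iff divide_nonneg_nonneg)
    finally show ?thesis .
  qed
  define P where "P = {l\<in>A. l > 0}"
  define N where "N = {l\<in>A. l < 0}"
  have A: "A = P \<union> N" using assms(2) by (force simp: P_def N_def)
  have fin: "finite P" "finite N" using assms(1) by (auto simp: P_def N_def)
  have "(\<Sum>l\<in>A. 1 / (real_of_int l)\<^sup>2) = (\<Sum>l\<in>P. 1 / (real_of_int l)\<^sup>2) + (\<Sum>l\<in>N. 1 / (real_of_int l)\<^sup>2)"
    unfolding A by (rule sum.union_disjoint[OF fin]) (auto simp: P_def N_def)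
  also have "(\<Sum>l\<in>N. 1 / (real_of_int l)\<^sup>2) = (\<Sum>l\<in>uminus ` N. 1 / (real_of_int l)\<^sup>2)"
    by (subst sum.reindex) auto
  also have "(\<Sum>l\<in>P. 1 / (real_of_int l)\<^sup>2) \<le> 1 / real L"
    by (rule pos[OF fin(1)]) (use assms(2) in \<open>force simp: P_def\<close>)
  also have "(\<Sum>l\<in>uminus ` N. 1 / (real_of_int l)\<^sup>2) \<le> 1 / real L"
    by (rule pos) (use assms(2) fin in \<open>force simp: N_def\<close>)+
  finally show ?thesis by simp
qed

lemma sum_tame_kernel_le:
  assumes "tame_kernel \<kappa> A" "finite A" "\<And>l. l \<in> A \<Longrightarrow> int L < \<bar>l\<bar>" "L \<ge> 1"
  shows "(\<Sum>l\<in>A. (norm (e (w * of_int l) * \<kappa> (of_int l)))\<^sup>2) \<le> 2 / real L"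
proof -
  have "(\<Sum>l\<in>A. (norm (e (w * of_int l) * \<kappa> (of_int l)))\<^sup>2) \<le> (\<Sum>l\<in>A. 1 / (real_of_int l)\<^sup>2)"
  proof (rule sum_mono)
    fix l assume "l \<in> A"
    then have "(norm (\<kappa> (of_int l)))\<^sup>2 \<le> (1 / \<bar>of_int l\<bar>)\<^sup>2"
      using tame_kernelD(1)[OF assms(1)] by (intro power_mono) auto
    then show "(norm (e (w * of_int l) * \<kappa> (of_int l)))\<^sup>2 \<le> 1 / (real_of_int l)\<^sup>2"
      by (simp add: norm_mult power_divide)
  qed
  also have "\<dots> \<le> 2 / real L" by (rule sum_inverse_squares_le[OF assms(2-4)])
  finally show ?thesis .
qed

text \<open>
Replacing \<open>\<kappa>(l + t)\<close> by \<open>\<kappa>(l)\<close> makes an absolutely summable error. After that the variable \<open>t\<close>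
enters only through the two factors \<open>e(v t)\<close> and \<open>e(u t)\<close>, which do not depend on \<open>l\<close>.
\<close>

lemma tame_tail_residual:
  fixes x :: "int \<Rightarrow> real" and c \<kappa> :: "real \<Rightarrow> complex"
  assumes tame: "tame_kernel \<kappa> A" "finite A" "\<And>l. l \<in> A \<Longrightarrow> int L < \<bar>l\<bar>" "L \<ge> 1"
    and x: "\<And>l. l \<in> A \<Longrightarrow> \<bar>x l\<bar> \<le> 1"
    and c: "\<And>l. l \<in> A \<Longrightarrow> c (of_int l + t) =
      (e (v * (of_int l + t)) - e (u * (of_int l + t))) * \<kappa> (of_int l + t)"
    and t: "t \<in> {0..1}"
  shows "norm ((\<Sum>l\<in>A. of_real (x l) * c (of_int l + t)) -
      (e (v * t) * (\<Sum>l\<in>A. of_real (x l) * (e (v * of_int l) * \<kappa> (of_int l))) -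
       e (u * t) * (\<Sum>l\<in>A. of_real (x l) * (e (u * of_int l) * \<kappa> (of_int l))))) \<le> 16 * pi / real L"
    (is "norm (?S - ?R) \<le> _")
proof -
  have "?S - ?R = (\<Sum>l\<in>A. of_real (x l) *
      ((e (v * (of_int l + t)) - e (u * (of_int l + t))) * (\<kappa> (of_int l + t) - \<kappa> (of_int l))))"
    unfolding sum_distrib_left sum_subtractf[symmetric]
  proof (rule sum.cong[OF refl])
    fix l assume l: "l \<in> A"
    have ex: "e (w * (of_int l + t)) = e (w * t) * e (w * of_int l)" for w
      by (simp add: e_add[symmetric] algebra_simps)
    show "of_real (x l) * c (of_int l + t) -
        (e (v * t) * (of_real (x l) * (e (v * of_int l) * \<kappa> (of_int l))) -
         e (u * t) * (of_real (x l) * (e (u * of_int l) * \<kappa> (of_int l)))) =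
        of_real (x l) * ((e (v * (of_int l + t)) - e (u * (of_int l + t))) *
          (\<kappa> (of_int l + t) - \<kappa> (of_int l)))"
      unfolding c[OF l] ex by (simp add: algebra_simps)
  qed
  also have "norm \<dots> \<le> (\<Sum>l\<in>A. 8 * pi * (1 / (of_int l)\<^sup>2))"
  proof (rule sum_norm_le)
    fix l assume l: "l \<in> A"
    have "norm (of_real (x l) * ((e (v * (of_int l + t)) - e (u * (of_int l + t))) *
        (\<kappa> (of_int l + t) - \<kappa> (of_int l)))) =
        \<bar>x l\<bar> * (norm (e (v * (of_int l + t)) - e (u * (of_int l + t))) *
        norm (\<kappa> (of_int l + t) - \<kappa> (of_int l)))"
      by (simp add: norm_mult)
    also have "\<dots> \<le> 1 * (2 * (4 * pi / (of_int l)\<^sup>2))"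
    proof (intro mult_mono x[OF l] tame_kernelD(2)[OF tame(1) l t])
      show "norm (e (v * (of_int l + t)) - e (u * (of_int l + t))) \<le> 2"
        by (rule order_trans[OF norm_triangle_ineq4]) simp
    qed auto
    finally show "norm (of_real (x l) * ((e (v * (of_int l + t)) - e (u * (of_int l + t))) *
        (\<kappa> (of_int l + t) - \<kappa> (of_int l)))) \<le> 8 * pi * (1 / (of_int l)\<^sup>2)" by simp
  qed
  also have "\<dots> = 8 * pi * (\<Sum>l\<in>A. 1 / (of_int l)\<^sup>2)" by (simp add: sum_distrib_left)
  also have "\<dots> \<le> 8 * pi * (2 / real L)"
    by (intro mult_left_mono sum_inverse_squares_le tame) auto
  finally show ?thesis by simp
qed

text \<open>
The bound does not depend on \<open>t\<close>, so it controls the supremum norm of the tail.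
\<close>

lemma tame_tail_bound:
  fixes x :: "int \<Rightarrow> real" and c \<kappa> :: "real \<Rightarrow> complex"
  assumes tame: "tame_kernel \<kappa> A" "finite A" "\<And>l. l \<in> A \<Longrightarrow> int L < \<bar>l\<bar>" "L \<ge> 1"
    and x: "\<And>l. l \<in> A \<Longrightarrow> \<bar>x l\<bar> \<le> 1"
    and c: "\<And>l. l \<in> A \<Longrightarrow> c (of_int l + t) =
      (e (v * (of_int l + t)) - e (u * (of_int l + t))) * \<kappa> (of_int l + t)"
    and t: "t \<in> {0..1}"
  shows "norm (\<Sum>l\<in>A. of_real (x l) * c (of_int l + t)) \<le>
      norm (\<Sum>l\<in>A. of_real (x l) * (e (v * of_int l) * \<kappa> (of_int l))) +
      norm (\<Sum>l\<in>A. of_real (x l) * (e (u * of_int l) * \<kappa> (of_int l))) + 16 * pi / real L"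
proof -
  have "norm (S::complex) \<le> norm V + norm U + r"
    if "norm (S - (e (v * t) * V - e (u * t) * U)) \<le> r" for S V U r
  proof -
    have "norm S \<le> norm (S - (e (v * t) * V - e (u * t) * U)) + norm (e (v * t) * V - e (u * t) * U)"
      using norm_triangle_ineq[of "S - (e (v * t) * V - e (u * t) * U)" "e (v * t) * V - e (u * t) * U"] by simp
    also have "norm (e (v * t) * V - e (u * t) * U) \<le> norm V + norm U"
      by (rule order_trans[OF norm_triangle_ineq4]) (simp add: norm_mult)
    finally show ?thesis using that by simp
  qed
  from this[OF tame_tail_residual[OF tame x c t]] show ?thesis by simp
qed

section \<open>Coefficients of the two processes\<close>

text \<open>
The integral of \<open>e(u x)\<close> over \<open>\<alpha> \<le> u \<le> \<alpha> + \<beta>\<close>.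
\<close>

definition limit_coeff :: "real \<Rightarrow> real \<Rightarrow> real \<Rightarrow> complex"
  where "limit_coeff \<alpha> \<beta> x = e (\<alpha> * x) * kernel \<beta> x / (2 * of_real pi * \<i>)"

lemma G_partial_eq:
  "G_partial \<alpha> \<beta> y N t = (\<Sum>l\<in>{- int N..int N}. of_real (y l) * limit_coeff \<alpha> \<beta> (of_int l + t))"
  unfolding G_partial_def sum_distrib_left
  by (intro sum.cong refl) (simp add: limit_coeff_def e_add distrib_left mult_ac)

lemma kernel_add: "kernel (a + b) x = kernel a x + e (a * x) * kernel b x"
  by (simp add: kernel_def e_add add_divide_distrib[symmetric] algebra_simps)

lemma norm_kernel_minus_linear_le: "norm (kernel h x - 2 * of_real pi * \<i> * of_real h) \<le> 2 * pi\<^sup>2 * h\<^sup>2 * \<bar>x\<bar>"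
proof (cases "x = 0")
  case False
  have "kernel h x - 2 * of_real pi * \<i> * of_real h =
      (e (h * x) - 1 - 2 * of_real pi * \<i> * of_real (h * x)) / of_real x"
    using False by (simp add: kernel_def field_simps)
  also have "norm \<dots> \<le> 2 * pi\<^sup>2 * (h * x)\<^sup>2 / \<bar>x\<bar>"
    using norm_e_minus_linear_le[of "h * x"] by (simp add: norm_divide divide_right_mono)
  also have "\<dots> = 2 * pi\<^sup>2 * h\<^sup>2 * \<bar>x\<bar>"
    using False by (simp add: power_mult_distrib power2_eq_square[of x] divide_simps abs_mult_self_eq abs_if)
  finally show ?thesis .
qed (simp add: kernel_def)

lemma norm_kernel_le: "norm (kernel h x) \<le> 2 * pi * \<bar>h\<bar>"
proof (cases "x = 0")
  case False
  have "norm (kernel h x) = norm (e (h * x) - 1) / \<bar>x\<bar>" using False by (simp add: kernel_def norm_divide)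
  also have "\<dots> \<le> 2 * pi * \<bar>h * x\<bar> / \<bar>x\<bar>" by (intro divide_right_mono norm_e_minus_1_le) auto
  finally show ?thesis using False by (simp add: abs_mult)
qed (simp add: kernel_def norm_mult)

lemma continuous_on_kernel: "continuous_on UNIV (kernel \<beta>)"
proof -
  have "isCont (kernel \<beta>) x" for x
  proof (cases "x = 0")
    case True
    have "((\<lambda>x. kernel \<beta> x - kernel \<beta> 0) \<longlongrightarrow> 0) (at 0)"
    proof (rule Lim_null_comparison)
      show "\<forall>\<^sub>F x in at 0. norm (kernel \<beta> x - kernel \<beta> 0) \<le> 2 * pi\<^sup>2 * \<beta>\<^sup>2 * \<bar>x\<bar>"
        using norm_kernel_minus_linear_le[of \<beta>] by (intro always_eventually) (simp add: kernel_def[of _ 0])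
      have "((\<lambda>x. 2 * pi\<^sup>2 * \<beta>\<^sup>2 * \<bar>x\<bar>) \<longlongrightarrow> 2 * pi\<^sup>2 * \<beta>\<^sup>2 * \<bar>0\<bar>) (at (0::real))"
        by (intro tendsto_intros)
      then show "((\<lambda>x. 2 * pi\<^sup>2 * \<beta>\<^sup>2 * \<bar>x\<bar>) \<longlongrightarrow> 0) (at (0::real))" by simp
    qed
    then show ?thesis unfolding isCont_def True by (rule Lim_null[THEN iffD2])
  next
    case False
    have "continuous_on (- {0}) (\<lambda>x. (e (\<beta> * x) - 1) / of_real x)"
      unfolding e_def by (intro continuous_intros) auto
    then have "continuous_on (- {0}) (kernel \<beta>)"
      by (rule continuous_on_eq) (simp add: kernel_def)
    then show ?thesis
      using False continuous_on_eq_continuous_at[of "- {0::real}" "kernel \<beta>"] by (simp add: open_Compl)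
  qed
  then show ?thesis by (simp add: continuous_at_imp_continuous_on)
qed

lemma continuous_on_e [continuous_intros]: "continuous_on S f \<Longrightarrow> continuous_on S (\<lambda>x. e (f x))"
  unfolding e_def by (intro continuous_intros)

lemma continuous_on_limit_coeff: "continuous_on UNIV (limit_coeff \<alpha> \<beta>)"
  unfolding limit_coeff_def by (intro continuous_intros continuous_on_kernel) simp

lemma limit_coeff_eq:
  "x \<noteq> 0 \<Longrightarrow> limit_coeff \<alpha> \<beta> x = (e ((\<alpha> + \<beta>) * x) - e (\<alpha> * x)) * (1 / (2 * of_real pi * \<i> * of_real x))"
  by (simp add: limit_coeff_def kernel_def distrib_right e_add field_simps)

lemma tame_limit_kernel:
  "tame_kernel (\<lambda>x. 1 / (2 * of_real pi * \<i> * of_real x)) {l. 1 < \<bar>l\<bar>}"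
  unfolding tame_kernel_def
proof (intro ballI conjI)
  fix l :: int assume l: "l \<in> {l. 1 < \<bar>l\<bar>}"
  then have l0: "real_of_int l \<noteq> 0" by auto
  have "1 / (2 * pi * \<bar>real_of_int l\<bar>) \<le> 1 / \<bar>real_of_int l\<bar>"
    using l0 pi_gt3 by (intro divide_left_mono) (auto simp: mult_le_cancel_right1)
  then show "norm (1 / (2 * of_real pi * \<i> * of_real (of_int l)) :: complex) \<le> 1 / \<bar>real_of_int l\<bar>"
    by (simp add: norm_divide norm_mult)
  fix t :: real assume t: "t \<in> {0..1}"
  have "2 \<le> \<bar>l\<bar>" using l by simp
  then have "2 \<le> \<bar>real_of_int l\<bar>" by linarith
  then have lt: "\<bar>real_of_int l\<bar> / 2 \<le> \<bar>of_int l + t\<bar>" using t by (auto simp: abs_if)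
  then have lt0: "of_int l + t \<noteq> 0" using l0 by auto
  have "1 / (2 * of_real pi * \<i> * of_real (of_int l + t)) - 1 / (2 * of_real pi * \<i> * of_real (of_int l)) =
      - of_real t / (2 * of_real pi * \<i> * (of_real (of_int l + t) * of_real (of_int l)))"
    using l0 lt0 by (simp add: divide_simps del: of_real_add) (simp add: algebra_simps)
  then have "norm (1 / (2 * of_real pi * \<i> * of_real (of_int l + t)) - 1 / (2 * of_real pi * \<i> * of_real (of_int l)) :: complex) =
      \<bar>t\<bar> / (2 * pi * (\<bar>of_int l + t\<bar> * \<bar>of_int l\<bar>))"
    by (simp add: norm_divide norm_mult del: of_real_add)
  also have "\<dots> \<le> 4 * pi / (2 * pi * (\<bar>of_int l\<bar> / 2 * \<bar>of_int l\<bar>)) "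
    using l0 t lt pi_gt3 lt0 by (intro frac_le mult_left_mono mult_right_mono mult_pos_pos) auto
  also have "\<dots> = 4 / (real_of_int l)\<^sup>2"
    using l0 by (simp add: power2_eq_square divide_simps abs_mult_self_eq)
  also have "\<dots> \<le> 4 * pi / (real_of_int l)\<^sup>2"
    using pi_gt3 by (intro divide_right_mono) auto
  finally show "norm (1 / (2 * of_real pi * \<i> * of_real (of_int l + t)) -
      1 / (2 * of_real pi * \<i> * of_real (of_int l)) :: complex) \<le> 4 * pi / (real_of_int l)\<^sup>2" .
qed

context odd_prime
begin

text \<open>
The first point of the grid \<open>\<int> / q\<close> that is greater than \<open>\<alpha>\<close>.
\<close>

definition grid_point :: "real \<Rightarrow> real" where "grid_point \<alpha> = (of_int \<lfloor>\<alpha> * real q\<rfloor> + 1) / real q"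

definition geom_kernel :: "real \<Rightarrow> complex" where "geom_kernel x = 1 / (of_nat q * (e (x / real q) - 1))"

lemma finite_coeff_sum:
  assumes "\<beta> > 0"
  shows "finite_coeff \<alpha> \<beta> x = (\<Sum>i<nat (\<lfloor>(\<alpha> + \<beta>) * real q\<rfloor> - \<lfloor>\<alpha> * real q\<rfloor>).
    e (grid_point \<alpha> * x) * e (x / real q) ^ i) / of_nat q"
proof -
  define a where "a = \<lfloor>\<alpha> * real q\<rfloor>"
  define b where "b = \<lfloor>(\<alpha> + \<beta>) * real q\<rfloor>"
  have set: "{n :: int. \<alpha> * real q < of_int n \<and> of_int n \<le> (\<alpha> + \<beta>) * real q} = {a<..b}"
    by (auto simp: a_def b_def floor_less_iff le_floor_iff)
  have "(\<Sum>n\<in>{a<..b}. e (of_int n * x / real q)) = (\<Sum>i<nat (b - a). e (of_int (a + 1 + int i) * x / real q))"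
    by (rule sum.reindex_bij_witness[of _ "\<lambda>i. a + 1 + int i" "\<lambda>n. nat (n - a - 1)"]) auto
  also have "\<dots> = (\<Sum>i<nat (b - a). e (grid_point \<alpha> * x) * e (x / real q) ^ i)"
  proof (rule sum.cong[OF refl])
    fix i
    have "of_int (a + 1 + int i) * x / real q = grid_point \<alpha> * x + real i * (x / real q)"
      by (simp add: grid_point_def a_def add_divide_distrib[symmetric] algebra_simps)
    then show "e (of_int (a + 1 + int i) * x / real q) = e (grid_point \<alpha> * x) * e (x / real q) ^ i"
      by (simp add: e_add e_power)
  qed
  finally show ?thesis unfolding finite_coeff_def set by (simp add: a_def b_def)
qed

lemma finite_coeff_eq_geom_kernel:
  assumes "\<beta> > 0" "e (x / real q) \<noteq> 1"
  shows "finite_coeff \<alpha> \<beta> x = (e (grid_point (\<alpha> + \<beta>) * x) - e (grid_point \<alpha> * x)) * geom_kernel x"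
proof -
  define n where "n = nat (\<lfloor>(\<alpha> + \<beta>) * real q\<rfloor> - \<lfloor>\<alpha> * real q\<rfloor>)"
  have "\<lfloor>\<alpha> * real q\<rfloor> \<le> \<lfloor>(\<alpha> + \<beta>) * real q\<rfloor>"
    using assms(1) by (intro floor_mono mult_right_mono) auto
  then have n: "real n = of_int \<lfloor>(\<alpha> + \<beta>) * real q\<rfloor> - of_int \<lfloor>\<alpha> * real q\<rfloor>"
    by (simp add: n_def)
  have "finite_coeff \<alpha> \<beta> x = e (grid_point \<alpha> * x) * (\<Sum>i<n. e (x / real q) ^ i) / of_nat q"
    unfolding finite_coeff_sum[OF assms(1)] n_def by (simp add: sum_distrib_left)
  also have "(\<Sum>i<n. e (x / real q) ^ i) = (e (x / real q) ^ n - 1) / (e (x / real q) - 1)"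
    using assms(2) by (rule geometric_sum)
  also have "e (grid_point \<alpha> * x) * \<dots> / of_nat q =
      (e (grid_point \<alpha> * x) * e (x / real q) ^ n - e (grid_point \<alpha> * x)) * geom_kernel x"
    by (simp add: geom_kernel_def divide_simps) (simp add: algebra_simps)
  also have "e (grid_point \<alpha> * x) * e (x / real q) ^ n = e (grid_point (\<alpha> + \<beta>) * x)"
    unfolding e_power e_add[symmetric]
    by (rule arg_cong[of _ _ e]) (simp add: n grid_point_def add_divide_distrib[symmetric] algebra_simps)
  finally show ?thesis .
qed

lemma norm_e_div_q_ge:
  assumes "\<bar>x\<bar> \<le> of_int half + 1"
  shows "\<bar>x\<bar> / real q \<le> norm (e (x / real q) - 1)"
proof -
  have "real q = 2 * of_int half + 1"
    using arg_cong[OF q_eq_half, of real_of_int] by simp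
  then have "\<bar>x\<bar> \<le> 2 / 3 * real q" using assms gt2 by linarith
  then have "\<bar>x / real q\<bar> \<le> 2 / 3" using q_pos by (simp add: abs_divide field_simps)
  from norm_e_minus_1_ge[OF this] show ?thesis by (simp add: abs_divide)
qed

lemma norm_geom_kernel_le:
  assumes "\<bar>x\<bar> \<le> of_int half + 1" "x \<noteq> 0"
  shows "norm (geom_kernel x) \<le> 1 / \<bar>x\<bar>"
proof -
  have "real q * (\<bar>x\<bar> / real q) \<le> real q * norm (e (x / real q) - 1)"
    by (intro mult_left_mono norm_e_div_q_ge assms) auto
  then have "\<bar>x\<bar> \<le> real q * norm (e (x / real q) - 1)" using q_pos by simp
  then show ?thesis
    using assms(2) by (simp add: geom_kernel_def norm_divide norm_mult divide_left_mono)
qed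

lemma tame_geom_kernel: "tame_kernel geom_kernel {l. 1 < \<bar>l\<bar> \<and> \<bar>l\<bar> \<le> half}"
  unfolding tame_kernel_def
proof (intro ballI conjI)
  fix l assume l: "l \<in> {l. 1 < \<bar>l\<bar> \<and> \<bar>l\<bar> \<le> half}"
  then have l0: "real_of_int l \<noteq> 0" by auto
  have "\<bar>l\<bar> \<le> half" using l by simp
  then have lh: "\<bar>real_of_int l\<bar> \<le> of_int half" by linarith
  show 1: "norm (geom_kernel (of_int l)) \<le> 1 / \<bar>of_int l\<bar>"
    by (rule norm_geom_kernel_le) (use l0 lh in auto)
  fix t :: real assume t: "t \<in> {0..1}"
  have "2 \<le> \<bar>l\<bar>" using l by simp
  then have "2 \<le> \<bar>real_of_int l\<bar>" by linarith
  then have lt: "\<bar>real_of_int l\<bar> / 2 \<le> \<bar>of_int l + t\<bar>" using t by (auto simp: abs_if)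
  then have lt0: "of_int l + t \<noteq> 0" using l0 by auto
  have 2: "norm (geom_kernel (of_int l + t)) \<le> 1 / \<bar>of_int l + t\<bar>"
    by (rule norm_geom_kernel_le) (use lt0 lh t in auto)
  have nz: "e (x / real q) - 1 \<noteq> 0" if "\<bar>x\<bar> \<le> of_int half + 1" "x \<noteq> 0" for x
  proof -
    have "0 < \<bar>x\<bar> / real q" using that(2) q_pos by simp
    then show ?thesis using norm_e_div_q_ge[OF that(1)] by auto
  qed
  have nzl: "e (of_int l / real q) - 1 \<noteq> 0" "e ((of_int l + t) / real q) - 1 \<noteq> 0"
    by (rule nz; use l0 lh lt0 t in auto)+
  have "1 / (Q * B) - 1 / (Q * A) = Q * ((A - B) * ((1 / (Q * B)) * (1 / (Q * A))))"
    if "A \<noteq> 0" "B \<noteq> 0" "Q \<noteq> 0" for A B Q :: complex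
    using that by (simp add: field_simps)
  from this[OF nzl, of "of_nat q"]
  have "geom_kernel (of_int l + t) - geom_kernel (of_int l) =
      of_nat q * ((e (of_int l / real q) - e ((of_int l + t) / real q)) *
        (geom_kernel (of_int l + t) * geom_kernel (of_int l)))"
    using q_pos by (simp add: geom_kernel_def)
  also have "norm \<dots> = real q * (norm (e (of_int l / real q) - e ((of_int l + t) / real q)) *
        (norm (geom_kernel (of_int l + t)) * norm (geom_kernel (of_int l))))"
    by (simp add: norm_mult)
  also have "\<dots> \<le> real q * ((2 * pi / real q) * ((1 / (\<bar>of_int l\<bar> / 2)) * (1 / \<bar>of_int l\<bar>)))"
  proof (intro mult_left_mono mult_mono)
    have "norm (e (of_int l / real q) - e ((of_int l + t) / real q)) \<le>
        2 * pi * \<bar>of_int l / real q - (of_int l + t) / real q\<bar>" by (rule norm_e_diff_le)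
    also have "\<bar>of_int l / real q - (of_int l + t) / real q\<bar> = t / real q"
      using t by (simp add: diff_divide_distrib[symmetric] abs_divide)
    also have "2 * pi * (t / real q) \<le> 2 * pi / real q"
      using t q_pos by (simp add: divide_right_mono)
    finally show "norm (e (of_int l / real q) - e ((of_int l + t) / real q)) \<le> 2 * pi / real q" .
    have "1 / \<bar>of_int l + t\<bar> \<le> 1 / (\<bar>real_of_int l\<bar> / 2)"
      using lt l0 lt0 by (intro divide_left_mono mult_pos_pos) auto
    with 2 show "norm (geom_kernel (of_int l + t)) \<le> 1 / (\<bar>of_int l\<bar> / 2)" by linarith
  qed (use 1 in auto)
  also have "\<dots> = 4 * pi / (of_int l)\<^sup>2"
    using q_pos l0 by (simp add: power2_eq_square divide_simps abs_mult_self_eq)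
  finally show "norm (geom_kernel (of_int l + t) - geom_kernel (of_int l)) \<le> 4 * pi / (of_int l)\<^sup>2" .
qed

text \<open>
Let \<open>F u\<close> be the integral of \<open>e(s x)\<close> over \<open>0 \<le> s \<le> u\<close>. On a grid interval of length \<open>1 / q\<close> the
increment of \<open>F\<close> differs from the summand \<open>e(u x) / q\<close> by \<open>O(\<bar>x\<bar> / q\<^sup>2)\<close>, and moving the two ends of
the range to grid points costs at most \<open>1 / q\<close> each. Expressing \<open>F\<close> by \<open>kernel\<close> covers \<open>x = 0\<close> as well.
\<close>

lemma finite_coeff_approx:
  assumes "\<beta> > 0"
  shows "norm (finite_coeff \<alpha> \<beta> x - limit_coeff \<alpha> \<beta> x) \<le> (2 + pi * \<bar>x\<bar> * (\<beta> + 1)) / real q"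
proof -
  define F where "F u = kernel u x / (2 * of_real pi * \<i>)" for u
  define n where "n = nat (\<lfloor>(\<alpha> + \<beta>) * real q\<rfloor> - \<lfloor>\<alpha> * real q\<rfloor>)"
  define u where "u i = grid_point \<alpha> + real i / real q" for i :: nat
  have "\<lfloor>\<alpha> * real q\<rfloor> \<le> \<lfloor>(\<alpha> + \<beta>) * real q\<rfloor>"
    using assms(1) by (intro floor_mono mult_right_mono) auto
  then have n: "real n = of_int \<lfloor>(\<alpha> + \<beta>) * real q\<rfloor> - of_int \<lfloor>\<alpha> * real q\<rfloor>"
    by (simp add: n_def)
  have nle: "real n \<le> \<beta> * real q + 1"
    unfolding n by (simp add: distrib_right) linarith
  have F_add: "F (a + b) = F a + e (a * x) * F b" for a b
    by (simp add: F_def kernel_add add_divide_distrib)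
  have F_le: "norm (F h) \<le> \<bar>h\<bar>" for h
    using norm_kernel_le[of h x] by (simp add: F_def norm_divide norm_mult field_simps)
  have F_lin: "norm (F h - of_real h) \<le> pi * h\<^sup>2 * \<bar>x\<bar>" for h
  proof -
    have "F h - of_real h = (kernel h x - 2 * of_real pi * \<i> * of_real h) / (2 * of_real pi * \<i>)"
      by (simp add: F_def field_simps)
    then have "norm (F h - of_real h) = norm (kernel h x - 2 * of_real pi * \<i> * of_real h) / (2 * pi)"
      by (simp add: norm_divide norm_mult)
    also have "\<dots> \<le> (2 * pi\<^sup>2 * h\<^sup>2 * \<bar>x\<bar>) / (2 * pi)"
      by (intro divide_right_mono norm_kernel_minus_linear_le) simp
    also have "\<dots> = pi * h\<^sup>2 * \<bar>x\<bar>" by (simp add: power2_eq_square)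
    finally show ?thesis .
  qed
  have limit: "limit_coeff \<alpha> \<beta> x = F (\<alpha> + \<beta>) - F \<alpha>"
    unfolding F_add by (simp add: limit_coeff_def F_def)
  have uS: "u (Suc i) = u i + 1 / real q" for i by (simp add: u_def add_divide_distrib)
  have ex: "e (grid_point \<alpha> * x) * e (x / real q) ^ i = e (u i * x)" for i
    by (simp add: u_def e_power e_add[symmetric] algebra_simps)
  have "finite_coeff \<alpha> \<beta> x = (\<Sum>i<n. e (u i * x) * of_real (1 / real q))"
    unfolding finite_coeff_sum[OF assms] n_def ex by (simp add: sum_divide_distrib)
  moreover have "F (u n) - F (u 0) = (\<Sum>i<n. e (u i * x) * F (1 / real q))"
    unfolding sum_lessThan_telescope[of "\<lambda>i. F (u i)", symmetric] uS F_add by simp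
  ultimately have "finite_coeff \<alpha> \<beta> x - (F (u n) - F (u 0)) =
      (\<Sum>i<n. e (u i * x) * (of_real (1 / real q) - F (1 / real q)))"
    by (simp add: sum_subtractf right_diff_distrib)
  also have "norm \<dots> \<le> (\<Sum>i<n. pi * (1 / real q)\<^sup>2 * \<bar>x\<bar>)"
    by (rule sum_norm_le) (use F_lin[of "1 / real q"] in \<open>simp add: norm_mult norm_minus_commute\<close>)
  also have "\<dots> = real n * (pi * \<bar>x\<bar> / (real q)\<^sup>2)" by (simp add: power_divide)
  also have "\<dots> \<le> (\<beta> * real q + 1) * (pi * \<bar>x\<bar> / (real q)\<^sup>2)"
    by (intro mult_right_mono nle) simp
  also have "\<dots> \<le> ((\<beta> + 1) * real q) * (pi * \<bar>x\<bar> / (real q)\<^sup>2)"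
    using q_pos by (intro mult_right_mono) (auto simp: distrib_right)
  also have "\<dots> = pi * \<bar>x\<bar> * (\<beta> + 1) / real q"
    using q_pos by (simp add: power2_eq_square)
  finally have 1: "norm (finite_coeff \<alpha> \<beta> x - (F (u n) - F (u 0))) \<le> pi * \<bar>x\<bar> * (\<beta> + 1) / real q" .
  have end_pt: "norm (F (grid_point a) - F a) \<le> 1 / real q" for a
  proof -
    have "F (grid_point a) - F a = e (a * x) * F (grid_point a - a)"
      using F_add[of a "grid_point a - a"] by simp
    then have "norm (F (grid_point a) - F a) \<le> \<bar>grid_point a - a\<bar>"
      using F_le[of "grid_point a - a"] by (simp add: norm_mult)
    also have "grid_point a - a = (of_int \<lfloor>a * real q\<rfloor> + 1 - a * real q) / real q"
      using q_pos by (simp add: grid_point_def field_simps)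
    also have "\<bar>\<dots>\<bar> \<le> 1 / real q"
    proof -
      have "\<bar>of_int \<lfloor>a * real q\<rfloor> + 1 - a * real q\<bar> \<le> 1" by linarith
      then show ?thesis using q_pos by (simp add: abs_divide divide_right_mono)
    qed
    finally show ?thesis .
  qed
  have "u n = grid_point (\<alpha> + \<beta>)" "u 0 = grid_point \<alpha>"
    by (simp_all add: u_def n grid_point_def add_divide_distrib[symmetric])
  with end_pt[of "\<alpha> + \<beta>"] end_pt[of \<alpha>]
  have 2: "norm ((F (u n) - F (u 0)) - limit_coeff \<alpha> \<beta> x) \<le> 2 / real q"
    unfolding limit
    using norm_triangle_ineq4[of "F (grid_point (\<alpha> + \<beta>)) - F (\<alpha> + \<beta>)" "F (grid_point \<alpha>) - F \<alpha>"]
    by (simp add: algebra_simps)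
  have "norm (finite_coeff \<alpha> \<beta> x - limit_coeff \<alpha> \<beta> x) \<le>
      norm (finite_coeff \<alpha> \<beta> x - (F (u n) - F (u 0))) + norm ((F (u n) - F (u 0)) - limit_coeff \<alpha> \<beta> x)"
    by (rule order_trans[OF _ norm_triangle_ineq]) simp
  also have "\<dots> \<le> pi * \<bar>x\<bar> * (\<beta> + 1) / real q + 2 / real q" using 1 2 by simp
  finally show ?thesis by (simp add: add_divide_distrib)
qed

end

section \<open>Convergence of the random series\<close>

lemma sum_symmetric_diff:
  fixes f :: "int \<Rightarrow> 'b::ab_group_add"
  assumes "M \<le> N"
  shows "(\<Sum>l\<in>{- int N..int N}. f l) - (\<Sum>l\<in>{- int M..int M}. f l) =
    (\<Sum>l\<in>{- int N..int N} - {- int M..int M}. f l)"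
  by (subst sum_diff) (use assms in auto)

text \<open>
Between \<open>j ^ 4\<close> and \<open>(j + 1) ^ 4\<close> there are \<open>O(j\<^sup>3)\<close> terms, each at most \<open>1 / j ^ 4\<close>, so the partial
sums vary by \<open>O(1 / j)\<close> there.
\<close>

lemma convergent_of_fourth_powers:
  fixes x :: "int \<Rightarrow> real" and w :: "int \<Rightarrow> complex"
  assumes x: "\<And>l. \<bar>x l\<bar> \<le> 1" and w: "\<And>l. 1 < \<bar>l\<bar> \<Longrightarrow> norm (w l) \<le> 1 / \<bar>of_int l\<bar>"
    and conv: "convergent (\<lambda>j. \<Sum>l\<in>{- int (j ^ 4)..int (j ^ 4)}. of_real (x l) * w l)"
  shows "convergent (\<lambda>N. \<Sum>l\<in>{- int N..int N}. of_real (x l) * w l)"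
proof -
  define S where "S N = (\<Sum>l\<in>{- int N..int N}. of_real (x l) * w l)" for N
  obtain s where s: "(\<lambda>j. S (j ^ 4)) \<longlonglongrightarrow> s" using conv unfolding S_def convergent_def by blast
  have gap: "norm (S N - S (j ^ 4)) \<le> 30 / real j" if j: "j \<ge> 1" "j ^ 4 \<le> N" "N < (j + 1) ^ 4" for j N
  proof -
    let ?A = "{- int N..int N} - {- int (j ^ 4)..int (j ^ 4)}"
    have "norm (S N - S (j ^ 4)) = norm (\<Sum>l\<in>?A. of_real (x l) * w l)"
      unfolding S_def by (subst sum_symmetric_diff[OF j(2)]) simp
    also have "\<dots> \<le> (\<Sum>l\<in>?A. 1 / real j ^ 4)"
    proof (rule sum_norm_le)
      fix l assume l: "l \<in> ?A"
      then have lj: "int (j ^ 4) < \<bar>l\<bar>" by auto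
      moreover have "int (j ^ 4) \<ge> 1" using j(1) by (simp add: one_le_power)
      ultimately have "1 < \<bar>l\<bar>" by linarith
      have "real_of_int (int (j ^ 4)) \<le> real_of_int \<bar>l\<bar>" using lj by (intro of_int_le_iff[THEN iffD2]) simp
      then have jl: "real j ^ 4 \<le> \<bar>real_of_int l\<bar>" by simp
      have "norm (of_real (x l) * w l) \<le> 1 * (1 / \<bar>of_int l\<bar>)"
        unfolding norm_mult using x w[OF \<open>1 < \<bar>l\<bar>\<close>] by (intro mult_mono) auto
      also have "\<dots> \<le> 1 / real j ^ 4"
        using frac_le[of 1 1 "real j ^ 4" "\<bar>real_of_int l\<bar>"] jl j(1) by simp
      finally show "norm (of_real (x l) * w l) \<le> 1 / real j ^ 4" .
    qed
    also have "\<dots> = real (card ?A) / real j ^ 4" by simp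
    also have "real (card ?A) = 2 * (real N - real j ^ 4)"
    proof -
      have c: "card {- int n..int n} = 2 * n + 1" for n by simp
      have "card ?A = card {- int N..int N} - card {- int (j ^ 4)..int (j ^ 4)}"
        using j(2) by (intro card_Diff_subset) auto
      then have "card ?A = 2 * N - 2 * j ^ 4" unfolding c by simp
      then show ?thesis using j(2) by (simp add: of_nat_diff)
    qed
    also have "\<dots> \<le> 30 * real j ^ 3"
    proof -
      have N: "real N \<le> (real j + 1) ^ 4"
        using of_nat_mono[OF less_imp_le[OF j(3)], where ?'a = real] by (simp add: add.commute)
      have power4: "(r + 1) ^ 4 - r ^ 4 \<le> 15 * r ^ 3" if "r \<ge> 1" for r :: real
      proof -
        have "1 \<le> r ^ 3" "r \<le> r ^ 3" "r ^ 2 \<le> r ^ 3"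
          using that power_increasing[of 1 3 r] power_increasing[of 2 3 r] one_le_power[of r 3] by simp_all
        moreover have "(r + 1) ^ 4 - r ^ 4 = 4 * r ^ 3 + 6 * r ^ 2 + 4 * r + 1"
          by (simp add: eval_nat_numeral algebra_simps)
        ultimately show ?thesis by linarith
      qed
      have "a - b \<le> 15 * c" if "a \<le> d" "d - b \<le> 15 * c" for a b c d :: real
        using that by linarith
      from this[OF N power4] show ?thesis using j(1) by simp
    qed
    also have "30 * real j ^ 3 / real j ^ 4 = 30 / real j"
      using j(1) by (simp add: eval_nat_numeral)
    finally show ?thesis using j(1) by (simp add: divide_right_mono)
  qed
  have "S \<longlonglongrightarrow> s"
  proof (rule LIMSEQ_I)
    fix r :: real assume r: "r > 0"
    obtain J where J: "\<And>j. j \<ge> J \<Longrightarrow> norm (S (j ^ 4) - s) < r / 2"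
      using LIMSEQ_D[OF s, of "r / 2"] r by auto
    obtain K where K: "real K > 60 / r" using reals_Archimedean2 by blast
    have "norm (S N - s) < r" if N: "N \<ge> (max J (max K 1)) ^ 4" for N
    proof -
      define j where "j = (GREATEST j. j ^ 4 \<le> N)"
      have bound: "i \<le> N" if "i ^ 4 \<le> N" for i
        using that self_le_power[of i 4] by (cases "i = 0") auto
      have j: "j ^ 4 \<le> N"
        unfolding j_def by (rule GreatestI_nat[of _ "max J (max K 1)" N]) (use N bound in auto)
      have "max J (max K 1) \<le> j"
        unfolding j_def by (rule Greatest_le_nat[of _ _ N]) (use N bound in auto)
      then have jJ: "j \<ge> J" "j \<ge> K" "j \<ge> 1" by auto
      have "N < (j + 1) ^ 4"
      proof (rule ccontr)
        assume "\<not> N < (j + 1) ^ 4"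
        then have "j + 1 \<le> j"
          unfolding j_def by (intro Greatest_le_nat[of _ _ N]) (use bound in auto)
        then show False by simp
      qed
      then have "norm (S N - S (j ^ 4)) \<le> 30 / real j" using gap[of j N] jJ j by simp
      also have "30 / real j < r / 2"
      proof -
        have "60 / r < real j" using K jJ(2) by linarith
        then show ?thesis using r jJ(3) by (simp add: field_simps)
      qed
      finally have "norm (S N - S (j ^ 4)) < r / 2" .
      then show ?thesis
        using norm_triangle_ineq[of "S N - S (j ^ 4)" "S (j ^ 4) - s"] J[OF jJ(1)] by simp
    qed
    then show "\<exists>N0. \<forall>N\<ge>N0. norm (S N - s) < r" by blast
  qed
  then show ?thesis unfolding S_def convergent_def by blast
qed

context rademacher
begin

text \<open>
The block between consecutive fourth powers has expected modulus \<open>O(1 / j\<^sup>2)\<close> by orthogonality. The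
blocks are therefore almost surely absolutely summable, which gives convergence along the fourth
powers.
\<close>

lemma AE_convergent_series:
  fixes w :: "int \<Rightarrow> complex"
  assumes w: "\<And>l. 1 < \<bar>l\<bar> \<Longrightarrow> norm (w l) \<le> 1 / \<bar>of_int l\<bar>"
  shows "AE \<omega> in M. convergent (\<lambda>N. \<Sum>l\<in>{- int N..int N}. of_real (Y l \<omega>) * w l)"
proof -
  define S where "S N \<omega> = (\<Sum>l\<in>{- int N..int N}. of_real (Y l \<omega>) * w l)" for N \<omega>
  define D where "D j \<omega> = norm (S ((j + 2) ^ 4) \<omega> - S ((j + 1) ^ 4) \<omega>)" for j \<omega>
  have S_meas [measurable]: "S N \<in> borel_measurable M" for N
    unfolding S_def by measurable
  have D_meas [measurable]: "D j \<in> borel_measurable M" for j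
    unfolding D_def by measurable
  have D_le: "integral\<^sup>N M (\<lambda>\<omega>. ennreal (D j \<omega>)) \<le> ennreal (2 * (1 / real (j + 1) ^ 2))" for j
  proof -
    let ?A = "{- int ((j + 2) ^ 4)..int ((j + 2) ^ 4)} - {- int ((j + 1) ^ 4)..int ((j + 1) ^ 4)}"
    have le: "(j + 1) ^ 4 \<le> (j + 2) ^ 4" by (intro power_mono) auto
    have D_eq: "D j = (\<lambda>\<omega>. norm (\<Sum>l\<in>?A. of_real (Y l \<omega>) * w l))"
      unfolding D_def S_def sum_symmetric_diff[OF le] ..
    have A: "int ((j + 1) ^ 4) < \<bar>l\<bar>" if "l \<in> ?A" for l using that by auto
    have j1: "1 \<le> (j + 1) ^ 4" by (simp add: one_le_power)
    have "expectation (D j) \<le> sqrt (\<Sum>l\<in>?A. (norm (w l))\<^sup>2)"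
      unfolding D_eq by (rule expectation_norm_sum_Y_le) simp
    also have "\<dots> \<le> sqrt (\<Sum>l\<in>?A. 1 / (of_int l)\<^sup>2)"
    proof (intro real_sqrt_le_mono sum_mono)
      fix l assume "l \<in> ?A"
      from A[OF this] have "1 < \<bar>l\<bar>" using j1 by linarith
      then have "(norm (w l))\<^sup>2 \<le> (1 / \<bar>of_int l\<bar>)\<^sup>2" by (intro power_mono w) auto
      then show "(norm (w l))\<^sup>2 \<le> 1 / (of_int l)\<^sup>2" by (simp add: power_divide)
    qed
    also have "\<dots> \<le> sqrt (2 / real ((j + 1) ^ 4))"
      by (intro real_sqrt_le_mono sum_inverse_squares_le A j1) auto
    also have "\<dots> \<le> sqrt ((2 * (1 / real (j + 1) ^ 2))\<^sup>2)"
      by (intro real_sqrt_le_mono) (simp add: power_mult_distrib power_divide divide_right_mono flip: power_mult)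
    also have "\<dots> = 2 * (1 / real (j + 1) ^ 2)" by (subst real_sqrt_abs) simp
    finally have "expectation (D j) \<le> 2 * (1 / real (j + 1) ^ 2)" .
    moreover have "integrable M (D j)"
      unfolding D_eq by (rule expectation_norm_sum_Y_le) simp
    then have "integral\<^sup>N M (\<lambda>\<omega>. ennreal (D j \<omega>)) = ennreal (expectation (D j))"
      by (rule nn_integral_eq_integral) (simp add: D_def)
    ultimately show ?thesis by (simp add: ennreal_leI)
  qed
  have summ: "summable (\<lambda>j. 2 * (1 / real (j + 1) ^ 2))"
  proof (rule summable_mult)
    have "summable (\<lambda>n. inverse (real n ^ 2))" by (rule inverse_power_summable) simp
    then show "summable (\<lambda>j. 1 / real (j + 1) ^ 2)"
      by (subst (asm) summable_Suc_iff[symmetric]) (simp add: inverse_eq_divide)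
  qed
  have "integral\<^sup>N M (\<lambda>\<omega>. \<Sum>j. ennreal (D j \<omega>)) = (\<Sum>j. integral\<^sup>N M (\<lambda>\<omega>. ennreal (D j \<omega>)))"
    by (rule nn_integral_suminf) simp
  also have "\<dots> \<le> (\<Sum>j. ennreal (2 * (1 / real (j + 1) ^ 2)))"
    by (intro suminf_le D_le) auto
  also have "\<dots> < \<infinity>" by (subst suminf_ennreal2[OF _ summ]) auto
  finally have "AE \<omega> in M. (\<Sum>j. ennreal (D j \<omega>)) \<noteq> \<infinity>"
    by (intro nn_integral_PInf_AE) auto
  then show ?thesis
  proof (rule AE_mp[OF _ AE_I2], safe)
    fix \<omega> assume \<omega>: "\<omega> \<in> space M" "(\<Sum>j. ennreal (D j \<omega>)) \<noteq> \<infinity>"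
    have Y1: "\<bar>Y l \<omega>\<bar> \<le> 1" for l using Y_values[OF \<omega>(1), of l] by auto
    have "summable (\<lambda>j. D j \<omega>)"
      by (rule summable_suminf_not_top) (use \<omega>(2) in \<open>auto simp: D_def top_ennreal_def infinity_ennreal_def\<close>)
    then have "summable (\<lambda>j. S ((j + 2) ^ 4) \<omega> - S ((j + 1) ^ 4) \<omega>)"
      unfolding D_def by (rule summable_norm_cancel)
    then have "convergent (\<lambda>n. \<Sum>j<n. S ((Suc j + 1) ^ 4) \<omega> - S ((j + 1) ^ 4) \<omega>)"
      by (simp add: summable_iff_convergent)
    then have "convergent (\<lambda>n. S ((n + 1) ^ 4) \<omega> - S 1 \<omega>)"
      unfolding sum_lessThan_telescope[of "\<lambda>j. S ((j + 1) ^ 4) \<omega>"] by simp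
    then have "convergent (\<lambda>n. S 1 \<omega> + (S ((n + 1) ^ 4) \<omega> - S 1 \<omega>))"
      by (intro convergent_add convergent_const)
    then have "convergent (\<lambda>n. S (Suc n ^ 4) \<omega>)" by simp
    then have "convergent (\<lambda>n. S (n ^ 4) \<omega>)"
      using convergent_Suc_iff[of "\<lambda>n. S (n ^ 4) \<omega>"] by simp
    then show "convergent (\<lambda>N. \<Sum>l\<in>{- int N..int N}. of_real (Y l \<omega>) * w l)"
      unfolding S_def by (intro convergent_of_fourth_powers[OF Y1 w])
  qed
qed

end

section \<open>The limit process\<close>

definition partial_path :: "real \<Rightarrow> real \<Rightarrow> nat \<Rightarrow> (int \<Rightarrow> real) \<Rightarrow> C01"
  where "partial_path \<alpha> \<beta> N y = Bcontfun (\<lambda>t. G_partial \<alpha> \<beta> y N (coord t))"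

lemma apply_partial_path: "apply_bcontfun (partial_path \<alpha> \<beta> N y) t = G_partial \<alpha> \<beta> y N (coord t)"
proof -
  have "continuous_on {0..1} (G_partial \<alpha> \<beta> y N)"
    unfolding G_partial_eq[abs_def]
    by (intro continuous_intros continuous_on_compose2[OF continuous_on_limit_coeff]) auto
  then show ?thesis
    by (simp add: partial_path_def Bcontfun_inverse bcontfun_unit_interval)
qed

abbreviation limit_kernel :: "real \<Rightarrow> complex"
  where "limit_kernel x \<equiv> 1 / (2 * of_real pi * \<i> * of_real x)"

text \<open>
The two series \<open>end_series \<alpha>\<close> and \<open>end_series (\<alpha> + \<beta>)\<close> belong to the end points of the interval of
integration. The term with \<open>l = 0\<close> is zero because of the division by zero, which is immaterial for
convergence.
\<close>

definition end_series :: "real \<Rightarrow> (int \<Rightarrow> real) \<Rightarrow> nat \<Rightarrow> complex"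
  where "end_series w y N = (\<Sum>l\<in>{- int N..int N}. of_real (y l) * (e (w * of_int l) * limit_kernel (of_int l)))"

lemma limit_tail_eq:
  assumes "t \<in> {0..1}" "1 < \<bar>l\<bar>"
  shows "limit_coeff \<alpha> \<beta> (of_int l + t) =
    (e ((\<alpha> + \<beta>) * (of_int l + t)) - e (\<alpha> * (of_int l + t))) * limit_kernel (of_int l + t)"
proof -
  have "2 \<le> \<bar>l\<bar>" using assms by simp
  then have "2 \<le> \<bar>real_of_int l\<bar>" by linarith
  then have "of_int l + t \<noteq> 0" using assms(1) by auto
  then show ?thesis by (rule limit_coeff_eq)
qed

lemma tame_kernel_subset: "tame_kernel \<kappa> B \<Longrightarrow> A \<subseteq> B \<Longrightarrow> tame_kernel \<kappa> A"
  by (auto simp: tame_kernel_def)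

lemma partial_residual:
  assumes y: "\<And>l. \<bar>y l\<bar> \<le> 1" and t: "t \<in> {0..1}" and L: "1 \<le> L" "L \<le> N"
  shows "norm ((G_partial \<alpha> \<beta> y N t - G_partial \<alpha> \<beta> y L t) -
    (e ((\<alpha> + \<beta>) * t) * (end_series (\<alpha> + \<beta>) y N - end_series (\<alpha> + \<beta>) y L) -
     e (\<alpha> * t) * (end_series \<alpha> y N - end_series \<alpha> y L))) \<le> 16 * pi / real L"
  unfolding G_partial_eq end_series_def sum_symmetric_diff[OF L(2)]
proof (rule tame_tail_residual[OF tame_kernel_subset[OF tame_limit_kernel]])
  show "{- int N..int N} - {- int L..int L} \<subseteq> {l. 1 < \<bar>l\<bar>}" using L by auto
  show "\<And>l. l \<in> {- int N..int N} - {- int L..int L} \<Longrightarrow> limit_coeff \<alpha> \<beta> (of_int l + t) =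
      (e ((\<alpha> + \<beta>) * (of_int l + t)) - e (\<alpha> * (of_int l + t))) * limit_kernel (of_int l + t)"
    by (rule limit_tail_eq[OF t]) (use L in auto)
qed (use y t L in auto)

lemma dist_partial_path_le:
  assumes y: "\<And>l. \<bar>y l\<bar> \<le> 1" and L: "1 \<le> L" "L \<le> N"
  shows "dist (partial_path \<alpha> \<beta> N y) (partial_path \<alpha> \<beta> L y) \<le>
    norm (end_series (\<alpha> + \<beta>) y N - end_series (\<alpha> + \<beta>) y L) +
    norm (end_series \<alpha> y N - end_series \<alpha> y L) + 16 * pi / real L"
proof (rule dist_bound)
  fix s
  have t: "coord s \<in> {0..1}" by (rule coord)
  let ?V = "end_series (\<alpha> + \<beta>) y N - end_series (\<alpha> + \<beta>) y L"
  let ?U = "end_series \<alpha> y N - end_series \<alpha> y L"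
  let ?S = "G_partial \<alpha> \<beta> y N (coord s) - G_partial \<alpha> \<beta> y L (coord s)"
  let ?R = "e ((\<alpha> + \<beta>) * coord s) * ?V - e (\<alpha> * coord s) * ?U"
  have "norm ?S \<le> norm (?S - ?R) + norm ?R"
    using norm_triangle_ineq[of "?S - ?R" ?R] by simp
  also have "norm ?R \<le> norm ?V + norm ?U"
    by (rule order_trans[OF norm_triangle_ineq4]) (simp add: norm_mult)
  also have "norm (?S - ?R) \<le> 16 * pi / real L"
    by (rule partial_residual[OF y t L])
  finally show "dist (apply_bcontfun (partial_path \<alpha> \<beta> N y) s) (apply_bcontfun (partial_path \<alpha> \<beta> L y) s) \<le>
      norm ?V + norm ?U + 16 * pi / real L"
    by (simp add: apply_partial_path dist_norm)
qed

lemma obtain_index_quotient_less: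
  assumes "r > 0"
  obtains L where "1 \<le> L" "\<And>N. L \<le> N \<Longrightarrow> c / real N < (r :: real)"
proof -
  have "(\<lambda>N. c / real N) \<longlonglongrightarrow> 0" by (rule lim_const_over_n)
  from order_tendstoD(2)[OF this assms] obtain L where "\<And>N. L \<le> N \<Longrightarrow> c / real N < r"
    by (auto simp: eventually_sequentially)
  then show thesis by (intro that[of "max 1 L"]) auto
qed

lemma Cauchy_partial_path:
  assumes y: "\<And>l. \<bar>y l\<bar> \<le> 1"
    and "Cauchy (end_series \<alpha> y)" "Cauchy (end_series (\<alpha> + \<beta>) y)"
  shows "Cauchy (\<lambda>N. partial_path \<alpha> \<beta> N y)"
proof (rule metric_CauchyI)
  fix r :: real assume r: "r > 0"
  then have r3: "r / 3 > 0" by simp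
  obtain L1 where L1: "\<And>m n. m \<ge> L1 \<Longrightarrow> n \<ge> L1 \<Longrightarrow> norm (end_series \<alpha> y m - end_series \<alpha> y n) < r / 3"
    using CauchyD[OF assms(2) r3] by blast
  obtain L2 where L2: "\<And>m n. m \<ge> L2 \<Longrightarrow> n \<ge> L2 \<Longrightarrow>
      norm (end_series (\<alpha> + \<beta>) y m - end_series (\<alpha> + \<beta>) y n) < r / 3"
    using CauchyD[OF assms(3) r3] by blast
  obtain L3 where L3: "1 \<le> L3" "\<And>N. L3 \<le> N \<Longrightarrow> 16 * pi / real N < r / 3"
    using obtain_index_quotient_less[OF r3, of "16 * pi"] by blast
  have *: "dist (partial_path \<alpha> \<beta> N y) (partial_path \<alpha> \<beta> L y) < r"
    if "L \<ge> max L1 (max L2 L3)" "L \<le> N" for L N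
  proof -
    have L: "L \<ge> L1" "L \<ge> L2" "L \<ge> L3" "N \<ge> L1" "N \<ge> L2" using that by auto
    have "1 \<le> L" using L(3) L3(1) by simp
    from dist_partial_path_le[of y, OF y this that(2), of \<alpha> \<beta>]
      L1[OF L(4,1)] L2[OF L(5,2)] L3(2)[OF L(3)]
    show ?thesis by linarith
  qed
  show "\<exists>K. \<forall>m\<ge>K. \<forall>n\<ge>K. dist (partial_path \<alpha> \<beta> m y) (partial_path \<alpha> \<beta> n y) < r"
  proof (intro exI allI impI)
    fix m n assume "m \<ge> max L1 (max L2 L3)" "n \<ge> max L1 (max L2 L3)"
    then show "dist (partial_path \<alpha> \<beta> m y) (partial_path \<alpha> \<beta> n y) < r"
      using *[of n m] *[of m n] by (cases "n \<le> m") (auto simp: dist_commute)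
  qed
qed

text \<open>
For each \<open>t\<close> the combination \<open>e((\<alpha> + \<beta>) t) V - e(\<alpha> t) U\<close> of the partial sums \<open>V\<close> and \<open>U\<close> of the two
series converges. Taking \<open>t = 0\<close> and one \<open>t\<close> with \<open>0 < \<beta> t \<le> 1 / 2\<close> gives two independent linear
equations for \<open>U\<close> and \<open>V\<close>, since their determinant \<open>e(\<beta> t) - 1\<close> is not zero.
\<close>

lemma Cauchy_end_series_if_pointwise:
  assumes y: "\<And>l. \<bar>y l\<bar> \<le> 1" and \<beta>: "\<beta> > 0"
    and conv: "\<And>t. t \<in> {0..1} \<Longrightarrow> convergent (\<lambda>N. G_partial \<alpha> \<beta> y N t)"
  shows "Cauchy (end_series \<alpha> y)" "Cauchy (end_series (\<alpha> + \<beta>) y)"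
proof -
  define H where "H t N = e ((\<alpha> + \<beta>) * t) * end_series (\<alpha> + \<beta>) y N - e (\<alpha> * t) * end_series \<alpha> y N" for t N
  have H: "Cauchy (H t)" if t: "t \<in> {0..1}" for t
  proof -
    define R where "R N = G_partial \<alpha> \<beta> y N t - H t N" for N
    have R: "norm (R N - R L) \<le> 16 * pi / real L" if L: "1 \<le> L" "L \<le> N" for L N
      using partial_residual[of y, OF y t L, of \<alpha> \<beta>] by (simp add: R_def H_def algebra_simps)
    have "Cauchy R"
    proof (rule CauchyI')
      fix r :: real assume r: "r > 0"
      obtain L where L: "1 \<le> L" "\<And>N. L \<le> N \<Longrightarrow> 16 * pi / real N < r"
        using obtain_index_quotient_less[OF r, of "16 * pi"] by blast
      have "dist (R m) (R n) < r" if "m \<ge> L" "n > m" for m n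
      proof -
        have "norm (R n - R m) \<le> 16 * pi / real m" by (rule R) (use that L in auto)
        also have "\<dots> < r" by (rule L(2)[OF that(1)])
        finally show ?thesis by (simp add: dist_norm norm_minus_commute)
      qed
      then show "\<exists>L. \<forall>m\<ge>L. \<forall>n>m. dist (R m) (R n) < r" by blast
    qed
    then have "convergent R" by (simp add: Cauchy_convergent_iff)
    then have "convergent (\<lambda>N. G_partial \<alpha> \<beta> y N t - R N)"
      by (intro convergent_diff conv t)
    then show ?thesis by (simp add: R_def Cauchy_convergent_iff)
  qed
  define t where "t = min 1 (1 / (2 * \<beta>))"
  have t: "t \<in> {0..1}" using \<beta> by (simp add: t_def)
  have "0 < \<beta> * t" "\<beta> * t \<le> 1 / 2"
    using \<beta> by (auto simp: t_def min_def field_simps)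
  have "\<beta> * t \<notin> \<int>"
  proof
    assume "\<beta> * t \<in> \<int>"
    then obtain n where n: "\<beta> * t = of_int n" by (elim Ints_cases)
    with \<open>0 < \<beta> * t\<close> have "1 \<le> n" by simp
    then have "(1::real) \<le> of_int n" by simp
    with n \<open>\<beta> * t \<le> 1 / 2\<close> show False by simp
  qed
  then have ne: "e (\<beta> * t) - 1 \<noteq> 0" by (simp add: e_eq_1_iff)
  have "e (\<beta> * t) * end_series (\<alpha> + \<beta>) y N - end_series \<alpha> y N = H t N / e (\<alpha> * t)" for N
    by (simp add: H_def distrib_right e_add diff_divide_distrib)
  then have eqB: "end_series (\<alpha> + \<beta>) y N = (H t N / e (\<alpha> * t) - H 0 N) / (e (\<beta> * t) - 1)" for N
    using ne by (simp add: H_def field_simps)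
  have convH: "convergent (H t)" "convergent (H 0)"
    using H[OF t] H[of 0] by (simp_all add: Cauchy_convergent_iff)
  have "convergent (\<lambda>N. (1 / (e (\<beta> * t) - 1)) * ((1 / e (\<alpha> * t)) * H t N - H 0 N))"
    by (intro convergent_mult convergent_diff convergent_const convH)
  then have B: "convergent (end_series (\<alpha> + \<beta>) y)"
    by (subst eqB[abs_def]) simp
  then show "Cauchy (end_series (\<alpha> + \<beta>) y)" by (simp add: Cauchy_convergent_iff)
  have "convergent (\<lambda>N. end_series (\<alpha> + \<beta>) y N - H 0 N)"
    by (intro convergent_diff B convH)
  then show "Cauchy (end_series \<alpha> y)" by (simp add: H_def Cauchy_convergent_iff)
qed

text \<open>
Pointwise convergence of the partial sums already forces uniform convergence, because it forces the two
numerical series to converge. Hence the case distinction in \<open>G_limit\<close>, which involves uncountably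
many points \<open>t\<close>, is a condition on two sequences of random variables.
\<close>

lemma G_limit_cases:
  assumes y: "\<And>l. \<bar>y l\<bar> \<le> 1" and \<beta>: "\<beta> > 0"
  shows "Cauchy (end_series \<alpha> y) \<and> Cauchy (end_series (\<alpha> + \<beta>) y) \<Longrightarrow>
      (\<lambda>N. partial_path \<alpha> \<beta> N y) \<longlonglongrightarrow> G_limit \<alpha> \<beta> y"
    and "\<not> (Cauchy (end_series \<alpha> y) \<and> Cauchy (end_series (\<alpha> + \<beta>) y)) \<Longrightarrow> G_limit \<alpha> \<beta> y = 0"
proof -
  let ?P = "\<lambda>g :: C01. \<forall>t. (\<lambda>N. G_partial \<alpha> \<beta> y N (coord t)) \<longlonglongrightarrow> apply_bcontfun g t"
  show "(\<lambda>N. partial_path \<alpha> \<beta> N y) \<longlonglongrightarrow> G_limit \<alpha> \<beta> y"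
    if "Cauchy (end_series \<alpha> y) \<and> Cauchy (end_series (\<alpha> + \<beta>) y)"
  proof -
    have "convergent (\<lambda>N. partial_path \<alpha> \<beta> N y)"
      using Cauchy_partial_path[of y, OF y, of \<alpha> \<beta>] that by (simp add: Cauchy_convergent_iff)
    then obtain g where g: "(\<lambda>N. partial_path \<alpha> \<beta> N y) \<longlonglongrightarrow> g" by (auto simp: convergent_def)
    have Pg: "?P g"
    proof
      fix t
      show "(\<lambda>N. G_partial \<alpha> \<beta> y N (coord t)) \<longlonglongrightarrow> apply_bcontfun g t"
      proof (rule metric_tendsto_imp_tendsto[OF g always_eventually], rule allI)
        fix N
        show "dist (G_partial \<alpha> \<beta> y N (coord t)) (apply_bcontfun g t) \<le> dist (partial_path \<alpha> \<beta> N y) g"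
          using dist_bounded[of "partial_path \<alpha> \<beta> N y" t g] by (simp add: apply_partial_path)
      qed
    qed
    have "(THE g. ?P g) = g"
    proof (rule the_equality[where P = ?P, OF Pg])
      fix h assume "?P h"
      then show "h = g" using Pg by (intro bcontfun_eqI) (metis LIMSEQ_unique)
    qed
    then have "G_limit \<alpha> \<beta> y = g" unfolding G_limit_def using Pg by auto
    with g show ?thesis by simp
  qed
  show "G_limit \<alpha> \<beta> y = 0" if not: "\<not> (Cauchy (end_series \<alpha> y) \<and> Cauchy (end_series (\<alpha> + \<beta>) y))"
  proof -
    have "\<not> (\<exists>g. ?P g)"
    proof
      assume "\<exists>g. ?P g"
      then obtain g where g: "?P g" by blast
      have "convergent (\<lambda>N. G_partial \<alpha> \<beta> y N t)" if "t \<in> {0..1}" for t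
        using g[rule_format, of "Unit_interval t"] Unit_interval_inverse[OF that]
        by (auto simp: convergent_def)
      from Cauchy_end_series_if_pointwise[OF y \<beta> this] not show False by blast
    qed
    then show ?thesis unfolding G_limit_def by (rule if_not_P)
  qed
qed

context rademacher
begin

lemma abs_Y_le_1: "\<omega> \<in> space M \<Longrightarrow> \<bar>Y l \<omega>\<bar> \<le> 1"
  using Y_values[of \<omega> l] by auto

lemma measurable_partial_path: "(\<lambda>\<omega>. partial_path \<alpha> \<beta> N (\<lambda>l. Y l \<omega>)) \<in> borel_measurable M"
proof (rule measurable_finitely_determined[of "{- int N..int N}"])
  fix x y :: "int \<Rightarrow> real" assume "\<And>l. l \<in> {- int N..int N} \<Longrightarrow> x l = y l"
  then show "partial_path \<alpha> \<beta> N x = partial_path \<alpha> \<beta> N y"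
    unfolding partial_path_def G_partial_def by simp
qed simp

text \<open>
Everywhere, not only almost everywhere, the limit path is the limit of the paths obtained by cutting
off the partial sums outside the measurable set on which both numerical series converge.
\<close>

lemma measurable_G_limit:
  assumes "\<beta> > 0"
  shows "(\<lambda>\<omega>. G_limit \<alpha> \<beta> (\<lambda>l. Y l \<omega>)) \<in> borel_measurable M"
proof -
  define K where "K = {\<omega>\<in>space M. Cauchy (end_series \<alpha> (\<lambda>l. Y l \<omega>))} \<inter>
    {\<omega>\<in>space M. Cauchy (end_series (\<alpha> + \<beta>) (\<lambda>l. Y l \<omega>))}"
  have meas: "(\<lambda>\<omega>. end_series w (\<lambda>l. Y l \<omega>) N) \<in> borel_measurable M" for w N
    unfolding end_series_def by measurable
  have K: "K \<in> sets M"
    unfolding K_def by (intro sets.Int sets_Collect_Cauchy meas)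
  show ?thesis
  proof (rule borel_measurable_LIMSEQ_metric)
    show "(\<lambda>\<omega>. if \<omega> \<in> K then partial_path \<alpha> \<beta> N (\<lambda>l. Y l \<omega>) else 0) \<in> borel_measurable M" for N
      by (intro measurable_If_set measurable_partial_path) (use K in \<open>auto intro: sets.Int\<close>)
    fix \<omega> assume \<omega>: "\<omega> \<in> space M"
    show "(\<lambda>N. if \<omega> \<in> K then partial_path \<alpha> \<beta> N (\<lambda>l. Y l \<omega>) else 0) \<longlonglongrightarrow> G_limit \<alpha> \<beta> (\<lambda>l. Y l \<omega>)"
      using G_limit_cases[of "\<lambda>l. Y l \<omega>" \<beta> \<alpha>, OF abs_Y_le_1[OF \<omega>] assms] \<omega>
      by (cases "\<omega> \<in> K") (auto simp: K_def)
  qed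
qed

lemma AE_partial_path_tendsto:
  assumes "\<beta> > 0"
  shows "AE \<omega> in M. (\<lambda>N. partial_path \<alpha> \<beta> N (\<lambda>l. Y l \<omega>)) \<longlonglongrightarrow> G_limit \<alpha> \<beta> (\<lambda>l. Y l \<omega>)"
proof -
  have AE: "AE \<omega> in M. Cauchy (end_series w (\<lambda>l. Y l \<omega>))" for w
    unfolding Cauchy_convergent_iff end_series_def
  proof (rule AE_convergent_series)
    fix l :: int assume "1 < \<bar>l\<bar>"
    then show "norm (e (w * of_int l) * limit_kernel (of_int l)) \<le> 1 / \<bar>of_int l\<bar>"
      using tame_kernelD(1)[OF tame_limit_kernel, of l] by (simp add: norm_mult norm_divide)
  qed
  show ?thesis
    using AE[of \<alpha>] AE[of "\<alpha> + \<beta>"] AE_space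
  proof eventually_elim
    case (elim \<omega>)
    then show ?case
      using G_limit_cases(1)[of "\<lambda>l. Y l \<omega>" \<beta> \<alpha>, OF abs_Y_le_1 assms] by blast
  qed
qed

end

section \<open>Convergence in distribution\<close>

text \<open>
The value at \<open>l\<close> is a sign except when \<open>l\<close> is congruent to \<open>k\<close>, where it is \<open>0\<close>.
\<close>

definition sign_path :: "nat \<Rightarrow> nat \<Rightarrow> int \<Rightarrow> real"
  where "sign_path q k l = of_int (Legendre (int k - l) (int q))"

context odd_prime
begin

lemma prob_space_residues: "prob_space (uniform_count_measure {..<q})"
  using q_pos by (intro prob_space_uniform_count_measure) auto

lemma measurable_residues: "X \<in> measurable (uniform_count_measure {..<q}) (borel :: 'b::topological_space measure)"
  by (simp add: measurable_def sets_uniform_count_measure space_uniform_count_measure)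

lemma integral_residues: "(\<integral>k. f k \<partial>uniform_count_measure {..<q}) = (\<Sum>k<q. f k) / real q"
  by (subst integral_uniform_count_measure) auto

lemma abs_sign_path_le_1: "\<bar>sign_path q k l\<bar> \<le> 1"
  using abs_leg_le_1[of "int k - l"] unfolding sign_path_def by linarith

lemma sign_path_correlation:
  assumes "l \<in> {-half..half}" "l' \<in> {-half..half}"
  shows "(\<Sum>k<q. sign_path q k l * sign_path q k l') / real q = (if l = l' then 1 else 0) - 1 / real q"
proof -
  have iff: "int q dvd l - l' \<longleftrightarrow> l = l'"
  proof
    assume "int q dvd l - l'"
    moreover have "\<bar>l - l'\<bar> < int q" using assms q_eq_half by auto
    ultimately show "l = l'" using dvd_imp_le_int[of "l - l'" "int q"] by fastforce
  qed simp
  have "(\<Sum>k<q. leg (int k - l) * leg (int k - l')) = (\<Sum>k\<in>{0..<int q}. leg (k - l) * leg (k - l'))"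
    by (rule sum.reindex_bij_witness[of _ nat int]) auto
  also have "\<dots> = (if l = l' then int q else 0) - 1" unfolding leg_correlation iff ..
  finally have "(\<Sum>k<q. sign_path q k l * sign_path q k l') = of_int ((if l = l' then int q else 0) - 1)"
    unfolding sign_path_def by (simp flip: of_int_mult of_int_sum)
  then show ?thesis using q_pos by (simp add: field_simps)
qed

lemma average_norm_sum_le:
  fixes w :: "int \<Rightarrow> complex"
  assumes "A \<subseteq> {-half..half}"
  shows "(\<Sum>k<q. norm (\<Sum>l\<in>A. of_real (sign_path q k l) * w l)) / real q \<le> sqrt (\<Sum>l\<in>A. (norm (w l))\<^sup>2)"
proof -
  interpret residues: prob_space "uniform_count_measure {..<q}" by (rule prob_space_residues)
  have "finite A" using assms finite_subset by auto
  have "residues.expectation (\<lambda>k. norm (\<Sum>l\<in>A. of_real (sign_path q k l) * w l)) \<le> sqrt (\<Sum>l\<in>A. (norm (w l))\<^sup>2)"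
  proof (rule residues.expectation_norm_sum_le[where \<eta> = "1 / real q" and X = "\<lambda>l k. sign_path q k l", THEN conjunct2])
    fix l l' assume "l \<in> A" "l' \<in> A"
    then show "residues.expectation (\<lambda>k. sign_path q k l * sign_path q k l') = (if l = l' then 1 else 0) - 1 / real q"
      unfolding integral_residues using assms by (intro sign_path_correlation) auto
  qed (use \<open>finite A\<close> abs_sign_path_le_1 measurable_residues in auto)
  then show ?thesis unfolding integral_residues .
qed

text \<open>
The terms with \<open>\<bar>l\<bar> \<le> L\<close> are compared with the partial sum of the limit process, the others are
estimated as a tail. In the bound only the first two summands depend on \<open>k\<close>.
\<close>

lemma dist_G_finite_le:
  assumes \<beta>: "\<beta> > 0" and L: "1 \<le> L" "int L \<le> half"
  defines "A \<equiv> {-half..half} - {- int L..int L}"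
  shows "dist (G_finite q \<alpha> \<beta> k) (partial_path \<alpha> \<beta> L (sign_path q k)) \<le>
    norm (\<Sum>l\<in>A. of_real (sign_path q k l) * (e (grid_point (\<alpha> + \<beta>) * of_int l) * geom_kernel (of_int l))) +
    norm (\<Sum>l\<in>A. of_real (sign_path q k l) * (e (grid_point \<alpha> * of_int l) * geom_kernel (of_int l))) +
    16 * pi / real L + (2 * real L + 1) * (2 + pi * (real L + 1) * (\<beta> + 1)) / real q"
    (is "_ \<le> ?T")
proof (rule dist_bound)
  fix s
  define t where "t = coord s"
  have t: "t \<in> {0..1}" unfolding t_def by (rule coord)
  define c where "c l = finite_coeff \<alpha> \<beta> (of_int l + t)" for l :: int
  define c' where "c' l = limit_coeff \<alpha> \<beta> (of_int l + t)" for l :: int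
  let ?x = "\<lambda>l. complex_of_real (sign_path q k l)"
  have path: "G_finite_path q \<alpha> \<beta> k t = (\<Sum>l\<in>{-half..half}. ?x l * c l)"
    unfolding G_finite_path_eq c_def by (simp add: sign_path_def)
  have partial: "G_partial \<alpha> \<beta> (sign_path q k) L t = (\<Sum>l\<in>{- int L..int L}. ?x l * c' l)"
    unfolding G_partial_eq c'_def ..
  have "(\<Sum>l\<in>A. ?x l * c l) = (\<Sum>l\<in>{-half..half}. ?x l * c l) - (\<Sum>l\<in>{- int L..int L}. ?x l * c l)"
    unfolding A_def using L by (intro sum_diff) auto
  then have "G_finite_path q \<alpha> \<beta> k t - G_partial \<alpha> \<beta> (sign_path q k) L t =
      (\<Sum>l\<in>A. ?x l * c l) + (\<Sum>l\<in>{- int L..int L}. ?x l * (c l - c' l))"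
    unfolding path partial by (simp add: sum_subtractf right_diff_distrib)
  also have "norm \<dots> \<le> norm (\<Sum>l\<in>A. ?x l * c l) + norm (\<Sum>l\<in>{- int L..int L}. ?x l * (c l - c' l))"
    by (rule norm_triangle_ineq)
  also have "norm (\<Sum>l\<in>{- int L..int L}. ?x l * (c l - c' l)) \<le>
      (\<Sum>l\<in>{- int L..int L}. (2 + pi * (real L + 1) * (\<beta> + 1)) / real q)"
  proof (rule sum_norm_le)
    fix l assume "l \<in> {- int L..int L}"
    then have "\<bar>l\<bar> \<le> int L" by auto
    then have "\<bar>real_of_int l\<bar> \<le> real L" by linarith
    then have lt: "\<bar>of_int l + t\<bar> \<le> real L + 1" using t by auto
    have "norm (?x l * (c l - c' l)) \<le> 1 * norm (c l - c' l)"
      unfolding norm_mult using abs_sign_path_le_1 by (intro mult_right_mono) auto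
    also have "\<dots> \<le> (2 + pi * \<bar>of_int l + t\<bar> * (\<beta> + 1)) / real q"
      unfolding c_def c'_def mult_1 by (rule finite_coeff_approx[OF \<beta>])
    also have "\<dots> \<le> (2 + pi * (real L + 1) * (\<beta> + 1)) / real q"
      using lt \<beta> by (intro divide_right_mono add_left_mono mult_right_mono mult_left_mono) auto
    finally show "norm (?x l * (c l - c' l)) \<le> (2 + pi * (real L + 1) * (\<beta> + 1)) / real q" .
  qed
  also have "\<dots> = (2 * real L + 1) * (2 + pi * (real L + 1) * (\<beta> + 1)) / real q"
    by simp
  also have "norm (\<Sum>l\<in>A. ?x l * c l) \<le>
      norm (\<Sum>l\<in>A. ?x l * (e (grid_point (\<alpha> + \<beta>) * of_int l) * geom_kernel (of_int l))) +
      norm (\<Sum>l\<in>A. ?x l * (e (grid_point \<alpha> * of_int l) * geom_kernel (of_int l))) + 16 * pi / real L"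
    unfolding c_def
  proof (rule tame_tail_bound[OF tame_kernel_subset[OF tame_geom_kernel]])
    show "A \<subseteq> {l. 1 < \<bar>l\<bar> \<and> \<bar>l\<bar> \<le> half}" unfolding A_def using L by auto
    show "finite A" by (simp add: A_def)
    show "int L < \<bar>l\<bar>" if "l \<in> A" for l using that by (auto simp: A_def)
    fix l assume l: "l \<in> A"
    show "finite_coeff \<alpha> \<beta> (of_int l + t) = (e (grid_point (\<alpha> + \<beta>) * (of_int l + t)) -
        e (grid_point \<alpha> * (of_int l + t))) * geom_kernel (of_int l + t)"
    proof (rule finite_coeff_eq_geom_kernel[OF \<beta>])
      have "2 \<le> \<bar>l\<bar>" "\<bar>l\<bar> \<le> half" using l L by (auto simp: A_def)
      then have "2 \<le> \<bar>real_of_int l\<bar>" "\<bar>real_of_int l\<bar> \<le> of_int half" by linarith+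
      then have "\<bar>of_int l + t\<bar> \<le> of_int half + 1" "of_int l + t \<noteq> 0" using t by auto
      then have "0 < \<bar>of_int l + t\<bar> / real q" "\<bar>of_int l + t\<bar> / real q \<le> norm (e ((of_int l + t) / real q) - 1)"
        using q_pos norm_e_div_q_ge by auto
      then show "e ((of_int l + t) / real q) \<noteq> 1" by auto
    qed
  qed (use L t abs_sign_path_le_1 in auto)
  finally have "norm (G_finite_path q \<alpha> \<beta> k t - G_partial \<alpha> \<beta> (sign_path q k) L t) \<le> ?T" by simp
  then show "dist (apply_bcontfun (G_finite q \<alpha> \<beta> k) s) (apply_bcontfun (partial_path \<alpha> \<beta> L (sign_path q k)) s) \<le> ?T"
    by (simp add: apply_G_finite apply_partial_path dist_norm t_def)
qed

text \<open>
Uniform smallness of the tails: the first two summands do not involve \<open>q\<close>, and the third one vanishes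
for fixed \<open>L\<close> as \<open>q\<close> grows.
\<close>

lemma average_dist_le:
  assumes \<beta>: "\<beta> > 0" and L: "1 \<le> L" "int L \<le> half"
  shows "(\<Sum>k<q. dist (G_finite q \<alpha> \<beta> k) (partial_path \<alpha> \<beta> L (sign_path q k))) / real q \<le>
    2 * sqrt (2 / real L) + 16 * pi / real L + (2 * real L + 1) * (2 + pi * (real L + 1) * (\<beta> + 1)) / real q"
proof -
  define A where "A = {-half..half} - {- int L..int L}"
  define C where "C = 16 * pi / real L + (2 * real L + 1) * (2 + pi * (real L + 1) * (\<beta> + 1)) / real q"
  define T where "T w k = norm (\<Sum>l\<in>A. of_real (sign_path q k l) * (e (w * of_int l) * geom_kernel (of_int l)))" for w k
  have T: "(\<Sum>k<q. T w k) / real q \<le> sqrt (2 / real L)" for w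
  proof -
    have "(\<Sum>k<q. T w k) / real q \<le> sqrt (\<Sum>l\<in>A. (norm (e (w * of_int l) * geom_kernel (of_int l)))\<^sup>2)"
      unfolding T_def by (rule average_norm_sum_le) (auto simp: A_def)
    also have "\<dots> \<le> sqrt (2 / real L)"
      by (intro real_sqrt_le_mono sum_tame_kernel_le tame_kernel_subset[OF tame_geom_kernel])
        (use L in \<open>auto simp: A_def\<close>)
    finally show ?thesis .
  qed
  have "(\<Sum>k<q. dist (G_finite q \<alpha> \<beta> k) (partial_path \<alpha> \<beta> L (sign_path q k))) \<le>
      (\<Sum>k<q. T (grid_point (\<alpha> + \<beta>)) k + T (grid_point \<alpha>) k + C)"
    using dist_G_finite_le[OF \<beta> L] unfolding T_def C_def A_def by (intro sum_mono) (simp add: add_ac)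
  then have "(\<Sum>k<q. dist (G_finite q \<alpha> \<beta> k) (partial_path \<alpha> \<beta> L (sign_path q k))) / real q \<le>
      (\<Sum>k<q. T (grid_point (\<alpha> + \<beta>)) k + T (grid_point \<alpha>) k + C) / real q"
    by (rule divide_right_mono) simp
  also have "\<dots> = (\<Sum>k<q. T (grid_point (\<alpha> + \<beta>)) k) / real q + (\<Sum>k<q. T (grid_point \<alpha>) k) / real q + C"
    using q_pos by (simp add: sum.distrib add_divide_distrib)
  also have "\<dots> \<le> sqrt (2 / real L) + sqrt (2 / real L) + C"
    by (intro add_mono T order_refl)
  finally show ?thesis by (simp add: C_def)
qed

end

text \<open>
First \<open>L\<close> is chosen so that both processes are close to their truncations at \<open>L\<close>, the finite one
uniformly in \<open>q\<close>. For this fixed \<open>L\<close> the truncated functional depends on finitely many signs, and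
their equidistribution applies.
\<close>

lemma (in rademacher) lipschitz_functional_tendsto:
  fixes \<phi> :: "C01 \<Rightarrow> real"
  assumes \<beta>: "\<beta> > 0" and bdd: "\<And>x. \<bar>\<phi> x\<bar> \<le> B"
    and lip: "\<And>x y. \<bar>\<phi> x - \<phi> y\<bar> \<le> C * dist x y" and C: "0 \<le> C"
  shows "((\<lambda>q. \<integral>k. \<phi> (G_finite q \<alpha> \<beta> k) \<partial>uniform_count_measure {..<q}) \<longlongrightarrow>
    expectation (\<lambda>\<omega>. \<phi> (G_limit \<alpha> \<beta> (\<lambda>l. Y l \<omega>)))) primes_at_top"
proof (rule tendstoI)
  fix r :: real assume r: "r > 0"
  define E where "E = expectation (\<lambda>\<omega>. \<phi> (G_limit \<alpha> \<beta> (\<lambda>l. Y l \<omega>)))"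
  define E' where "E' L = expectation (\<lambda>\<omega>. \<phi> (partial_path \<alpha> \<beta> L (\<lambda>l. Y l \<omega>)))" for L
  have cont: "continuous_on UNIV \<phi>" by (rule continuous_on_if_lipschitz[OF lip])
  have "E' \<longlonglongrightarrow> E"
    unfolding E_def E'_def
  proof (rule integral_dominated_convergence[where w = "\<lambda>_. B"])
    show "(\<lambda>\<omega>. \<phi> (G_limit \<alpha> \<beta> (\<lambda>l. Y l \<omega>))) \<in> borel_measurable M"
      by (rule measurable_continuous_compose[OF cont measurable_G_limit[OF \<beta>]])
    show "(\<lambda>\<omega>. \<phi> (partial_path \<alpha> \<beta> L (\<lambda>l. Y l \<omega>))) \<in> borel_measurable M" for L
      by (rule measurable_continuous_compose[OF cont measurable_partial_path])
    show "AE \<omega> in M. (\<lambda>L. \<phi> (partial_path \<alpha> \<beta> L (\<lambda>l. Y l \<omega>))) \<longlonglongrightarrow> \<phi> (G_limit \<alpha> \<beta> (\<lambda>l. Y l \<omega>))"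
      using AE_partial_path_tendsto[OF \<beta>, of \<alpha>]
    proof eventually_elim
      case (elim \<omega>)
      show ?case by (rule continuous_on_tendsto_compose[OF cont elim]) auto
    qed
  qed (use bdd in auto)
  then have "\<forall>\<^sub>F L in sequentially. dist (E' L) E < r / 4"
    using r by (intro tendstoD) auto
  moreover have "(\<lambda>L. C * (2 * sqrt (2 / real L) + 16 * pi / real L)) \<longlonglongrightarrow> C * (2 * sqrt 0 + 0)"
    by (intro tendsto_intros lim_const_over_n)
  then have "\<forall>\<^sub>F L in sequentially. C * (2 * sqrt (2 / real L) + 16 * pi / real L) < r / 4"
    using r by (intro order_tendstoD(2)) auto
  ultimately have "\<forall>\<^sub>F L in sequentially. 1 \<le> L \<and> dist (E' L) E < r / 4 \<and>
      C * (2 * sqrt (2 / real L) + 16 * pi / real L) < r / 4"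
    using eventually_ge_at_top[of 1] by eventually_elim simp
  then obtain L where L: "1 \<le> L" "dist (E' L) E < r / 4"
      "C * (2 * sqrt (2 / real L) + 16 * pi / real L) < r / 4"
    unfolding eventually_sequentially by blast
  define K where "K = C * ((2 * real L + 1) * (2 + pi * (real L + 1) * (\<beta> + 1)))"
  have "((\<lambda>q. (\<Sum>k<q. \<phi> (partial_path \<alpha> \<beta> L (sign_path q k))) / real q) \<longlongrightarrow> E' L) primes_at_top"
    unfolding sign_path_def[abs_def] E'_def
  proof (rule pattern_equidistribution[of "{- int L..int L}"])
    fix x y :: "int \<Rightarrow> real" assume "\<And>l. l \<in> {- int L..int L} \<Longrightarrow> x l = y l"
    then show "\<phi> (partial_path \<alpha> \<beta> L x) = \<phi> (partial_path \<alpha> \<beta> L y)"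
      unfolding partial_path_def G_partial_def by simp
  qed (use bdd in auto)
  then have "\<forall>\<^sub>F q in primes_at_top. dist ((\<Sum>k<q. \<phi> (partial_path \<alpha> \<beta> L (sign_path q k))) / real q) (E' L) < r / 4"
    using r by (intro tendstoD) auto
  moreover have "\<forall>\<^sub>F q in primes_at_top. K / real q < r / 4"
    using r by (intro order_tendstoD(2)[OF tendsto_divide_primes]) auto
  moreover have "\<forall>\<^sub>F q in primes_at_top. odd_prime q \<and> q \<ge> 2 * L + 1"
    by (rule eventually_odd_prime)
  ultimately show "\<forall>\<^sub>F q in primes_at_top.
      dist (\<integral>k. \<phi> (G_finite q \<alpha> \<beta> k) \<partial>uniform_count_measure {..<q})
        (expectation (\<lambda>\<omega>. \<phi> (G_limit \<alpha> \<beta> (\<lambda>l. Y l \<omega>)))) < r"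
  proof eventually_elim
    case (elim q)
    then interpret odd_prime q by simp
    let ?P = "\<lambda>k. partial_path \<alpha> \<beta> L (sign_path q k)"
    have half: "int L \<le> half" using elim q_eq_half by linarith
    have "\<bar>(\<Sum>k<q. \<phi> (G_finite q \<alpha> \<beta> k)) / real q - (\<Sum>k<q. \<phi> (?P k)) / real q\<bar> =
        \<bar>\<Sum>k<q. \<phi> (G_finite q \<alpha> \<beta> k) - \<phi> (?P k)\<bar> / real q"
      by (simp add: sum_subtractf flip: diff_divide_distrib)
    also have "\<dots> \<le> (\<Sum>k<q. C * dist (G_finite q \<alpha> \<beta> k) (?P k)) / real q"
      by (intro divide_right_mono order_trans[OF sum_abs sum_mono] lip) simp
    also have "\<dots> = C * ((\<Sum>k<q. dist (G_finite q \<alpha> \<beta> k) (?P k)) / real q)"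
      by (simp add: sum_distrib_left)
    also have "\<dots> \<le> C * (2 * sqrt (2 / real L) + 16 * pi / real L +
        (2 * real L + 1) * (2 + pi * (real L + 1) * (\<beta> + 1)) / real q)"
      by (intro mult_left_mono average_dist_le \<beta> L half C)
    also have "\<dots> = C * (2 * sqrt (2 / real L) + 16 * pi / real L) + K / real q"
      by (simp add: K_def distrib_left)
    also have "\<dots> < r / 4 + r / 4"
      by (intro add_strict_mono L(3)) (use elim in simp)
    finally have "dist (\<integral>k. \<phi> (G_finite q \<alpha> \<beta> k) \<partial>uniform_count_measure {..<q}) ((\<Sum>k<q. \<phi> (?P k)) / real q) < r / 2"
      unfolding integral_residues by (simp add: dist_real_def)
    moreover have "dist ((\<Sum>k<q. \<phi> (?P k)) / real q) (E' L) < r / 4" using elim by simp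
    moreover have "dist a d < r" if "dist a b < r / 2" "dist b c < r / 4" "dist c d < r / 4" for a b c d :: real
      using dist_triangle[of a d b] dist_triangle[of b d c] that by linarith
    ultimately show ?case using L(2) unfolding E_def by blast
  qed
qed

theorem theorem2:
  fixes \<alpha> \<beta> :: real
    and M :: "'a measure"
    and Y :: "int \<Rightarrow> 'a \<Rightarrow> real"
  assumes "\<beta> > 0"
    and "prob_space M"
    and "prob_space.indep_vars M (\<lambda>_. count_space {-1, 1}) Y UNIV"
    and "\<And>l. distr M (count_space {-1, 1}) (Y l) = uniform_count_measure {-1, 1}"
  shows "converges_in_distribution
    (\<lambda>q. uniform_count_measure {..<q}) (\<lambda>q k. G_finite q \<alpha> \<beta> k)
    M (\<lambda>\<omega>. G_limit \<alpha> \<beta> (\<lambda>l. Y l \<omega>))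
    (inf at_top (principal {q :: nat. prime q}))"
proof -
  interpret rademacher M Y
    using assms by (intro rademacher.intro rademacher_axioms.intro)
  show ?thesis
  proof (rule converges_in_distribution_lipschitz)
    show "\<forall>\<^sub>F q in primes_at_top. prob_space (uniform_count_measure {..<q}) \<and>
        G_finite q \<alpha> \<beta> \<in> borel_measurable (uniform_count_measure {..<q})"
      using eventually_odd_prime[of 0]
    proof eventually_elim
      case (elim q)
      then interpret odd_prime q by simp
      show ?case using prob_space_residues measurable_residues by blast
    qed
    show "(\<lambda>\<omega>. G_limit \<alpha> \<beta> (\<lambda>l. Y l \<omega>)) \<in> borel_measurable M"
      by (rule measurable_G_limit[OF assms(1)])
    fix \<phi> :: "C01 \<Rightarrow> real" and B C
    assume "\<And>x. \<bar>\<phi> x\<bar> \<le> B" "\<And>x y. \<bar>\<phi> x - \<phi> y\<bar> \<le> C * dist x y" "0 \<le> C"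
    then show "((\<lambda>q. \<integral>k. \<phi> (G_finite q \<alpha> \<beta> k) \<partial>uniform_count_measure {..<q}) \<longlongrightarrow>
        (\<integral>\<omega>. \<phi> (G_limit \<alpha> \<beta> (\<lambda>l. Y l \<omega>)) \<partial>M)) primes_at_top"
      by (intro lipschitz_functional_tendsto[OF assms(1)])
  qed (rule assms(2))
qed

end
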